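(* Let $\mathcal M$ be any Mackey 2-functor for $(\mathbb G;\mathbb J)$. Then: (1) The Hom-decategorification $M=M(\{X_G,X_G,\lambda_u,\lambda_u^{-1}\}_{G,u})$ of $\mathcal M$ for any coherent choice of objects such that $X_G=Y_G$ and $\rho_u=\lambda_u^{-1}$ is an ordinary Green functor for $(\mathbb G;\mathbb J)$. As a ring, each $M(G)$ is just $\mathrm{End}_{\mathcal M(G)}(X_G)$. The resulting Green functors are commutative if the endomorphism ring of each $X_G$ is commutative. (2) Similarly, the Hom-decategorification for any coherent choice $\{X_G,Y_G,\lambda_u,\rho_u\}$ of pairs of objects in $\mathcal M$ is a left module over $M(\{Y_G,Y_G,\rho_u^{-1},\rho_u\}_{G,u})$ and a right module over $M(\{X_G,X_G,\lambda_u,\lambda_u^{-1}\}_{G,u})$, the latter two being the endomorphism Green functors as in (1).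
   Context: Fix a commutative ring $\Bbbk$. $\mathbb A$ denotes either $\mathsf{ADD}_\Bbbk$, the 2-category of (possibly large) additive $\Bbbk$-linear categories, $\Bbbk$-linear functors and natural transformations, or its full 2-subcategory of idempotent complete ones. A spannable pair $(\mathbb G;\mathbb J)$ consists of: (1) an essentially small $(2,1)$-category $\mathbb G$ (Hom categories are small groupoids; up to equivalence only a small set of objects), which (2) is extensive (it has finite coproducts and for all $G,H$ the pseudofunctor $\mathbb G/G\times\mathbb G/H\to\mathbb G/(G\sqcup H)$, $(u,v)\mapsto u\sqcup v$, is a biequivalence); (3) a 2-full 2-subcategory $\mathbb J\subseteq\mathbb G$ containing all equivalences and closed under isomorphic 1-cells, such that (4) for $i\colon H\to G$ in $\mathbb J$ and any $u\colon K\to G$ there is a pseudopullback ("Mackey square") $p\colon P\to H$, $q\colon P\to K$, $\gamma\colon ip\overset{\sim}{\Rightarrow}uq$, with $q\in\mathbb J$; and (5) for every finite family $u_\ell\colon H_\ell\to G$, the induced $\sqcup_\ell H_\ell\to G$ is in $\mathbb J$ iff every $u_\ell$ is. A Mackey 2-functor for $(\mathbb G;\mathbb J)$ is a 2-functor $\mathcal M\colon\mathbb G^{op}\to\mathbb A$ (write $u^*=\mathcal M(u)$) such that: (1) it sends finite coproducts to direct sums; (2) for $i\in\mathbb J$, $i^*$ has a left adjoint $i_!$ and a right adjoint $i_*$; (3) for every Mackey square with $i,q\in\mathbb J$ the mates $\gamma_!\colon q_!p^*\Rightarrow u^*i_!$ and $(\gamma^{-1})_*\colon u^*i_*\Rightarrow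 q_*p^*$ are invertible; (4) $i_!\simeq i_*$ for $i\in\mathbb J$. Standing assumption: all Mackey 2-functors are rectified, i.e. come with chosen adjunctions $(i_!\dashv i^*,{}^\ell\eta,{}^\ell\varepsilon)$ and $(i^*\dashv i_*,{}^r\eta,{}^r\varepsilon)$ for $i\in\mathbb J$ with $i_!=i_*$ as functors, the pseudofunctors $i\mapsto i_!$ and $i\mapsto i_*$ on $\mathbb J$ equal, $(\gamma_!)^{-1}=(\gamma^{-1})_*$ for all Mackey squares, and ${}^r\varepsilon\circ{}^\ell\eta=\mathrm{id}$. An ordinary Mackey functor $M$ for $(\mathbb G;\mathbb J)$: $\Bbbk$-modules $M(G)$, $\Bbbk$-linear maps $u^\bullet\colon M(G)\to M(H)$ for $u\colon H\to G$ in $\mathbb G$ and $u_\bullet\colon M(H)\to M(G)$ if $u\in\mathbb J$, functorial, depending only on isomorphism classes of 1-cells, with $(i^\bullet,j^\bullet)\colon M(G\sqcup H)\cong M(G)\oplus M(H)$ inverse to $(i_\bullet,j_\bullet)$ for coproduct inclusions $i,j$, and $u^\bullet i_\bullet=q_\bullet p^\bullet$ for Mackey squares. An ordinary Green functor is a Mackey functor with an associative unital $\Bbbk$-algebra structure on each $M(G)$ such that $u^\bullet(xy)=u^\bullet(x)u^\bullet(y)$ for all $u$ and, for $u\in\mathbb J$, $x\cdot u_\bullet(y)=u_\bullet(u^\bullet(x)\cdot y)$ and $u_\bullet(y)\cdot x=u_\bullet(y\cdot u^\bullet(x))$. A left (right) module over $M$ is a Mackey functor $N$ with left (right) $M(G)$-module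 structures on $N(G)$ satisfying the analogous formulas (compatibility with $u^\bullet$, and both Frobenius formulas for $u\in\mathbb J$). A coherent family of pairs $\{X_G,Y_G,\lambda_u,\rho_u\}$ in $\mathcal M$: objects $X_G,Y_G\in\mathcal M(G)$ for all $G$, and isomorphisms $\lambda_u\colon X_H\xrightarrow{\sim}u^*X_G$, $\rho_u\colon u^*Y_G\xrightarrow{\sim}Y_H$ for all $u\colon H\to G$, with $\lambda_{\mathrm{Id}}=\mathrm{id}$, $\rho_{\mathrm{Id}}=\mathrm{id}$, $\lambda_{uv}=v^*(\lambda_u)\lambda_v$, $\rho_{uv}=\rho_v\,v^*(\rho_u)$, and $\alpha^*_{X_G}\lambda_u=\lambda_v$, $\rho_v\alpha^*_{Y_G}=\rho_u$ for each 2-cell $\alpha\colon u\Rightarrow v$ (with $\alpha^*=\mathcal M(\alpha)\colon u^*\Rightarrow v^*$). Its Hom-decategorification is the ordinary Mackey functor $M(\{X_G,Y_G,\lambda_u,\rho_u\}_{G,u})$ with $M(G)=\mathrm{Hom}_{\mathcal M(G)}(X_G,Y_G)$, $u^\bullet(\varphi)=\rho_u\circ u^*(\varphi)\circ\lambda_u$, and $u_\bullet(\psi)={}^\ell\varepsilon\circ u_*(\rho_u^{-1}\psi\lambda_u^{-1})\circ{}^r\eta$ for $u\in\mathbb J$. The products and actions in the theorem are given by composition of morphisms. *)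

theory Defs
  imports "HOL-Algebra.Module" "HOL-Library.Equipollence"
begin

section \<open>Categories, functors, adjunctions\<close>

text \<open>Categories have a set of objects and a set of arrows, so every arrow has one source and one
  target and the Hom sets are pairwise disjoint. All operations are meaningful on the carriers only.\<close>

record ('o, 'm) cat =
  Ob :: "'o set"
  Ar :: "'m set"
  Src :: "'m \<Rightarrow> 'o"
  Tgt :: "'m \<Rightarrow> 'o"
  Ide :: "'o \<Rightarrow> 'm"
  Cmp :: "'m \<Rightarrow> 'm \<Rightarrow> 'm" (infixl "\<cdot>\<index>" 70)

definition Hom :: "('o, 'm, 'z) cat_scheme \<Rightarrow> 'o \<Rightarrow> 'o \<Rightarrow> 'm set" where
  "Hom C x y = {f \<in> Ar C. Src C f = x \<and> Tgt C f = y}"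

locale category =
  fixes C :: "('o, 'm, 'z) cat_scheme"
  assumes Src_in_Ob: "f \<in> Ar C \<Longrightarrow> Src C f \<in> Ob C"
    and Tgt_in_Ob: "f \<in> Ar C \<Longrightarrow> Tgt C f \<in> Ob C"
    and Ide_in_Hom: "x \<in> Ob C \<Longrightarrow> Ide C x \<in> Hom C x x"
    and Cmp_in_Hom: "f \<in> Hom C x y \<Longrightarrow> g \<in> Hom C y z \<Longrightarrow> g \<cdot>\<^bsub>C\<^esub> f \<in> Hom C x z"
    and Cmp_Ide: "f \<in> Hom C x y \<Longrightarrow> f \<cdot>\<^bsub>C\<^esub> Ide C x = f"
    and Ide_Cmp: "f \<in> Hom C x y \<Longrightarrow> Ide C y \<cdot>\<^bsub>C\<^esub> f = f"
    and Cmp_assoc: "f \<in> Hom C w x \<Longrightarrow> g \<in> Hom C x y \<Longrightarrow> h \<in> Hom C y z \<Longrightarrow>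
      (h \<cdot>\<^bsub>C\<^esub> g) \<cdot>\<^bsub>C\<^esub> f = h \<cdot>\<^bsub>C\<^esub> (g \<cdot>\<^bsub>C\<^esub> f)"

definition inverse_arrows :: "('o, 'm, 'z) cat_scheme \<Rightarrow> 'm \<Rightarrow> 'm \<Rightarrow> bool" where
  "inverse_arrows C f g \<longleftrightarrow> f \<in> Ar C \<and> g \<in> Hom C (Tgt C f) (Src C f) \<and>
     g \<cdot>\<^bsub>C\<^esub> f = Ide C (Src C f) \<and> f \<cdot>\<^bsub>C\<^esub> g = Ide C (Tgt C f)"

definition is_iso :: "('o, 'm, 'z) cat_scheme \<Rightarrow> 'm \<Rightarrow> bool" where
  "is_iso C f \<longleftrightarrow> (\<exists>g. inverse_arrows C f g)"

definition inv_arr :: "('o, 'm, 'z) cat_scheme \<Rightarrow> 'm \<Rightarrow> 'm" where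
  "inv_arr C f = (THE g. inverse_arrows C f g)"

record ('o, 'm, 'p, 'n) func =
  FO :: "'o \<Rightarrow> 'p"
  FA :: "'m \<Rightarrow> 'n"

definition func_id :: "('o, 'm, 'o, 'm) func" where
  "func_id = \<lparr>FO = (\<lambda>x. x), FA = (\<lambda>f. f)\<rparr>"

definition func_comp :: "('p, 'n, 'q, 'l) func \<Rightarrow> ('o, 'm, 'p, 'n) func \<Rightarrow> ('o, 'm, 'q, 'l) func" where
  "func_comp E F = \<lparr>FO = FO E \<circ> FO F, FA = FA E \<circ> FA F\<rparr>"

definition func_eq :: "('o, 'm, 'z) cat_scheme \<Rightarrow> ('o, 'm, 'p, 'n) func \<Rightarrow> ('o, 'm, 'p, 'n) func \<Rightarrow> bool" where
  "func_eq C F E \<longleftrightarrow> (\<forall>x \<in> Ob C. FO F x = FO E x) \<and> (\<forall>f \<in> Ar C. FA F f = FA E f)"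

definition is_functor ::
  "('o, 'm, 'y) cat_scheme \<Rightarrow> ('p, 'n, 'z) cat_scheme \<Rightarrow> ('o, 'm, 'p, 'n) func \<Rightarrow> bool" where
  "is_functor C D F \<longleftrightarrow>
     (\<forall>x \<in> Ob C. FO F x \<in> Ob D) \<and>
     (\<forall>x \<in> Ob C. \<forall>y \<in> Ob C. \<forall>f \<in> Hom C x y. FA F f \<in> Hom D (FO F x) (FO F y)) \<and>
     (\<forall>x \<in> Ob C. FA F (Ide C x) = Ide D (FO F x)) \<and>
     (\<forall>f \<in> Ar C. \<forall>g \<in> Ar C. Src C g = Tgt C f \<longrightarrow> FA F (g \<cdot>\<^bsub>C\<^esub> f) = FA F g \<cdot>\<^bsub>D\<^esub> FA F f)"

definition is_equivalence_functor ::
  "('o, 'm, 'y) cat_scheme \<Rightarrow> ('p, 'n, 'z) cat_scheme \<Rightarrow> ('o, 'm, 'p, 'n) func \<Rightarrow> bool" where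
  "is_equivalence_functor C D F \<longleftrightarrow>
     is_functor C D F \<and>
     (\<forall>x \<in> Ob C. \<forall>y \<in> Ob C. bij_betw (FA F) (Hom C x y) (Hom D (FO F x) (FO F y))) \<and>
     (\<forall>z \<in> Ob D. \<exists>x \<in> Ob C. \<exists>f \<in> Hom D (FO F x) z. is_iso D f)"

definition nat_trans ::
  "('o, 'm, 'y) cat_scheme \<Rightarrow> ('p, 'n, 'z) cat_scheme \<Rightarrow>
   ('o, 'm, 'p, 'n) func \<Rightarrow> ('o, 'm, 'p, 'n) func \<Rightarrow> ('o \<Rightarrow> 'n) \<Rightarrow> bool" where
  "nat_trans C D F E \<tau> \<longleftrightarrow>
     (\<forall>x \<in> Ob C. \<tau> x \<in> Hom D (FO F x) (FO E x)) \<and>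
     (\<forall>f \<in> Ar C. \<tau> (Tgt C f) \<cdot>\<^bsub>D\<^esub> FA F f = FA E f \<cdot>\<^bsub>D\<^esub> \<tau> (Src C f))"

definition functors_isomorphic ::
  "('o, 'm, 'y) cat_scheme \<Rightarrow> ('p, 'n, 'z) cat_scheme \<Rightarrow>
   ('o, 'm, 'p, 'n) func \<Rightarrow> ('o, 'm, 'p, 'n) func \<Rightarrow> bool" where
  "functors_isomorphic C D F E \<longleftrightarrow> (\<exists>\<tau>. nat_trans C D F E \<tau> \<and> (\<forall>x \<in> Ob C. is_iso D (\<tau> x)))"

text \<open>\<open>adjunction C D F U \<eta> \<epsilon>\<close>: the functor \<open>F: C \<rightarrow> D\<close> is left adjoint to \<open>U: D \<rightarrow> C\<close>.\<close>

definition adjunction ::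
  "('o, 'm, 'y) cat_scheme \<Rightarrow> ('p, 'n, 'z) cat_scheme \<Rightarrow>
   ('o, 'm, 'p, 'n) func \<Rightarrow> ('p, 'n, 'o, 'm) func \<Rightarrow> ('o \<Rightarrow> 'm) \<Rightarrow> ('p \<Rightarrow> 'n) \<Rightarrow> bool" where
  "adjunction C D F U \<eta> \<epsilon> \<longleftrightarrow>
     is_functor C D F \<and> is_functor D C U \<and>
     nat_trans C C func_id (func_comp U F) \<eta> \<and>
     nat_trans D D (func_comp F U) func_id \<epsilon> \<and>
     (\<forall>x \<in> Ob C. \<epsilon> (FO F x) \<cdot>\<^bsub>D\<^esub> FA F (\<eta> x) = Ide D (FO F x)) \<and>
     (\<forall>y \<in> Ob D. FA U (\<epsilon> y) \<cdot>\<^bsub>C\<^esub> \<eta> (FO U y) = Ide C (FO U y))"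

definition pair_cat ::
  "('o, 'm, 'y) cat_scheme \<Rightarrow> ('p, 'n, 'z) cat_scheme \<Rightarrow> ('o \<times> 'p, 'm \<times> 'n) cat" where
  "pair_cat C D =
     \<lparr>Ob = Ob C \<times> Ob D, Ar = Ar C \<times> Ar D,
      Src = (\<lambda>(f, g). (Src C f, Src D g)), Tgt = (\<lambda>(f, g). (Tgt C f, Tgt D g)),
      Ide = (\<lambda>(x, y). (Ide C x, Ide D y)),
      Cmp = (\<lambda>(f', g') (f, g). (f' \<cdot>\<^bsub>C\<^esub> f, g' \<cdot>\<^bsub>D\<^esub> g))\<rparr>"

definition list_cat :: "('o, 'm, 'z) cat_scheme list \<Rightarrow> ('o list, 'm list) cat" where
  "list_cat Cs =
     \<lparr>Ob = {xs. list_all2 (\<lambda>x C. x \<in> Ob C) xs Cs},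
      Ar = {fs. list_all2 (\<lambda>f C. f \<in> Ar C) fs Cs},
      Src = (\<lambda>fs. map2 Src Cs fs), Tgt = (\<lambda>fs. map2 Tgt Cs fs),
      Ide = (\<lambda>xs. map2 Ide Cs xs),
      Cmp = (\<lambda>gs fs. map2 (\<lambda>C (g, f). g \<cdot>\<^bsub>C\<^esub> f) Cs (zip gs fs))\<rparr>"


section \<open>Additive linear categories\<close>

record ('k, 'o, 'm) lincat = "('o, 'm) cat" +
  Zero :: "'o \<Rightarrow> 'o \<Rightarrow> 'm"
  Add :: "'m \<Rightarrow> 'm \<Rightarrow> 'm"
  Scal :: "'k \<Rightarrow> 'm \<Rightarrow> 'm"

text \<open>The library's module records extend ring records; for a mere module the fields \<open>mult\<close> and
  \<open>one\<close> play no role.\<close>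

definition hom_module :: "('k, 'o, 'm, 'z) lincat_scheme \<Rightarrow> 'o \<Rightarrow> 'o \<Rightarrow> ('k, 'm) module" where
  "hom_module C x y =
     \<lparr>carrier = Hom C x y, monoid.mult = undefined, one = undefined,
      zero = Zero C x y, add = Add C, smult = Scal C\<rparr>"

definition End_ring :: "('k, 'o, 'm, 'z) lincat_scheme \<Rightarrow> 'o \<Rightarrow> 'm ring" where
  "End_ring C x =
     \<lparr>carrier = Hom C x x, monoid.mult = Cmp C, one = Ide C x, zero = Zero C x x, add = Add C\<rparr>"

locale linear_category = category C + cring k
  for k :: "'k ring" and C :: "('k, 'o, 'm) lincat" +
  assumes Hom_module: "x \<in> Ob C \<Longrightarrow> y \<in> Ob C \<Longrightarrow> module k (hom_module C x y)"
    and Cmp_Add_left: "f \<in> Hom C x y \<Longrightarrow> g \<in> Hom C y z \<Longrightarrow> g' \<in> Hom C y z \<Longrightarrow>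
      Add C g g' \<cdot>\<^bsub>C\<^esub> f = Add C (g \<cdot>\<^bsub>C\<^esub> f) (g' \<cdot>\<^bsub>C\<^esub> f)"
    and Cmp_Add_right: "f \<in> Hom C x y \<Longrightarrow> f' \<in> Hom C x y \<Longrightarrow> g \<in> Hom C y z \<Longrightarrow>
      g \<cdot>\<^bsub>C\<^esub> Add C f f' = Add C (g \<cdot>\<^bsub>C\<^esub> f) (g \<cdot>\<^bsub>C\<^esub> f')"
    and Cmp_Scal_left: "c \<in> carrier k \<Longrightarrow> f \<in> Hom C x y \<Longrightarrow> g \<in> Hom C y z \<Longrightarrow>
      Scal C c g \<cdot>\<^bsub>C\<^esub> f = Scal C c (g \<cdot>\<^bsub>C\<^esub> f)"
    and Cmp_Scal_right: "c \<in> carrier k \<Longrightarrow> f \<in> Hom C x y \<Longrightarrow> g \<in> Hom C y z \<Longrightarrow>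
      g \<cdot>\<^bsub>C\<^esub> Scal C c f = Scal C c (g \<cdot>\<^bsub>C\<^esub> f)"

definition zero_object :: "('o, 'm, 'z) cat_scheme \<Rightarrow> 'o \<Rightarrow> bool" where
  "zero_object C z \<longleftrightarrow> z \<in> Ob C \<and> (\<forall>x \<in> Ob C. (\<exists>!f. f \<in> Hom C x z) \<and> (\<exists>!f. f \<in> Hom C z x))"

definition biproduct ::
  "('k, 'o, 'm, 'z) lincat_scheme \<Rightarrow> 'o \<Rightarrow> 'o \<Rightarrow> 'o \<Rightarrow> 'm \<Rightarrow> 'm \<Rightarrow> 'm \<Rightarrow> 'm \<Rightarrow> bool" where
  "biproduct C x y s i j p q \<longleftrightarrow>
     s \<in> Ob C \<and> i \<in> Hom C x s \<and> j \<in> Hom C y s \<and> p \<in> Hom C s x \<and> q \<in> Hom C s y \<and>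
     p \<cdot>\<^bsub>C\<^esub> i = Ide C x \<and> q \<cdot>\<^bsub>C\<^esub> j = Ide C y \<and>
     p \<cdot>\<^bsub>C\<^esub> j = Zero C y x \<and> q \<cdot>\<^bsub>C\<^esub> i = Zero C x y \<and>
     Add C (i \<cdot>\<^bsub>C\<^esub> p) (j \<cdot>\<^bsub>C\<^esub> q) = Ide C s"

locale additive_category = linear_category k C
  for k :: "'k ring" and C :: "('k, 'o, 'm) lincat" +
  assumes has_zero_object: "\<exists>z. zero_object C z"
    and has_biproducts: "x \<in> Ob C \<Longrightarrow> y \<in> Ob C \<Longrightarrow> \<exists>s i j p q. biproduct C x y s i j p q"

definition idempotent_complete :: "('o, 'm, 'z) cat_scheme \<Rightarrow> bool" where
  "idempotent_complete C \<longleftrightarrow>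
     (\<forall>x \<in> Ob C. \<forall>e \<in> Hom C x x. e \<cdot>\<^bsub>C\<^esub> e = e \<longrightarrow>
        (\<exists>y \<in> Ob C. \<exists>r \<in> Hom C x y. \<exists>s \<in> Hom C y x. s \<cdot>\<^bsub>C\<^esub> r = e \<and> r \<cdot>\<^bsub>C\<^esub> s = Ide C y))"

text \<open>The two possible target 2-categories: all additive linear categories, or only the
  idempotent complete ones.\<close>

datatype ambient = ADD | ADD_idempotent_complete

definition in_ambient :: "'k ring \<Rightarrow> ambient \<Rightarrow> ('k, 'o, 'm) lincat \<Rightarrow> bool" where
  "in_ambient k A C \<longleftrightarrow> additive_category k C \<and> (A = ADD_idempotent_complete \<longrightarrow> idempotent_complete C)"

definition linear_functor ::
  "'k ring \<Rightarrow> ('k, 'o, 'm) lincat \<Rightarrow> ('k, 'p, 'n) lincat \<Rightarrow> ('o, 'm, 'p, 'n) func \<Rightarrow> bool" where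
  "linear_functor k C D F \<longleftrightarrow>
     is_functor C D F \<and>
     (\<forall>x \<in> Ob C. \<forall>y \<in> Ob C. \<forall>f \<in> Hom C x y. \<forall>g \<in> Hom C x y.
        FA F (Add C f g) = Add D (FA F f) (FA F g)) \<and>
     (\<forall>c \<in> carrier k. \<forall>f \<in> Ar C. FA F (Scal C c f) = Scal D c (FA F f))"


section \<open>Strict 2-categories\<close>

text \<open>The underlying 1-category is extended by the category \<open>Two\<close> whose objects are the 1-cells,
  whose arrows are the 2-cells and whose composition is the vertical one. \<open>\<star>\<close> is horizontal
  composition, in the same order as the composition of 1-cells.\<close>

record ('g, 'u, 'a) twocat = "('g, 'u) cat" +
  Two :: "('u, 'a) cat"
  HCmp :: "'a \<Rightarrow> 'a \<Rightarrow> 'a" (infixl "\<star>\<index>" 75)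

abbreviation Hom2 :: "('g, 'u, 'a, 'z) twocat_scheme \<Rightarrow> 'u \<Rightarrow> 'u \<Rightarrow> 'a set" where
  "Hom2 G u v \<equiv> Hom (Two G) u v"

abbreviation Ide2 :: "('g, 'u, 'a, 'z) twocat_scheme \<Rightarrow> 'u \<Rightarrow> 'a" where
  "Ide2 G u \<equiv> Ide (Two G) u"

locale two_category = category G + Two: category "Two G"
  for G :: "('g, 'u, 'a) twocat" +
  assumes Ob_Two: "Ob (Two G) = Ar G"
    and parallel: "\<alpha> \<in> Hom2 G u v \<Longrightarrow> Src G u = Src G v \<and> Tgt G u = Tgt G v"
    and HCmp_in_Hom2: "\<alpha> \<in> Hom2 G u u' \<Longrightarrow> \<beta> \<in> Hom2 G v v' \<Longrightarrow> Src G u = Tgt G v \<Longrightarrow>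
      \<alpha> \<star>\<^bsub>G\<^esub> \<beta> \<in> Hom2 G (u \<cdot>\<^bsub>G\<^esub> v) (u' \<cdot>\<^bsub>G\<^esub> v')"
    and HCmp_Ide2: "u \<in> Ar G \<Longrightarrow> v \<in> Ar G \<Longrightarrow> Src G u = Tgt G v \<Longrightarrow>
      Ide2 G u \<star>\<^bsub>G\<^esub> Ide2 G v = Ide2 G (u \<cdot>\<^bsub>G\<^esub> v)"
    and interchange: "\<alpha> \<in> Hom2 G u u' \<Longrightarrow> \<alpha>' \<in> Hom2 G u' u'' \<Longrightarrow>
      \<beta> \<in> Hom2 G v v' \<Longrightarrow> \<beta>' \<in> Hom2 G v' v'' \<Longrightarrow> Src G u = Tgt G v \<Longrightarrow>
      (\<alpha>' \<cdot>\<^bsub>Two G\<^esub> \<alpha>) \<star>\<^bsub>G\<^esub> (\<beta>' \<cdot>\<^bsub>Two G\<^esub> \<beta>) = (\<alpha>' \<star>\<^bsub>G\<^esub> \<beta>') \<cdot>\<^bsub>Two G\<^esub> (\<alpha> \<star>\<^bsub>G\<^esub> \<beta>)"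
    and HCmp_assoc: "\<alpha> \<in> Hom2 G u u' \<Longrightarrow> \<beta> \<in> Hom2 G v v' \<Longrightarrow> \<gamma> \<in> Hom2 G w w' \<Longrightarrow>
      Src G u = Tgt G v \<Longrightarrow> Src G v = Tgt G w \<Longrightarrow>
      (\<alpha> \<star>\<^bsub>G\<^esub> \<beta>) \<star>\<^bsub>G\<^esub> \<gamma> = \<alpha> \<star>\<^bsub>G\<^esub> (\<beta> \<star>\<^bsub>G\<^esub> \<gamma>)"
    and HCmp_unit_right: "\<alpha> \<in> Hom2 G u u' \<Longrightarrow> \<alpha> \<star>\<^bsub>G\<^esub> Ide2 G (Ide G (Src G u)) = \<alpha>"
    and HCmp_unit_left: "\<alpha> \<in> Hom2 G u u' \<Longrightarrow> Ide2 G (Ide G (Tgt G u)) \<star>\<^bsub>G\<^esub> \<alpha> = \<alpha>"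

locale two_one_category = two_category G
  for G :: "('g, 'u, 'a) twocat" +
  assumes two_cells_invertible: "\<alpha> \<in> Ar (Two G) \<Longrightarrow> is_iso (Two G) \<alpha>"

definition hom_cat :: "('g, 'u, 'a, 'z) twocat_scheme \<Rightarrow> 'g \<Rightarrow> 'g \<Rightarrow> ('u, 'a) cat" where
  "hom_cat G x y =
     \<lparr>Ob = Hom G x y, Ar = {\<alpha> \<in> Ar (Two G). Src (Two G) \<alpha> \<in> Hom G x y},
      Src = Src (Two G), Tgt = Tgt (Two G), Ide = Ide (Two G), Cmp = Cmp (Two G)\<rparr>"

definition isomorphic_1cells :: "('g, 'u, 'a, 'z) twocat_scheme \<Rightarrow> 'u \<Rightarrow> 'u \<Rightarrow> bool" where
  "isomorphic_1cells G u v \<longleftrightarrow> (\<exists>\<alpha> \<in> Hom2 G u v. is_iso (Two G) \<alpha>)"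

definition is_equivalence_1cell :: "('g, 'u, 'a, 'z) twocat_scheme \<Rightarrow> 'u \<Rightarrow> bool" where
  "is_equivalence_1cell G u \<longleftrightarrow> u \<in> Ar G \<and>
     (\<exists>v \<in> Hom G (Tgt G u) (Src G u).
        isomorphic_1cells G (v \<cdot>\<^bsub>G\<^esub> u) (Ide G (Src G u)) \<and>
        isomorphic_1cells G (u \<cdot>\<^bsub>G\<^esub> v) (Ide G (Tgt G u)))"

definition equivalent_objects :: "('g, 'u, 'a, 'z) twocat_scheme \<Rightarrow> 'g \<Rightarrow> 'g \<Rightarrow> bool" where
  "equivalent_objects G x y \<longleftrightarrow> (\<exists>u \<in> Hom G x y. is_equivalence_1cell G u)"

text \<open>Smallness is relative to a universe \<open>U\<close>, as usual: a set is small if its cardinality is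
  smaller than that of \<open>U\<close>.\<close>

definition essentially_small :: "'s set \<Rightarrow> ('g, 'u, 'a, 'z) twocat_scheme \<Rightarrow> bool" where
  "essentially_small U G \<longleftrightarrow>
     (\<forall>x \<in> Ob G. \<forall>y \<in> Ob G. Ob (hom_cat G x y) \<prec> U \<and> Ar (hom_cat G x y) \<prec> U) \<and>
     (\<exists>S \<subseteq> Ob G. S \<prec> U \<and> (\<forall>x \<in> Ob G. \<exists>s \<in> S. equivalent_objects G s x))"


section \<open>Coproducts, pseudopullbacks and extensivity\<close>

text \<open>Finite coproducts in the bicategorical sense: the cocone \<open>is\<close> under the finite family \<open>Hs\<close>
  induces equivalences (not necessarily isomorphisms) of Hom categories.\<close>

definition coproduct ::
  "('g, 'u, 'a, 'z) twocat_scheme \<Rightarrow> 'g list \<Rightarrow> 'g \<Rightarrow> 'u list \<Rightarrow> bool" where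
  "coproduct G Hs c is \<longleftrightarrow>
     set Hs \<subseteq> Ob G \<and> c \<in> Ob G \<and> list_all2 (\<lambda>i H. i \<in> Hom G H c) is Hs \<and>
     (\<forall>K \<in> Ob G. is_equivalence_functor (hom_cat G c K) (list_cat (map (\<lambda>H. hom_cat G H K) Hs))
        \<lparr>FO = (\<lambda>w. map (\<lambda>i. w \<cdot>\<^bsub>G\<^esub> i) is), FA = (\<lambda>\<alpha>. map (\<lambda>i. \<alpha> \<star>\<^bsub>G\<^esub> Ide2 G i) is)\<rparr>)"

text \<open>The category of pseudo-commutative squares with vertex \<open>T\<close> over the cospan \<open>(i, u)\<close>. An arrow
  carries its source and target besides its two components.\<close>

definition square_cat ::
  "('g, 'u, 'a, 'z) twocat_scheme \<Rightarrow> 'u \<Rightarrow> 'u \<Rightarrow> 'g \<Rightarrow>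
   ('u \<times> 'u \<times> 'a, ('u \<times> 'u \<times> 'a) \<times> ('u \<times> 'u \<times> 'a) \<times> 'a \<times> 'a) cat" where
  "square_cat G i u T = (let
     obs = {(a, b, \<delta>). a \<in> Hom G T (Src G i) \<and> b \<in> Hom G T (Src G u) \<and>
              \<delta> \<in> Hom2 G (i \<cdot>\<^bsub>G\<^esub> a) (u \<cdot>\<^bsub>G\<^esub> b) \<and> is_iso (Two G) \<delta>} in
     \<lparr>Ob = obs,
      Ar = {((a, b, \<delta>), (a', b', \<delta>'), \<alpha>, \<beta>).
              (a, b, \<delta>) \<in> obs \<and> (a', b', \<delta>') \<in> obs \<and> \<alpha> \<in> Hom2 G a a' \<and> \<beta> \<in> Hom2 G b b' \<and>
              \<delta>' \<cdot>\<^bsub>Two G\<^esub> (Ide2 G i \<star>\<^bsub>G\<^esub> \<alpha>) = (Ide2 G u \<star>\<^bsub>G\<^esub> \<beta>) \<cdot>\<^bsub>Two G\<^esub> \<delta>},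
      Src = (\<lambda>(s, t, \<alpha>, \<beta>). s), Tgt = (\<lambda>(s, t, \<alpha>, \<beta>). t),
      Ide = (\<lambda>(a, b, \<delta>). ((a, b, \<delta>), (a, b, \<delta>), Ide2 G a, Ide2 G b)),
      Cmp = (\<lambda>(s', t', \<alpha>', \<beta>') (s, t, \<alpha>, \<beta>). (s, t', \<alpha>' \<cdot>\<^bsub>Two G\<^esub> \<alpha>, \<beta>' \<cdot>\<^bsub>Two G\<^esub> \<beta>))\<rparr>)"

definition pseudopullback ::
  "('g, 'u, 'a, 'z) twocat_scheme \<Rightarrow> 'u \<Rightarrow> 'u \<Rightarrow> 'u \<Rightarrow> 'u \<Rightarrow> 'a \<Rightarrow> bool" where
  "pseudopullback G i u p q \<gamma> \<longleftrightarrow>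
     i \<in> Ar G \<and> u \<in> Ar G \<and> Tgt G i = Tgt G u \<and>
     p \<in> Hom G (Src G p) (Src G i) \<and> q \<in> Hom G (Src G p) (Src G u) \<and>
     \<gamma> \<in> Hom2 G (i \<cdot>\<^bsub>G\<^esub> p) (u \<cdot>\<^bsub>G\<^esub> q) \<and> is_iso (Two G) \<gamma> \<and>
     (\<forall>T \<in> Ob G. is_equivalence_functor (hom_cat G T (Src G p)) (square_cat G i u T)
        (let F = (\<lambda>t. (p \<cdot>\<^bsub>G\<^esub> t, q \<cdot>\<^bsub>G\<^esub> t, \<gamma> \<star>\<^bsub>G\<^esub> Ide2 G t)) in
         \<lparr>FO = F,
          FA = (\<lambda>\<tau>. (F (Src (Two G) \<tau>), F (Tgt (Two G) \<tau>), Ide2 G p \<star>\<^bsub>G\<^esub> \<tau>, Ide2 G q \<star>\<^bsub>G\<^esub> \<tau>))\<rparr>))"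

text \<open>The slice \<open>G/X\<close>. A 1-cell \<open>(u, v, w, \<gamma>)\<close> from \<open>u\<close> to \<open>v\<close> consists of \<open>w: Src u \<rightarrow> Src v\<close> and an
  invertible \<open>\<gamma>: u \<Rightarrow> v w\<close>; a 2-cell consists of its source, its target and a compatible 2-cell of \<open>G\<close>.\<close>

definition slice ::
  "('g, 'u, 'a, 'z) twocat_scheme \<Rightarrow> 'g \<Rightarrow>
   ('u, 'u \<times> 'u \<times> 'u \<times> 'a, ('u \<times> 'u \<times> 'u \<times> 'a) \<times> ('u \<times> 'u \<times> 'u \<times> 'a) \<times> 'a) twocat" where
  "slice G X = (let
     obs = {u \<in> Ar G. Tgt G u = X};
     ars = {(u, v, w, \<gamma>). u \<in> obs \<and> v \<in> obs \<and> w \<in> Hom G (Src G u) (Src G v) \<and>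
              \<gamma> \<in> Hom2 G u (v \<cdot>\<^bsub>G\<^esub> w) \<and> is_iso (Two G) \<gamma>};
     comp = (\<lambda>(v, x, w', \<gamma>') (u, v', w, \<gamma>).
              (u, x, w' \<cdot>\<^bsub>G\<^esub> w, (\<gamma>' \<star>\<^bsub>G\<^esub> Ide2 G w) \<cdot>\<^bsub>Two G\<^esub> \<gamma>)) in
     \<lparr>Ob = obs, Ar = ars,
      Src = (\<lambda>(u, v, w, \<gamma>). u), Tgt = (\<lambda>(u, v, w, \<gamma>). v),
      Ide = (\<lambda>u. (u, u, Ide G (Src G u), Ide2 G u)),
      Cmp = comp,
      Two =
        \<lparr>Ob = ars,
         Ar = {((u, v, w, \<gamma>), (u', v', w', \<gamma>'), \<alpha>).
                 (u, v, w, \<gamma>) \<in> ars \<and> (u', v', w', \<gamma>') \<in> ars \<and> u = u' \<and> v = v' \<and>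
                 \<alpha> \<in> Hom2 G w w' \<and> (Ide2 G v \<star>\<^bsub>G\<^esub> \<alpha>) \<cdot>\<^bsub>Two G\<^esub> \<gamma> = \<gamma>'},
         Src = (\<lambda>(s, t, \<alpha>). s), Tgt = (\<lambda>(s, t, \<alpha>). t),
         Ide = (\<lambda>(u, v, w, \<gamma>). ((u, v, w, \<gamma>), (u, v, w, \<gamma>), Ide2 G w)),
         Cmp = (\<lambda>(s', t', \<alpha>') (s, t, \<alpha>). (s, t', \<alpha>' \<cdot>\<^bsub>Two G\<^esub> \<alpha>))\<rparr>,
      HCmp = (\<lambda>(s', t', \<alpha>') (s, t, \<alpha>). (comp s' s, comp t' t, \<alpha>' \<star>\<^bsub>G\<^esub> \<alpha>))\<rparr>)"

definition pair_twocat ::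
  "('g, 'u, 'a) twocat \<Rightarrow> ('h, 'v, 'b) twocat \<Rightarrow> ('g \<times> 'h, 'u \<times> 'v, 'a \<times> 'b) twocat" where
  "pair_twocat G H = cat.extend (pair_cat G H)
     \<lparr>Two = pair_cat (Two G) (Two H), HCmp = (\<lambda>(\<alpha>', \<beta>') (\<alpha>, \<beta>). (\<alpha>' \<star>\<^bsub>G\<^esub> \<alpha>, \<beta>' \<star>\<^bsub>H\<^esub> \<beta>))\<rparr>"

text \<open>A pseudofunctor, given by its actions on objects, 1-cells and 2-cells, is a biequivalence if it
  is surjective on objects up to equivalence and an equivalence on all Hom categories. Its coherence
  isomorphisms do not enter this condition.\<close>

definition biequivalence ::
  "('g, 'u, 'a) twocat \<Rightarrow> ('h, 'v, 'b) twocat \<Rightarrow> ('g \<Rightarrow> 'h) \<Rightarrow> ('u \<Rightarrow> 'v) \<Rightarrow> ('a \<Rightarrow> 'b) \<Rightarrow> bool" where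
  "biequivalence G H F0 F1 F2 \<longleftrightarrow>
     (\<forall>x \<in> Ob G. F0 x \<in> Ob H) \<and>
     (\<forall>y \<in> Ob H. \<exists>x \<in> Ob G. equivalent_objects H (F0 x) y) \<and>
     (\<forall>x \<in> Ob G. \<forall>y \<in> Ob G.
        is_equivalence_functor (hom_cat G x y) (hom_cat H (F0 x) (F0 y)) \<lparr>FO = F1, FA = F2\<rparr>)"

definition has_finite_coproducts :: "('g, 'u, 'a, 'z) twocat_scheme \<Rightarrow> bool" where
  "has_finite_coproducts G \<longleftrightarrow> (\<forall>Hs. set Hs \<subseteq> Ob G \<longrightarrow> (\<exists>c is. coproduct G Hs c is))"

text \<open>The pseudofunctor \<open>\<squnion>\<close> depends on a choice of binary coproducts \<open>cop\<close> with inclusions \<open>inl\<close>,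
  \<open>inr\<close>, and of 1-cells \<open>u \<squnion> v\<close> induced by \<open>u\<close> and \<open>v\<close>, with invertible 2-cells
  \<open>\<theta>: (u \<squnion> v) inl \<Rightarrow> inl u\<close> and \<open>\<theta>': (u \<squnion> v) inr \<Rightarrow> inr v\<close>.\<close>

definition chosen_coproduct :: "('g, 'u, 'a, 'z) twocat_scheme \<Rightarrow> 'g \<Rightarrow> 'g \<Rightarrow> 'g \<times> 'u \<times> 'u" where
  "chosen_coproduct G x y = (SOME (c, i, j). coproduct G [x, y] c [i, j])"

definition cop :: "('g, 'u, 'a, 'z) twocat_scheme \<Rightarrow> 'g \<Rightarrow> 'g \<Rightarrow> 'g" where
  "cop G x y = fst (chosen_coproduct G x y)"

definition inl :: "('g, 'u, 'a, 'z) twocat_scheme \<Rightarrow> 'g \<Rightarrow> 'g \<Rightarrow> 'u" where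
  "inl G x y = fst (snd (chosen_coproduct G x y))"

definition inr :: "('g, 'u, 'a, 'z) twocat_scheme \<Rightarrow> 'g \<Rightarrow> 'g \<Rightarrow> 'u" where
  "inr G x y = snd (snd (chosen_coproduct G x y))"

definition chosen_sum :: "('g, 'u, 'a, 'z) twocat_scheme \<Rightarrow> 'u \<Rightarrow> 'u \<Rightarrow> 'u \<times> 'a \<times> 'a" where
  "chosen_sum G u v = (SOME (s, \<theta>, \<theta>').
     s \<in> Hom G (cop G (Src G u) (Src G v)) (cop G (Tgt G u) (Tgt G v)) \<and>
     \<theta> \<in> Hom2 G (s \<cdot>\<^bsub>G\<^esub> inl G (Src G u) (Src G v)) (inl G (Tgt G u) (Tgt G v) \<cdot>\<^bsub>G\<^esub> u) \<and>
     is_iso (Two G) \<theta> \<and>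
     \<theta>' \<in> Hom2 G (s \<cdot>\<^bsub>G\<^esub> inr G (Src G u) (Src G v)) (inr G (Tgt G u) (Tgt G v) \<cdot>\<^bsub>G\<^esub> v) \<and>
     is_iso (Two G) \<theta>')"

definition sum1 :: "('g, 'u, 'a, 'z) twocat_scheme \<Rightarrow> 'u \<Rightarrow> 'u \<Rightarrow> 'u" where
  "sum1 G u v = fst (chosen_sum G u v)"

definition sum_inl :: "('g, 'u, 'a, 'z) twocat_scheme \<Rightarrow> 'u \<Rightarrow> 'u \<Rightarrow> 'a" where
  "sum_inl G u v = fst (snd (chosen_sum G u v))"

definition sum_inr :: "('g, 'u, 'a, 'z) twocat_scheme \<Rightarrow> 'u \<Rightarrow> 'u \<Rightarrow> 'a" where
  "sum_inr G u v = snd (snd (chosen_sum G u v))"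

text \<open>For \<open>\<alpha>: w \<Rightarrow> w'\<close> and \<open>\<beta>: z \<Rightarrow> z'\<close>, the 2-cell \<open>\<alpha> \<squnion> \<beta>: w \<squnion> z \<Rightarrow> w' \<squnion> z'\<close>.\<close>

definition sum2 :: "('g, 'u, 'a, 'z) twocat_scheme \<Rightarrow> 'a \<Rightarrow> 'a \<Rightarrow> 'a" where
  "sum2 G \<alpha> \<beta> = (let
     w = Src (Two G) \<alpha>; w' = Tgt (Two G) \<alpha>; z = Src (Two G) \<beta>; z' = Tgt (Two G) \<beta>;
     K = Src G w; L = Src G z; K' = Tgt G w; L' = Tgt G z in
     THE \<sigma>. \<sigma> \<in> Hom2 G (sum1 G w z) (sum1 G w' z') \<and>
       sum_inl G w' z' \<cdot>\<^bsub>Two G\<^esub> (\<sigma> \<star>\<^bsub>G\<^esub> Ide2 G (inl G K L)) =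
         (Ide2 G (inl G K' L') \<star>\<^bsub>G\<^esub> \<alpha>) \<cdot>\<^bsub>Two G\<^esub> sum_inl G w z \<and>
       sum_inr G w' z' \<cdot>\<^bsub>Two G\<^esub> (\<sigma> \<star>\<^bsub>G\<^esub> Ide2 G (inr G K L)) =
         (Ide2 G (inr G K' L') \<star>\<^bsub>G\<^esub> \<beta>) \<cdot>\<^bsub>Two G\<^esub> sum_inr G w z)"

text \<open>The 1-cell of the slice over the coproduct induced by \<open>(w, \<gamma>: u \<Rightarrow> u' w)\<close> and
  \<open>(z, \<delta>: v \<Rightarrow> v' z)\<close>: its 2-cell \<open>\<sigma>: u \<squnion> v \<Rightarrow> (u' \<squnion> v') (w \<squnion> z)\<close> restricts to \<open>\<gamma>\<close> and \<open>\<delta>\<close>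
  along the inclusions.\<close>

definition slice_sum1 ::
  "('g, 'u, 'a, 'z) twocat_scheme \<Rightarrow>
   ('u \<times> 'u \<times> 'u \<times> 'a) \<times> ('u \<times> 'u \<times> 'u \<times> 'a) \<Rightarrow> 'u \<times> 'u \<times> 'u \<times> 'a" where
  "slice_sum1 G = (\<lambda>((u, u', w, \<gamma>), (v, v', z, \<delta>)).
     (sum1 G u v, sum1 G u' v', sum1 G w z,
      THE \<sigma>. \<sigma> \<in> Hom2 G (sum1 G u v) (sum1 G u' v' \<cdot>\<^bsub>G\<^esub> sum1 G w z) \<and>
        (sum_inl G u' v' \<star>\<^bsub>G\<^esub> Ide2 G w) \<cdot>\<^bsub>Two G\<^esub> (Ide2 G (sum1 G u' v') \<star>\<^bsub>G\<^esub> sum_inl G w z)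
            \<cdot>\<^bsub>Two G\<^esub> (\<sigma> \<star>\<^bsub>G\<^esub> Ide2 G (inl G (Src G u) (Src G v))) =
          (Ide2 G (inl G (Tgt G u) (Tgt G v)) \<star>\<^bsub>G\<^esub> \<gamma>) \<cdot>\<^bsub>Two G\<^esub> sum_inl G u v \<and>
        (sum_inr G u' v' \<star>\<^bsub>G\<^esub> Ide2 G z) \<cdot>\<^bsub>Two G\<^esub> (Ide2 G (sum1 G u' v') \<star>\<^bsub>G\<^esub> sum_inr G w z)
            \<cdot>\<^bsub>Two G\<^esub> (\<sigma> \<star>\<^bsub>G\<^esub> Ide2 G (inr G (Src G u) (Src G v))) =
          (Ide2 G (inr G (Tgt G u) (Tgt G v)) \<star>\<^bsub>G\<^esub> \<delta>) \<cdot>\<^bsub>Two G\<^esub> sum_inr G u v))"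

definition slice_sum2 ::
  "('g, 'u, 'a, 'z) twocat_scheme \<Rightarrow>
   (('u \<times> 'u \<times> 'u \<times> 'a) \<times> ('u \<times> 'u \<times> 'u \<times> 'a) \<times> 'a) \<times>
   (('u \<times> 'u \<times> 'u \<times> 'a) \<times> ('u \<times> 'u \<times> 'u \<times> 'a) \<times> 'a) \<Rightarrow>
   ('u \<times> 'u \<times> 'u \<times> 'a) \<times> ('u \<times> 'u \<times> 'u \<times> 'a) \<times> 'a" where
  "slice_sum2 G = (\<lambda>((s, s', \<alpha>), (t, t', \<beta>)).
     (slice_sum1 G (s, t), slice_sum1 G (s', t'), sum2 G \<alpha> \<beta>))"

definition extensive :: "('g, 'u, 'a) twocat \<Rightarrow> bool" where
  "extensive G \<longleftrightarrow> has_finite_coproducts G \<and>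
     (\<forall>x \<in> Ob G. \<forall>y \<in> Ob G.
        biequivalence (pair_twocat (slice G x) (slice G y)) (slice G (cop G x y))
          (\<lambda>(u, v). sum1 G u v) (slice_sum1 G) (slice_sum2 G))"


section \<open>Spannable pairs\<close>

text \<open>A 2-full 2-subcategory containing all equivalences contains all objects and all 2-cells between
  its 1-cells, so it is given by its set \<open>J\<close> of 1-cells.\<close>

locale spannable_pair = two_one_category G
  for U :: "'s set" and G :: "('g, 'u, 'a) twocat" and J :: "'u set" +
  assumes essentially_small: "essentially_small U G"
    and extensive: "extensive G"
    and J_subset: "J \<subseteq> Ar G"
    and J_Cmp: "i \<in> J \<Longrightarrow> j \<in> J \<Longrightarrow> Src G i = Tgt G j \<Longrightarrow> i \<cdot>\<^bsub>G\<^esub> j \<in> J"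
    and J_equivalence: "is_equivalence_1cell G u \<Longrightarrow> u \<in> J"
    and J_isomorphic: "i \<in> J \<Longrightarrow> isomorphic_1cells G i v \<Longrightarrow> v \<in> J"
    and J_pseudopullback: "i \<in> J \<Longrightarrow> u \<in> Ar G \<Longrightarrow> Tgt G u = Tgt G i \<Longrightarrow>
      \<exists>p q \<gamma>. pseudopullback G i u p q \<gamma> \<and> q \<in> J"
    and J_coproduct: "coproduct G Hs c is \<Longrightarrow> w \<in> Hom G c X \<Longrightarrow>
      list_all2 (\<lambda>v H. v \<in> Hom G H X) us Hs \<Longrightarrow>
      list_all2 (\<lambda>i v. isomorphic_1cells G (w \<cdot>\<^bsub>G\<^esub> i) v) is us \<Longrightarrow>
      w \<in> J \<longleftrightarrow> set us \<subseteq> J"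

definition mackey_square ::
  "('g, 'u, 'a, 'z) twocat_scheme \<Rightarrow> 'u set \<Rightarrow> 'u \<Rightarrow> 'u \<Rightarrow> 'u \<Rightarrow> 'u \<Rightarrow> 'a \<Rightarrow> bool" where
  "mackey_square G J i u p q \<gamma> \<longleftrightarrow> pseudopullback G i u p q \<gamma> \<and> i \<in> J \<and> q \<in> J"


section \<open>Mackey 2-functors\<close>

text \<open>For \<open>u: H \<rightarrow> G\<close>, \<open>Pull u\<close> is the functor \<open>u\<^sup>*\<close> from \<open>Val G\<close> to \<open>Val H\<close>; for a 2-cell \<open>\<alpha>: u \<Rightarrow> v\<close>,
  \<open>Cell \<alpha> X\<close> is the component at \<open>X\<close> of \<open>\<alpha>\<^sup>*: u\<^sup>* \<Rightarrow> v\<^sup>*\<close>. All \<open>Val G\<close> share the types \<open>'o\<close> and \<open>'m\<close>,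
  which is no restriction since these may be taken to be disjoint sums.\<close>

record ('k, 'g, 'u, 'a, 'o, 'm) twofun =
  Val :: "'g \<Rightarrow> ('k, 'o, 'm) lincat"
  Pull :: "'u \<Rightarrow> ('o, 'm, 'o, 'm) func"
  Cell :: "'a \<Rightarrow> 'o \<Rightarrow> 'm"

locale two_functor_op =
  fixes k :: "'k ring" and A :: ambient and G :: "('g, 'u, 'a) twocat"
    and M :: "('k, 'g, 'u, 'a, 'o, 'm, 'z) twofun_scheme"
  assumes Val_ambient: "x \<in> Ob G \<Longrightarrow> in_ambient k A (Val M x)"
    and Pull_functor: "u \<in> Ar G \<Longrightarrow> linear_functor k (Val M (Tgt G u)) (Val M (Src G u)) (Pull M u)"
    and Pull_Ide: "x \<in> Ob G \<Longrightarrow> func_eq (Val M x) (Pull M (Ide G x)) func_id"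
    and Pull_Cmp: "u \<in> Ar G \<Longrightarrow> v \<in> Ar G \<Longrightarrow> Src G u = Tgt G v \<Longrightarrow>
      func_eq (Val M (Tgt G u)) (Pull M (u \<cdot>\<^bsub>G\<^esub> v)) (func_comp (Pull M v) (Pull M u))"
    and Cell_nat_trans: "\<alpha> \<in> Hom2 G u v \<Longrightarrow>
      nat_trans (Val M (Tgt G u)) (Val M (Src G u)) (Pull M u) (Pull M v) (Cell M \<alpha>)"
    and Cell_Ide2: "u \<in> Ar G \<Longrightarrow> X \<in> Ob (Val M (Tgt G u)) \<Longrightarrow>
      Cell M (Ide2 G u) X = Ide (Val M (Src G u)) (FO (Pull M u) X)"
    and Cell_VCmp: "\<alpha> \<in> Hom2 G u v \<Longrightarrow> \<beta> \<in> Hom2 G v w \<Longrightarrow> X \<in> Ob (Val M (Tgt G u)) \<Longrightarrow>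
      Cell M (\<beta> \<cdot>\<^bsub>Two G\<^esub> \<alpha>) X = Cell M \<beta> X \<cdot>\<^bsub>Val M (Src G u)\<^esub> Cell M \<alpha> X"
    and Cell_HCmp: "\<alpha> \<in> Hom2 G u u' \<Longrightarrow> \<beta> \<in> Hom2 G v v' \<Longrightarrow> Src G u = Tgt G v \<Longrightarrow>
      X \<in> Ob (Val M (Tgt G u)) \<Longrightarrow>
      Cell M (\<alpha> \<star>\<^bsub>G\<^esub> \<beta>) X =
        Cell M \<beta> (FO (Pull M u') X) \<cdot>\<^bsub>Val M (Src G v)\<^esub> FA (Pull M v) (Cell M \<alpha> X)"

text \<open>A 2-functor together with, for each \<open>i\<close> in \<open>J\<close>, chosen adjunctions
  \<open>(i\<^sub>!, i\<^sup>*, lunit, lcounit)\<close> and \<open>(i\<^sup>*, i\<^sub>*, runit, rcounit)\<close>.\<close>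

record ('k, 'g, 'u, 'a, 'o, 'm) mackey2 = "('k, 'g, 'u, 'a, 'o, 'm) twofun" +
  Lsh :: "'u \<Rightarrow> ('o, 'm, 'o, 'm) func"
  lunit :: "'u \<Rightarrow> 'o \<Rightarrow> 'm"
  lcounit :: "'u \<Rightarrow> 'o \<Rightarrow> 'm"
  Rsh :: "'u \<Rightarrow> ('o, 'm, 'o, 'm) func"
  runit :: "'u \<Rightarrow> 'o \<Rightarrow> 'm"
  rcounit :: "'u \<Rightarrow> 'o \<Rightarrow> 'm"

text \<open>For \<open>\<gamma>: i p \<Rightarrow> u q\<close>, the component at \<open>X\<close> of the mate
  \<open>q\<^sub>! p\<^sup>* \<Rightarrow> q\<^sub>! p\<^sup>* i\<^sup>* i\<^sub>! \<Rightarrow> q\<^sub>! q\<^sup>* u\<^sup>* i\<^sub>! \<Rightarrow> u\<^sup>* i\<^sub>!\<close>.\<close>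

definition lmate ::
  "('g, 'u, 'a) twocat \<Rightarrow> ('k, 'g, 'u, 'a, 'o, 'm) mackey2 \<Rightarrow> 'u \<Rightarrow> 'u \<Rightarrow> 'u \<Rightarrow> 'u \<Rightarrow> 'a \<Rightarrow> 'o \<Rightarrow> 'm" where
  "lmate G M i u p q \<gamma> X =
     lcounit M q (FO (Pull M u) (FO (Lsh M i) X))
       \<cdot>\<^bsub>Val M (Tgt G q)\<^esub> FA (Lsh M q) (Cell M \<gamma> (FO (Lsh M i) X))
       \<cdot>\<^bsub>Val M (Tgt G q)\<^esub> FA (Lsh M q) (FA (Pull M p) (lunit M i X))"

text \<open>For \<open>\<delta>: u q \<Rightarrow> i p\<close>, the component at \<open>X\<close> of the mate
  \<open>u\<^sup>* i\<^sub>* \<Rightarrow> q\<^sub>* q\<^sup>* u\<^sup>* i\<^sub>* \<Rightarrow> q\<^sub>* p\<^sup>* i\<^sup>* i\<^sub>* \<Rightarrow> q\<^sub>* p\<^sup>*\<close>.\<close>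

definition rmate ::
  "('g, 'u, 'a) twocat \<Rightarrow> ('k, 'g, 'u, 'a, 'o, 'm) mackey2 \<Rightarrow> 'u \<Rightarrow> 'u \<Rightarrow> 'u \<Rightarrow> 'u \<Rightarrow> 'a \<Rightarrow> 'o \<Rightarrow> 'm" where
  "rmate G M i u p q \<delta> X =
     FA (Rsh M q) (FA (Pull M p) (rcounit M i X))
       \<cdot>\<^bsub>Val M (Tgt G q)\<^esub> FA (Rsh M q) (Cell M \<delta> (FO (Rsh M i) X))
       \<cdot>\<^bsub>Val M (Tgt G q)\<^esub> runit M q (FO (Pull M u) (FO (Rsh M i) X))"

locale mackey_2_functor = spannable_pair U G J + cring k + two_functor_op k A G M
  for U :: "'s set" and G :: "('g, 'u, 'a) twocat" and J :: "'u set"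
    and k :: "'k ring" and A :: ambient and M :: "('k, 'g, 'u, 'a, 'o, 'm) mackey2" +
  assumes additivity: "coproduct G Hs c is \<Longrightarrow>
      is_equivalence_functor (Val M c) (list_cat (map (Val M) Hs))
        \<lparr>FO = (\<lambda>X. map (\<lambda>i. FO (Pull M i) X) is), FA = (\<lambda>f. map (\<lambda>i. FA (Pull M i) f) is)\<rparr>"
    and Lsh_functor: "i \<in> J \<Longrightarrow> linear_functor k (Val M (Src G i)) (Val M (Tgt G i)) (Lsh M i)"
    and Rsh_functor: "i \<in> J \<Longrightarrow> linear_functor k (Val M (Src G i)) (Val M (Tgt G i)) (Rsh M i)"
    and left_adjoint: "i \<in> J \<Longrightarrow>
      adjunction (Val M (Src G i)) (Val M (Tgt G i)) (Lsh M i) (Pull M i) (lunit M i) (lcounit M i)"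
    and right_adjoint: "i \<in> J \<Longrightarrow>
      adjunction (Val M (Tgt G i)) (Val M (Src G i)) (Pull M i) (Rsh M i) (runit M i) (rcounit M i)"
    and base_change_left: "mackey_square G J i u p q \<gamma> \<Longrightarrow> X \<in> Ob (Val M (Src G i)) \<Longrightarrow>
      is_iso (Val M (Tgt G q)) (lmate G M i u p q \<gamma> X)"
    and base_change_right: "mackey_square G J i u p q \<gamma> \<Longrightarrow> X \<in> Ob (Val M (Src G i)) \<Longrightarrow>
      is_iso (Val M (Tgt G q)) (rmate G M i u p q (inv_arr (Two G) \<gamma>) X)"
    and ambidexterity: "i \<in> J \<Longrightarrow>
      functors_isomorphic (Val M (Src G i)) (Val M (Tgt G i)) (Lsh M i) (Rsh M i)"

text \<open>Equality of the pseudofunctors \<open>i \<mapsto> i\<^sub>!\<close> and \<open>i \<mapsto> i\<^sub>*\<close> is spelled out: they agree on 1-cells;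
  on a 2-cell \<open>\<alpha>: i \<Rightarrow> j\<close> the two mates \<open>j\<^sub>! \<Rightarrow> i\<^sub>!\<close> and \<open>j\<^sub>* \<Rightarrow> i\<^sub>*\<close> agree, which are the mates of \<open>\<alpha>\<close>
  seen as a square with two identity sides; and the structure isomorphisms
  \<open>(i j)\<^sub>! \<Rightarrow> i\<^sub>! j\<^sub>!\<close>, \<open>Id\<^sub>! \<Rightarrow> Id\<close> are inverse to \<open>i\<^sub>* j\<^sub>* \<Rightarrow> (i j)\<^sub>*\<close>, \<open>Id \<Rightarrow> Id\<^sub>*\<close>.\<close>

locale rectified_mackey_2_functor = mackey_2_functor U G J k A M
  for U :: "'s set" and G :: "('g, 'u, 'a) twocat" and J :: "'u set"
    and k :: "'k ring" and A :: ambient and M :: "('k, 'g, 'u, 'a, 'o, 'm) mackey2" +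
  assumes Lsh_eq_Rsh: "i \<in> J \<Longrightarrow> func_eq (Val M (Src G i)) (Lsh M i) (Rsh M i)"
    and pseudofunctors_2cells: "i \<in> J \<Longrightarrow> j \<in> J \<Longrightarrow> \<alpha> \<in> Hom2 G i j \<Longrightarrow> X \<in> Ob (Val M (Src G i)) \<Longrightarrow>
      lmate G M i (Ide G (Tgt G i)) (Ide G (Src G i)) j \<alpha> X =
      rmate G M j (Ide G (Tgt G i)) (Ide G (Src G i)) i \<alpha> X"
    and pseudofunctors_Cmp: "i \<in> J \<Longrightarrow> j \<in> J \<Longrightarrow> Src G i = Tgt G j \<Longrightarrow> X \<in> Ob (Val M (Src G j)) \<Longrightarrow>
      inverse_arrows (Val M (Tgt G i))
        (lcounit M (i \<cdot>\<^bsub>G\<^esub> j) (FO (Lsh M i) (FO (Lsh M j) X))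
           \<cdot>\<^bsub>Val M (Tgt G i)\<^esub> FA (Lsh M (i \<cdot>\<^bsub>G\<^esub> j))
             (FA (Pull M j) (lunit M i (FO (Lsh M j) X)) \<cdot>\<^bsub>Val M (Src G j)\<^esub> lunit M j X))
        (FA (Rsh M (i \<cdot>\<^bsub>G\<^esub> j))
             (rcounit M j X \<cdot>\<^bsub>Val M (Src G j)\<^esub> FA (Pull M j) (rcounit M i (FO (Rsh M j) X)))
           \<cdot>\<^bsub>Val M (Tgt G i)\<^esub> runit M (i \<cdot>\<^bsub>G\<^esub> j) (FO (Rsh M i) (FO (Rsh M j) X)))"
    and pseudofunctors_Ide: "x \<in> Ob G \<Longrightarrow> X \<in> Ob (Val M x) \<Longrightarrow>
      inverse_arrows (Val M x) (lcounit M (Ide G x) X) (runit M (Ide G x) X)"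
    and base_change_inverse: "mackey_square G J i u p q \<gamma> \<Longrightarrow> X \<in> Ob (Val M (Src G i)) \<Longrightarrow>
      inv_arr (Val M (Tgt G q)) (lmate G M i u p q \<gamma> X) =
      rmate G M i u p q (inv_arr (Two G) \<gamma>) X"
    and special_frobenius: "i \<in> J \<Longrightarrow> X \<in> Ob (Val M (Src G i)) \<Longrightarrow>
      rcounit M i X \<cdot>\<^bsub>Val M (Src G i)\<^esub> lunit M i X = Ide (Val M (Src G i)) X"


section \<open>Ordinary Mackey and Green functors\<close>

record ('k, 'g, 'u, 'x) mackey =
  Mod :: "'g \<Rightarrow> ('k, 'x) module"
  Res :: "'u \<Rightarrow> 'x \<Rightarrow> 'x"
  Ind :: "'u \<Rightarrow> 'x \<Rightarrow> 'x"

definition linear_map :: "'k ring \<Rightarrow> ('k, 'x) module \<Rightarrow> ('k, 'y) module \<Rightarrow> ('x \<Rightarrow> 'y) \<Rightarrow> bool" where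
  "linear_map k V W f \<longleftrightarrow> f \<in> carrier V \<rightarrow> carrier W \<and>
     (\<forall>a \<in> carrier V. \<forall>b \<in> carrier V. f (a \<oplus>\<^bsub>V\<^esub> b) = f a \<oplus>\<^bsub>W\<^esub> f b) \<and>
     (\<forall>c \<in> carrier k. \<forall>a \<in> carrier V. f (c \<odot>\<^bsub>V\<^esub> a) = c \<odot>\<^bsub>W\<^esub> f a)"

locale mackey_functor = cring k
  for k :: "'k ring" and G :: "('g, 'u, 'a) twocat" and J :: "'u set"
    and N :: "('k, 'g, 'u, 'x) mackey" +
  assumes Mod_module: "x \<in> Ob G \<Longrightarrow> module k (Mod N x)"
    and Res_linear: "u \<in> Ar G \<Longrightarrow> linear_map k (Mod N (Tgt G u)) (Mod N (Src G u)) (Res N u)"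
    and Ind_linear: "u \<in> J \<Longrightarrow> linear_map k (Mod N (Src G u)) (Mod N (Tgt G u)) (Ind N u)"
    and Res_Ide: "x \<in> Ob G \<Longrightarrow> m \<in> carrier (Mod N x) \<Longrightarrow> Res N (Ide G x) m = m"
    and Ind_Ide: "x \<in> Ob G \<Longrightarrow> m \<in> carrier (Mod N x) \<Longrightarrow> Ind N (Ide G x) m = m"
    and Res_Cmp: "u \<in> Ar G \<Longrightarrow> v \<in> Ar G \<Longrightarrow> Src G u = Tgt G v \<Longrightarrow> m \<in> carrier (Mod N (Tgt G u)) \<Longrightarrow>
      Res N (u \<cdot>\<^bsub>G\<^esub> v) m = Res N v (Res N u m)"
    and Ind_Cmp: "u \<in> J \<Longrightarrow> v \<in> J \<Longrightarrow> Src G u = Tgt G v \<Longrightarrow> m \<in> carrier (Mod N (Src G v)) \<Longrightarrow>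
      Ind N (u \<cdot>\<^bsub>G\<^esub> v) m = Ind N u (Ind N v m)"
    and Res_isomorphic: "u \<in> Ar G \<Longrightarrow> v \<in> Ar G \<Longrightarrow> isomorphic_1cells G u v \<Longrightarrow>
      m \<in> carrier (Mod N (Tgt G u)) \<Longrightarrow> Res N u m = Res N v m"
    and Ind_isomorphic: "u \<in> J \<Longrightarrow> v \<in> J \<Longrightarrow> isomorphic_1cells G u v \<Longrightarrow>
      m \<in> carrier (Mod N (Src G u)) \<Longrightarrow> Ind N u m = Ind N v m"
    and Ind_Res_coproduct: "coproduct G [x, y] c [i, j] \<Longrightarrow> m \<in> carrier (Mod N c) \<Longrightarrow>
      Ind N i (Res N i m) \<oplus>\<^bsub>Mod N c\<^esub> Ind N j (Res N j m) = m"
    and Res_Ind_coproduct: "coproduct G [x, y] c [i, j] \<Longrightarrow>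
      m \<in> carrier (Mod N x) \<Longrightarrow> n \<in> carrier (Mod N y) \<Longrightarrow>
      Res N i (Ind N i m \<oplus>\<^bsub>Mod N c\<^esub> Ind N j n) = m \<and> Res N j (Ind N i m \<oplus>\<^bsub>Mod N c\<^esub> Ind N j n) = n"
    and mackey_formula: "mackey_square G J i u p q \<gamma> \<Longrightarrow> m \<in> carrier (Mod N (Src G i)) \<Longrightarrow>
      Res N u (Ind N i m) = Ind N q (Res N p m)"

text \<open>The ring obtained from the additive group \<open>N(x)\<close> with product \<open>mul\<close> and unit \<open>e\<close>.\<close>

definition ring_at ::
  "('k, 'g, 'u, 'x) mackey \<Rightarrow> ('g \<Rightarrow> 'x \<Rightarrow> 'x \<Rightarrow> 'x) \<Rightarrow> ('g \<Rightarrow> 'x) \<Rightarrow> 'g \<Rightarrow> 'x ring" where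
  "ring_at N mul e x =
     \<lparr>carrier = carrier (Mod N x), monoid.mult = mul x, one = e x,
      zero = zero (Mod N x), add = add (Mod N x)\<rparr>"

locale green_functor = mackey_functor k G J N
  for k :: "'k ring" and G :: "('g, 'u, 'a) twocat" and J :: "'u set"
    and N :: "('k, 'g, 'u, 'x) mackey" and mul :: "'g \<Rightarrow> 'x \<Rightarrow> 'x \<Rightarrow> 'x" and e :: "'g \<Rightarrow> 'x" +
  assumes ring_at: "x \<in> Ob G \<Longrightarrow> ring (ring_at N mul e x)"
    and smult_mul_left: "x \<in> Ob G \<Longrightarrow> c \<in> carrier k \<Longrightarrow> a \<in> carrier (Mod N x) \<Longrightarrow>
      b \<in> carrier (Mod N x) \<Longrightarrow> mul x (c \<odot>\<^bsub>Mod N x\<^esub> a) b = c \<odot>\<^bsub>Mod N x\<^esub> mul x a b"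
    and smult_mul_right: "x \<in> Ob G \<Longrightarrow> c \<in> carrier k \<Longrightarrow> a \<in> carrier (Mod N x) \<Longrightarrow>
      b \<in> carrier (Mod N x) \<Longrightarrow> mul x a (c \<odot>\<^bsub>Mod N x\<^esub> b) = c \<odot>\<^bsub>Mod N x\<^esub> mul x a b"
    and Res_mul: "u \<in> Ar G \<Longrightarrow> a \<in> carrier (Mod N (Tgt G u)) \<Longrightarrow> b \<in> carrier (Mod N (Tgt G u)) \<Longrightarrow>
      Res N u (mul (Tgt G u) a b) = mul (Src G u) (Res N u a) (Res N u b)"
    and frobenius_left: "u \<in> J \<Longrightarrow> a \<in> carrier (Mod N (Tgt G u)) \<Longrightarrow> b \<in> carrier (Mod N (Src G u)) \<Longrightarrow>
      mul (Tgt G u) a (Ind N u b) = Ind N u (mul (Src G u) (Res N u a) b)"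
    and frobenius_right: "u \<in> J \<Longrightarrow> a \<in> carrier (Mod N (Tgt G u)) \<Longrightarrow> b \<in> carrier (Mod N (Src G u)) \<Longrightarrow>
      mul (Tgt G u) (Ind N u b) a = Ind N u (mul (Src G u) b (Res N u a))"

locale commutative_green_functor = green_functor k G J N mul e
  for k :: "'k ring" and G :: "('g, 'u, 'a) twocat" and J :: "'u set"
    and N :: "('k, 'g, 'u, 'x) mackey" and mul :: "'g \<Rightarrow> 'x \<Rightarrow> 'x \<Rightarrow> 'x" and e :: "'g \<Rightarrow> 'x" +
  assumes cring_at: "x \<in> Ob G \<Longrightarrow> cring (ring_at N mul e x)"

locale green_left_module = R: green_functor k G J R mul e + N: mackey_functor k G J N
  for k :: "'k ring" and G :: "('g, 'u, 'a) twocat" and J :: "'u set"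
    and R :: "('k, 'g, 'u, 'x) mackey" and mul :: "'g \<Rightarrow> 'x \<Rightarrow> 'x \<Rightarrow> 'x" and e :: "'g \<Rightarrow> 'x"
    and N :: "('k, 'g, 'u, 'y) mackey" and act :: "'g \<Rightarrow> 'x \<Rightarrow> 'y \<Rightarrow> 'y" +
  assumes act_closed: "x \<in> Ob G \<Longrightarrow> a \<in> carrier (Mod R x) \<Longrightarrow> n \<in> carrier (Mod N x) \<Longrightarrow>
      act x a n \<in> carrier (Mod N x)"
    and act_add_left: "x \<in> Ob G \<Longrightarrow> a \<in> carrier (Mod R x) \<Longrightarrow> b \<in> carrier (Mod R x) \<Longrightarrow>
      n \<in> carrier (Mod N x) \<Longrightarrow> act x (a \<oplus>\<^bsub>Mod R x\<^esub> b) n = act x a n \<oplus>\<^bsub>Mod N x\<^esub> act x b n"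
    and act_add_right: "x \<in> Ob G \<Longrightarrow> a \<in> carrier (Mod R x) \<Longrightarrow> n \<in> carrier (Mod N x) \<Longrightarrow>
      n' \<in> carrier (Mod N x) \<Longrightarrow> act x a (n \<oplus>\<^bsub>Mod N x\<^esub> n') = act x a n \<oplus>\<^bsub>Mod N x\<^esub> act x a n'"
    and act_smult_left: "x \<in> Ob G \<Longrightarrow> c \<in> carrier k \<Longrightarrow> a \<in> carrier (Mod R x) \<Longrightarrow>
      n \<in> carrier (Mod N x) \<Longrightarrow> act x (c \<odot>\<^bsub>Mod R x\<^esub> a) n = c \<odot>\<^bsub>Mod N x\<^esub> act x a n"
    and act_smult_right: "x \<in> Ob G \<Longrightarrow> c \<in> carrier k \<Longrightarrow> a \<in> carrier (Mod R x) \<Longrightarrow>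
      n \<in> carrier (Mod N x) \<Longrightarrow> act x a (c \<odot>\<^bsub>Mod N x\<^esub> n) = c \<odot>\<^bsub>Mod N x\<^esub> act x a n"
    and act_mul: "x \<in> Ob G \<Longrightarrow> a \<in> carrier (Mod R x) \<Longrightarrow> b \<in> carrier (Mod R x) \<Longrightarrow>
      n \<in> carrier (Mod N x) \<Longrightarrow> act x (mul x a b) n = act x a (act x b n)"
    and act_one: "x \<in> Ob G \<Longrightarrow> n \<in> carrier (Mod N x) \<Longrightarrow> act x (e x) n = n"
    and Res_act: "u \<in> Ar G \<Longrightarrow> a \<in> carrier (Mod R (Tgt G u)) \<Longrightarrow> n \<in> carrier (Mod N (Tgt G u)) \<Longrightarrow>
      Res N u (act (Tgt G u) a n) = act (Src G u) (Res R u a) (Res N u n)"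
    and frobenius_act_left: "u \<in> J \<Longrightarrow> a \<in> carrier (Mod R (Tgt G u)) \<Longrightarrow>
      n \<in> carrier (Mod N (Src G u)) \<Longrightarrow>
      act (Tgt G u) a (Ind N u n) = Ind N u (act (Src G u) (Res R u a) n)"
    and frobenius_act_right: "u \<in> J \<Longrightarrow> a \<in> carrier (Mod R (Src G u)) \<Longrightarrow>
      n \<in> carrier (Mod N (Tgt G u)) \<Longrightarrow>
      act (Tgt G u) (Ind R u a) n = Ind N u (act (Src G u) a (Res N u n))"

locale green_right_module = R: green_functor k G J R mul e + N: mackey_functor k G J N
  for k :: "'k ring" and G :: "('g, 'u, 'a) twocat" and J :: "'u set"
    and R :: "('k, 'g, 'u, 'x) mackey" and mul :: "'g \<Rightarrow> 'x \<Rightarrow> 'x \<Rightarrow> 'x" and e :: "'g \<Rightarrow> 'x"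
    and N :: "('k, 'g, 'u, 'y) mackey" and act :: "'g \<Rightarrow> 'y \<Rightarrow> 'x \<Rightarrow> 'y" +
  assumes act_closed: "x \<in> Ob G \<Longrightarrow> n \<in> carrier (Mod N x) \<Longrightarrow> a \<in> carrier (Mod R x) \<Longrightarrow>
      act x n a \<in> carrier (Mod N x)"
    and act_add_right: "x \<in> Ob G \<Longrightarrow> n \<in> carrier (Mod N x) \<Longrightarrow> a \<in> carrier (Mod R x) \<Longrightarrow>
      b \<in> carrier (Mod R x) \<Longrightarrow> act x n (a \<oplus>\<^bsub>Mod R x\<^esub> b) = act x n a \<oplus>\<^bsub>Mod N x\<^esub> act x n b"
    and act_add_left: "x \<in> Ob G \<Longrightarrow> n \<in> carrier (Mod N x) \<Longrightarrow> n' \<in> carrier (Mod N x) \<Longrightarrow>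
      a \<in> carrier (Mod R x) \<Longrightarrow> act x (n \<oplus>\<^bsub>Mod N x\<^esub> n') a = act x n a \<oplus>\<^bsub>Mod N x\<^esub> act x n' a"
    and act_smult_right: "x \<in> Ob G \<Longrightarrow> c \<in> carrier k \<Longrightarrow> n \<in> carrier (Mod N x) \<Longrightarrow>
      a \<in> carrier (Mod R x) \<Longrightarrow> act x n (c \<odot>\<^bsub>Mod R x\<^esub> a) = c \<odot>\<^bsub>Mod N x\<^esub> act x n a"
    and act_smult_left: "x \<in> Ob G \<Longrightarrow> c \<in> carrier k \<Longrightarrow> n \<in> carrier (Mod N x) \<Longrightarrow>
      a \<in> carrier (Mod R x) \<Longrightarrow> act x (c \<odot>\<^bsub>Mod N x\<^esub> n) a = c \<odot>\<^bsub>Mod N x\<^esub> act x n a"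
    and act_mul: "x \<in> Ob G \<Longrightarrow> n \<in> carrier (Mod N x) \<Longrightarrow> a \<in> carrier (Mod R x) \<Longrightarrow>
      b \<in> carrier (Mod R x) \<Longrightarrow> act x n (mul x a b) = act x (act x n a) b"
    and act_one: "x \<in> Ob G \<Longrightarrow> n \<in> carrier (Mod N x) \<Longrightarrow> act x n (e x) = n"
    and Res_act: "u \<in> Ar G \<Longrightarrow> n \<in> carrier (Mod N (Tgt G u)) \<Longrightarrow> a \<in> carrier (Mod R (Tgt G u)) \<Longrightarrow>
      Res N u (act (Tgt G u) n a) = act (Src G u) (Res N u n) (Res R u a)"
    and frobenius_act_left: "u \<in> J \<Longrightarrow> n \<in> carrier (Mod N (Tgt G u)) \<Longrightarrow>
      a \<in> carrier (Mod R (Src G u)) \<Longrightarrow>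
      act (Tgt G u) n (Ind R u a) = Ind N u (act (Src G u) (Res N u n) a)"
    and frobenius_act_right: "u \<in> J \<Longrightarrow> n \<in> carrier (Mod N (Src G u)) \<Longrightarrow>
      a \<in> carrier (Mod R (Tgt G u)) \<Longrightarrow>
      act (Tgt G u) (Ind N u n) a = Ind N u (act (Src G u) n (Res R u a))"


section \<open>Hom-decategorification\<close>

locale coherent_family =
  fixes G :: "('g, 'u, 'a) twocat" and M :: "('k, 'g, 'u, 'a, 'o, 'm) mackey2"
    and X Y :: "'g \<Rightarrow> 'o" and lam rho :: "'u \<Rightarrow> 'm"
  assumes X_in_Ob: "x \<in> Ob G \<Longrightarrow> X x \<in> Ob (Val M x)"
    and Y_in_Ob: "x \<in> Ob G \<Longrightarrow> Y x \<in> Ob (Val M x)"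
    and lam_in_Hom: "u \<in> Ar G \<Longrightarrow>
      lam u \<in> Hom (Val M (Src G u)) (X (Src G u)) (FO (Pull M u) (X (Tgt G u)))"
    and lam_iso: "u \<in> Ar G \<Longrightarrow> is_iso (Val M (Src G u)) (lam u)"
    and rho_in_Hom: "u \<in> Ar G \<Longrightarrow>
      rho u \<in> Hom (Val M (Src G u)) (FO (Pull M u) (Y (Tgt G u))) (Y (Src G u))"
    and rho_iso: "u \<in> Ar G \<Longrightarrow> is_iso (Val M (Src G u)) (rho u)"
    and lam_Ide: "x \<in> Ob G \<Longrightarrow> lam (Ide G x) = Ide (Val M x) (X x)"
    and rho_Ide: "x \<in> Ob G \<Longrightarrow> rho (Ide G x) = Ide (Val M x) (Y x)"
    and lam_Cmp: "u \<in> Ar G \<Longrightarrow> v \<in> Ar G \<Longrightarrow> Src G u = Tgt G v \<Longrightarrow>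
      lam (u \<cdot>\<^bsub>G\<^esub> v) = FA (Pull M v) (lam u) \<cdot>\<^bsub>Val M (Src G v)\<^esub> lam v"
    and rho_Cmp: "u \<in> Ar G \<Longrightarrow> v \<in> Ar G \<Longrightarrow> Src G u = Tgt G v \<Longrightarrow>
      rho (u \<cdot>\<^bsub>G\<^esub> v) = rho v \<cdot>\<^bsub>Val M (Src G v)\<^esub> FA (Pull M v) (rho u)"
    and lam_Cell: "\<alpha> \<in> Hom2 G u v \<Longrightarrow> Cell M \<alpha> (X (Tgt G u)) \<cdot>\<^bsub>Val M (Src G u)\<^esub> lam u = lam v"
    and rho_Cell: "\<alpha> \<in> Hom2 G u v \<Longrightarrow> rho v \<cdot>\<^bsub>Val M (Src G u)\<^esub> Cell M \<alpha> (Y (Tgt G u)) = rho u"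

definition hom_decat ::
  "('g, 'u, 'a) twocat \<Rightarrow> ('k, 'g, 'u, 'a, 'o, 'm) mackey2 \<Rightarrow> ('g \<Rightarrow> 'o) \<Rightarrow> ('g \<Rightarrow> 'o) \<Rightarrow>
   ('u \<Rightarrow> 'm) \<Rightarrow> ('u \<Rightarrow> 'm) \<Rightarrow> ('k, 'g, 'u, 'm) mackey" where
  "hom_decat G M X Y lam rho =
     \<lparr>Mod = (\<lambda>x. hom_module (Val M x) (X x) (Y x)),
      Res = (\<lambda>u \<phi>. rho u \<cdot>\<^bsub>Val M (Src G u)\<^esub> FA (Pull M u) \<phi> \<cdot>\<^bsub>Val M (Src G u)\<^esub> lam u),
      Ind = (\<lambda>u \<psi>. lcounit M u (Y (Tgt G u))
        \<cdot>\<^bsub>Val M (Tgt G u)\<^esub> FA (Rsh M u)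
          (inv_arr (Val M (Src G u)) (rho u) \<cdot>\<^bsub>Val M (Src G u)\<^esub> \<psi>
             \<cdot>\<^bsub>Val M (Src G u)\<^esub> inv_arr (Val M (Src G u)) (lam u))
        \<cdot>\<^bsub>Val M (Tgt G u)\<^esub> runit M u (X (Tgt G u)))\<rparr>"

definition inv_family ::
  "('g, 'u, 'a) twocat \<Rightarrow> ('k, 'g, 'u, 'a, 'o, 'm) mackey2 \<Rightarrow> ('u \<Rightarrow> 'm) \<Rightarrow> 'u \<Rightarrow> 'm" where
  "inv_family G M lam u = inv_arr (Val M (Src G u)) (lam u)"

text \<open>Products and actions by composition of morphisms in the categories \<open>Val G\<close>.\<close>

definition comp_mul :: "('k, 'g, 'u, 'a, 'o, 'm) mackey2 \<Rightarrow> 'g \<Rightarrow> 'm \<Rightarrow> 'm \<Rightarrow> 'm" where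
  "comp_mul M x f g = f \<cdot>\<^bsub>Val M x\<^esub> g"

definition id_unit :: "('k, 'g, 'u, 'a, 'o, 'm) mackey2 \<Rightarrow> ('g \<Rightarrow> 'o) \<Rightarrow> 'g \<Rightarrow> 'm" where
  "id_unit M X x = Ide (Val M x) (X x)"

end

theory Submission
  imports Defs
begin

text \<open>The idea is to separate the induction maps from the coherent family. For \<open>i: H \<rightarrow> G\<close> in \<open>J\<close> the equality
\<open>i\<^sub>! = i\<^sub>*\<close> turns a morphism \<open>f: i\<^sup>*W \<rightarrow> i\<^sup>*B\<close> into its transfer
\<open>tr\<^sub>i f: W \<rightarrow> i\<^sub>*i\<^sup>*W \<rightarrow> i\<^sub>!i\<^sup>*B \<rightarrow> B\<close>, the composite of the right unit, \<open>i\<^sub>*f\<close> and the left counit. Induction in the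
Hom-decategorification is \<open>\<psi> \<mapsto> tr\<^sub>i (\<rho>\<^sub>i\<^sup>-\<^sup>1 \<psi> \<lambda>\<^sub>i\<^sup>-\<^sup>1)\<close>, so each axiom about induction is a property of \<open>tr\<close>
combined with the coherence of \<open>\<lambda>\<close> and \<open>\<rho>\<close>.

The units and counits being natural, \<open>b tr\<^sub>i(f) a = tr\<^sub>i(i\<^sup>*b f i\<^sup>*a)\<close> (\<open>Cmp_transfer\<close>, \<open>transfer_Cmp\<close>). This is
already both Frobenius formulas, since \<open>Res\<close> is \<open>u\<^sup>*\<close> up to conjugation by \<open>\<lambda>\<close> and \<open>\<rho>\<close>. It also allows the
structure isomorphisms to be moved in and out of a transfer.

Base change along a Mackey square, dinaturality in a 2-cell and compatibility with composition of 1-cells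
(\<open>transfer_base_change\<close>, \<open>transfer_dinatural\<close>, \<open>transfer_comp\<close>) have one proof. Each compares two ways of
pushing forward by a map \<open>l\<close> made from left adjoints and a map \<open>r\<close> made from right adjoints. Both are
transposes of simple arrows, so the left counit after \<open>l\<close> and the right unit before \<open>r\<close> simplify by the triangle
identities (\<open>lcounit_lmate\<close>, \<open>rmate_transpose\<close>). Rectification says \<open>l r = 1\<close>, or \<open>l = r\<close> for 2-cells, which
allows one transfer to be rewritten as the other.

For a coproduct with inclusions \<open>i\<close> and \<open>j\<close>, additivity makes \<open>(i\<^sup>*, j\<^sup>*)\<close> an equivalence, under which \<open>i\<^sub>!X\<close>
corresponds to \<open>(X, 0)\<close>. So \<open>j\<^sup>*i\<^sub>!X\<close> is zero and the left unit at \<open>X\<close> is invertible, with the right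
counit as its inverse by the special Frobenius property (\<open>coproduct_lunit\<close>). Hence \<open>i\<^sup>* tr\<^sub>i f = f\<close> and
\<open>j\<^sup>* tr\<^sub>i f = 0\<close>, and \<open>tr\<^sub>i(i\<^sup>*m) + tr\<^sub>j(j\<^sup>*m) = m\<close> follows because both sides have the same images under
\<open>i\<^sup>*\<close> and \<open>j\<^sup>*\<close>.

The product of a Green functor and the left and right actions are all instances of one composition pairing
\<open>Hom(Y, Z) \<times> Hom(X, Y) \<rightarrow> Hom(X, Z)\<close>, where the structure isomorphisms of the middle family \<open>Y\<close> cancel
(\<open>composable_decategorifications\<close>).\<close>

section \<open>Categories, functors and adjunctions\<close>

text \<open>Typing by \<open>Src\<close> and \<open>Tgt\<close> instead of \<open>Hom\<close> leaves no intermediate object to be guessed, so the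
simplifier can decide composability and normalise composites to the right.\<close>

lemma cat_simps:
  assumes "category C"
  shows cat_Cmp_Ar: "f \<in> Ar C \<Longrightarrow> g \<in> Ar C \<Longrightarrow> Src C g = Tgt C f \<Longrightarrow> g \<cdot>\<^bsub>C\<^esub> f \<in> Ar C"
    and cat_Cmp_Src: "f \<in> Ar C \<Longrightarrow> g \<in> Ar C \<Longrightarrow> Src C g = Tgt C f \<Longrightarrow> Src C (g \<cdot>\<^bsub>C\<^esub> f) = Src C f"
    and cat_Cmp_Tgt: "f \<in> Ar C \<Longrightarrow> g \<in> Ar C \<Longrightarrow> Src C g = Tgt C f \<Longrightarrow> Tgt C (g \<cdot>\<^bsub>C\<^esub> f) = Tgt C g"
    and cat_assoc: "f \<in> Ar C \<Longrightarrow> g \<in> Ar C \<Longrightarrow> h \<in> Ar C \<Longrightarrow> Src C g = Tgt C f \<Longrightarrow> Src C h = Tgt C g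
      \<Longrightarrow> (h \<cdot>\<^bsub>C\<^esub> g) \<cdot>\<^bsub>C\<^esub> f = h \<cdot>\<^bsub>C\<^esub> (g \<cdot>\<^bsub>C\<^esub> f)"
    and cat_Cmp_Ide: "f \<in> Ar C \<Longrightarrow> Src C f = x \<Longrightarrow> f \<cdot>\<^bsub>C\<^esub> Ide C x = f"
    and cat_Ide_Cmp: "f \<in> Ar C \<Longrightarrow> Tgt C f = x \<Longrightarrow> Ide C x \<cdot>\<^bsub>C\<^esub> f = f"
    and cat_Ide_Ar: "x \<in> Ob C \<Longrightarrow> Ide C x \<in> Ar C"
    and cat_Ide_Src: "x \<in> Ob C \<Longrightarrow> Src C (Ide C x) = x"
    and cat_Ide_Tgt: "x \<in> Ob C \<Longrightarrow> Tgt C (Ide C x) = x"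
    and cat_Src_Ob: "f \<in> Ar C \<Longrightarrow> Src C f \<in> Ob C"
    and cat_Tgt_Ob: "f \<in> Ar C \<Longrightarrow> Tgt C f \<in> Ob C"
  using category.Cmp_in_Hom[OF assms, of f _ _ g] category.Cmp_assoc[OF assms, of f _ _ g _ h]
    category.Cmp_Ide[OF assms, of f] category.Ide_Cmp[OF assms, of f]
    category.Ide_in_Hom[OF assms, of x] category.Src_in_Ob[OF assms] category.Tgt_in_Ob[OF assms]
  by (auto simp: Hom_def)

lemma inverse_arrows_sym: "inverse_arrows C f g \<Longrightarrow> inverse_arrows C g f"
  by (auto simp: inverse_arrows_def Hom_def)

lemma inverse_arrows_unique:
  assumes C: "category C" and g: "inverse_arrows C f g" and h: "inverse_arrows C f h"
  shows "g = h"
proof -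
  have "g = g \<cdot>\<^bsub>C\<^esub> (f \<cdot>\<^bsub>C\<^esub> h)"
    using g h by (simp add: inverse_arrows_def Hom_def cat_simps[OF C])
  also have "\<dots> = (g \<cdot>\<^bsub>C\<^esub> f) \<cdot>\<^bsub>C\<^esub> h"
    using g h by (subst cat_assoc[OF C]) (auto simp: inverse_arrows_def Hom_def)
  also have "\<dots> = h"
    using g h by (simp add: inverse_arrows_def Hom_def cat_simps[OF C])
  finally show ?thesis .
qed

lemma inv_arr_eq: "category C \<Longrightarrow> inverse_arrows C f g \<Longrightarrow> inv_arr C f = g"
  unfolding inv_arr_def by (blast intro: inverse_arrows_unique)

lemma inverse_arrows_inv_arr: "category C \<Longrightarrow> is_iso C f \<Longrightarrow> inverse_arrows C f (inv_arr C f)"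
  unfolding is_iso_def using inv_arr_eq by metis

lemma inverse_arrowsD:
  assumes "inverse_arrows C f g" and "f \<in> Hom C x y"
  shows "g \<in> Hom C y x" "g \<cdot>\<^bsub>C\<^esub> f = Ide C x" "f \<cdot>\<^bsub>C\<^esub> g = Ide C y"
  using assms by (auto simp: inverse_arrows_def Hom_def)

lemma functor_simps:
  assumes "is_functor C D F"
  shows functor_Ob: "x \<in> Ob C \<Longrightarrow> FO F x \<in> Ob D"
    and functor_Ide: "x \<in> Ob C \<Longrightarrow> FA F (Ide C x) = Ide D (FO F x)"
    and functor_Cmp: "f \<in> Ar C \<Longrightarrow> g \<in> Ar C \<Longrightarrow> Src C g = Tgt C f \<Longrightarrow>
      FA F (g \<cdot>\<^bsub>C\<^esub> f) = FA F g \<cdot>\<^bsub>D\<^esub> FA F f"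
  using assms by (auto simp: is_functor_def)

lemma functor_arrow_simps:
  assumes "is_functor C D F" and "category C"
  shows functor_Ar: "f \<in> Ar C \<Longrightarrow> FA F f \<in> Ar D"
    and functor_Src: "f \<in> Ar C \<Longrightarrow> Src D (FA F f) = FO F (Src C f)"
    and functor_Tgt: "f \<in> Ar C \<Longrightarrow> Tgt D (FA F f) = FO F (Tgt C f)"
  using assms(1) cat_Src_Ob[OF assms(2), of f] cat_Tgt_Ob[OF assms(2), of f] 
  by (auto simp: is_functor_def Hom_def)

text \<open>The cancellation rule that applies inside composites normalised to the right.\<close>

lemma inverse_arrows_cancel:
  assumes C: "category C" and f: "inverse_arrows C f g" and r: "r \<in> Ar C" "Tgt C r = Src C f"
  shows "g \<cdot>\<^bsub>C\<^esub> (f \<cdot>\<^bsub>C\<^esub> r) = r"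
proof -
  have "g \<cdot>\<^bsub>C\<^esub> (f \<cdot>\<^bsub>C\<^esub> r) = (g \<cdot>\<^bsub>C\<^esub> f) \<cdot>\<^bsub>C\<^esub> r"
    using f r by (subst cat_assoc[OF C]) (auto simp: inverse_arrows_def Hom_def)
  also have "\<dots> = r" using f r by (simp add: inverse_arrows_def cat_Ide_Cmp[OF C])
  finally show ?thesis .
qed

lemma inverse_arrows_Cmp:
  assumes C: "category C" and f: "inverse_arrows C f f'" and g: "inverse_arrows C g g'"
    and gf: "Src C g = Tgt C f"
  shows "inverse_arrows C (g \<cdot>\<^bsub>C\<^esub> f) (f' \<cdot>\<^bsub>C\<^esub> g')"
proof -
  have ty: "f \<in> Ar C" "f' \<in> Ar C" "Src C f' = Tgt C f" "Tgt C f' = Src C f"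
    "g \<in> Ar C" "g' \<in> Ar C" "Src C g' = Tgt C g" "Tgt C g' = Src C g"
    "f' \<cdot>\<^bsub>C\<^esub> f = Ide C (Src C f)" "g \<cdot>\<^bsub>C\<^esub> g' = Ide C (Tgt C g)"
    using f g by (auto simp: inverse_arrows_def Hom_def)
  have "g' \<cdot>\<^bsub>C\<^esub> (g \<cdot>\<^bsub>C\<^esub> f) = f" "f \<cdot>\<^bsub>C\<^esub> (f' \<cdot>\<^bsub>C\<^esub> g') = g'"
    using inverse_arrows_cancel[OF C g] inverse_arrows_cancel[OF C inverse_arrows_sym[OF f]] ty gf by auto
  then show ?thesis using ty gf by (simp add: inverse_arrows_def Hom_def cat_simps[OF C])
qed

lemma functor_inverse_arrows:
  assumes F: "is_functor C D F" and C: "category C" and f: "inverse_arrows C f f'"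
  shows "inverse_arrows D (FA F f) (FA F f')"
proof -
  have ty: "f \<in> Ar C" "f' \<in> Ar C" "Src C f' = Tgt C f" "Tgt C f' = Src C f"
    "f' \<cdot>\<^bsub>C\<^esub> f = Ide C (Src C f)" "f \<cdot>\<^bsub>C\<^esub> f' = Ide C (Tgt C f)"
    using f by (auto simp: inverse_arrows_def Hom_def)
  have "FA F f' \<cdot>\<^bsub>D\<^esub> FA F f = Ide D (FO F (Src C f))" "FA F f \<cdot>\<^bsub>D\<^esub> FA F f' = Ide D (FO F (Tgt C f))"
    using functor_Cmp[OF F, of f f'] functor_Cmp[OF F, of f' f] ty
      functor_Ide[OF F] cat_Src_Ob[OF C] cat_Tgt_Ob[OF C] by auto
  then show ?thesis using ty
    by (simp add: inverse_arrows_def Hom_def functor_simps[OF F] functor_arrow_simps[OF F C])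
qed

lemma Hom_list_cat:
  "Hom (list_cat [C, D]) [a, b] [a', b'] = {[f, g] |f g. f \<in> Hom C a a' \<and> g \<in> Hom D b b'}"
  by (auto simp: Hom_def list_cat_def list_all2_Cons2)

lemma is_iso_list_cat:
  assumes "is_iso (list_cat [C, D]) [s, t]" shows "is_iso C s" "is_iso D t"
proof -
  obtain r where r: "inverse_arrows (list_cat [C, D]) [s, t] r" using assms by (auto simp: is_iso_def)
  have "r \<in> Ar (list_cat [C, D])" using r by (auto simp: inverse_arrows_def Hom_def)
  then obtain s' t' where "r = [s', t']" by (auto simp: list_cat_def list_all2_Cons2)
  with r have "inverse_arrows C s s'" "inverse_arrows D t t'"
    by (auto simp: inverse_arrows_def Hom_def list_cat_def)
  thus "is_iso C s" "is_iso D t" by (auto simp: is_iso_def)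
qed

text \<open>The left adjunct of \<open>g: x \<rightarrow> U y\<close> is written \<open>\<epsilon> y \<cdot> F g\<close>. All mates below are adjuncts, so this lemma and
its dual reduce each identity between mates to one between the arrows that they are made from.\<close>

lemma adjunct_left_natural:
  assumes A: "adjunction C D F U \<eta> \<epsilon>" and C: "category C" and D: "category D"
    and h: "h \<in> Hom D y y'" and g: "g \<in> Hom C x (FO U y)"
  shows "h \<cdot>\<^bsub>D\<^esub> (\<epsilon> y \<cdot>\<^bsub>D\<^esub> FA F g) = \<epsilon> y' \<cdot>\<^bsub>D\<^esub> FA F (FA U h \<cdot>\<^bsub>C\<^esub> g)"
proof -
  have F: "is_functor C D F" and U: "is_functor D C U"
    and e: "nat_trans D D (func_comp F U) func_id \<epsilon>" using A by (auto simp: adjunction_def)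
  note s = cat_simps[OF C] cat_simps[OF D] functor_simps[OF F] functor_simps[OF U]
    functor_arrow_simps[OF F C] functor_arrow_simps[OF U D]
  have y: "y \<in> Ob D" "y' \<in> Ob D" using h s by (auto simp: Hom_def)
  have ty: "\<epsilon> y \<in> Hom D (FO F (FO U y)) y" "\<epsilon> y' \<in> Hom D (FO F (FO U y')) y'"
    using e y by (auto simp: nat_trans_def func_comp_def func_id_def)
  have n: "\<epsilon> y' \<cdot>\<^bsub>D\<^esub> FA F (FA U h) = h \<cdot>\<^bsub>D\<^esub> \<epsilon> y"
    using e h by (auto simp: nat_trans_def func_comp_def func_id_def Hom_def)
  have "h \<cdot>\<^bsub>D\<^esub> (\<epsilon> y \<cdot>\<^bsub>D\<^esub> FA F g) = (h \<cdot>\<^bsub>D\<^esub> \<epsilon> y) \<cdot>\<^bsub>D\<^esub> FA F g"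
    using ty h g by (simp add: Hom_def s)
  also have "\<dots> = (\<epsilon> y' \<cdot>\<^bsub>D\<^esub> FA F (FA U h)) \<cdot>\<^bsub>D\<^esub> FA F g" by (simp add: n)
  also have "\<dots> = \<epsilon> y' \<cdot>\<^bsub>D\<^esub> FA F (FA U h \<cdot>\<^bsub>C\<^esub> g)"
    using ty h g by (simp add: Hom_def s)
  finally show ?thesis .
qed

lemma adjunct_right_natural:
  assumes A: "adjunction C D F U \<eta> \<epsilon>" and C: "category C" and D: "category D"
    and h: "h \<in> Hom C x' x" and g: "g \<in> Hom D (FO F x) y"
  shows "(FA U g \<cdot>\<^bsub>C\<^esub> \<eta> x) \<cdot>\<^bsub>C\<^esub> h = FA U (g \<cdot>\<^bsub>D\<^esub> FA F h) \<cdot>\<^bsub>C\<^esub> \<eta> x'"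
proof -
  have F: "is_functor C D F" and U: "is_functor D C U"
    and e: "nat_trans C C func_id (func_comp U F) \<eta>" using A by (auto simp: adjunction_def)
  note s = cat_simps[OF C] cat_simps[OF D] functor_simps[OF F] functor_simps[OF U]
    functor_arrow_simps[OF F C] functor_arrow_simps[OF U D]
  have x: "x \<in> Ob C" "x' \<in> Ob C" using h s by (auto simp: Hom_def)
  have ty: "\<eta> x \<in> Hom C x (FO U (FO F x))" "\<eta> x' \<in> Hom C x' (FO U (FO F x'))"
    using e x by (auto simp: nat_trans_def func_comp_def func_id_def)
  have n: "\<eta> x \<cdot>\<^bsub>C\<^esub> h = FA U (FA F h) \<cdot>\<^bsub>C\<^esub> \<eta> x'"
    using e h by (auto simp: nat_trans_def func_comp_def func_id_def Hom_def)
  show ?thesis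
    using ty h g n by (simp add: Hom_def s)
qed

text \<open>The triangle identity at \<open>y\<close>, in the form that passing to the adjunct and back is the identity.\<close>

lemma adjunct_left_inverse:
  assumes A: "adjunction C D F U \<eta> \<epsilon>" and C: "category C" and D: "category D"
    and x: "x \<in> Ob C" and y: "y \<in> Ob D" and g: "g \<in> Hom C x (FO U y)"
  shows "FA U (\<epsilon> y \<cdot>\<^bsub>D\<^esub> FA F g) \<cdot>\<^bsub>C\<^esub> \<eta> x = g"
proof -
  have F: "is_functor C D F" and U: "is_functor D C U"
    and e: "nat_trans D D (func_comp F U) func_id \<epsilon>"
    and n: "nat_trans C C func_id (func_comp U F) \<eta>"
    and t: "FA U (\<epsilon> y) \<cdot>\<^bsub>C\<^esub> \<eta> (FO U y) = Ide C (FO U y)"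
    using A y by (auto simp: adjunction_def)
  note s = cat_simps[OF C] cat_simps[OF D] functor_simps[OF F] functor_simps[OF U]
    functor_arrow_simps[OF F C] functor_arrow_simps[OF U D]
  have ty: "\<epsilon> y \<in> Hom D (FO F (FO U y)) y" "\<eta> x \<in> Hom C x (FO U (FO F x))"
     "\<eta> (FO U y) \<in> Hom C (FO U y) (FO U (FO F (FO U y)))"
    using e n x y s by (auto simp: nat_trans_def func_comp_def func_id_def)
  have n: "FA U (FA F g) \<cdot>\<^bsub>C\<^esub> \<eta> x = \<eta> (FO U y) \<cdot>\<^bsub>C\<^esub> g"
    using n g by (auto simp: nat_trans_def func_comp_def func_id_def Hom_def)
  have "FA U (\<epsilon> y \<cdot>\<^bsub>D\<^esub> FA F g) \<cdot>\<^bsub>C\<^esub> \<eta> x = FA U (\<epsilon> y) \<cdot>\<^bsub>C\<^esub> (FA U (FA F g) \<cdot>\<^bsub>C\<^esub> \<eta> x)"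
    using ty g by (simp add: Hom_def s)
  also have "\<dots> = (FA U (\<epsilon> y) \<cdot>\<^bsub>C\<^esub> \<eta> (FO U y)) \<cdot>\<^bsub>C\<^esub> g"
    using ty g by (simp add: n Hom_def s)
  also have "\<dots> = g" using g by (simp add: t Hom_def s)
  finally show ?thesis .
qed

lemma adjunct_right_inverse:
  assumes A: "adjunction C D F U \<eta> \<epsilon>" and C: "category C" and D: "category D"
    and x: "x \<in> Ob C" and y: "y \<in> Ob D" and g: "g \<in> Hom D (FO F x) y"
  shows "\<epsilon> y \<cdot>\<^bsub>D\<^esub> FA F (FA U g \<cdot>\<^bsub>C\<^esub> \<eta> x) = g"
proof -
  have F: "is_functor C D F" and U: "is_functor D C U"
    and e: "nat_trans D D (func_comp F U) func_id \<epsilon>"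
    and n: "nat_trans C C func_id (func_comp U F) \<eta>"
    and t: "\<epsilon> (FO F x) \<cdot>\<^bsub>D\<^esub> FA F (\<eta> x) = Ide D (FO F x)"
    using A x by (auto simp: adjunction_def)
  note s = cat_simps[OF C] cat_simps[OF D] functor_simps[OF F] functor_simps[OF U]
    functor_arrow_simps[OF F C] functor_arrow_simps[OF U D]
  have ty: "\<epsilon> y \<in> Hom D (FO F (FO U y)) y" "\<eta> x \<in> Hom C x (FO U (FO F x))"
     "\<epsilon> (FO F x) \<in> Hom D (FO F (FO U (FO F x))) (FO F x)"
    using e n x y s by (auto simp: nat_trans_def func_comp_def func_id_def)
  have n: "g \<cdot>\<^bsub>D\<^esub> \<epsilon> (FO F x) = \<epsilon> y \<cdot>\<^bsub>D\<^esub> FA F (FA U g)"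
    using e g by (auto simp: nat_trans_def func_comp_def func_id_def Hom_def)
  have "\<epsilon> y \<cdot>\<^bsub>D\<^esub> FA F (FA U g \<cdot>\<^bsub>C\<^esub> \<eta> x) = (\<epsilon> y \<cdot>\<^bsub>D\<^esub> FA F (FA U g)) \<cdot>\<^bsub>D\<^esub> FA F (\<eta> x)"
    using ty g by (simp add: Hom_def s)
  also have "\<dots> = g \<cdot>\<^bsub>D\<^esub> (\<epsilon> (FO F x) \<cdot>\<^bsub>D\<^esub> FA F (\<eta> x))"
    using ty g by (simp add: n[symmetric] Hom_def s x)
  also have "\<dots> = g" using g by (simp add: t Hom_def s)
  finally show ?thesis .
qed

section \<open>Linear categories\<close>

context linear_category
begin

lemma is_category: "category C" ..

lemma hom_abelian: "x \<in> Ob C \<Longrightarrow> y \<in> Ob C \<Longrightarrow> abelian_group (hom_module C x y)"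
  using Hom_module module.axioms(2) by blast

lemma Add_in_Hom: "f \<in> Hom C x y \<Longrightarrow> g \<in> Hom C x y \<Longrightarrow> Add C f g \<in> Hom C x y"
  using abelian_monoid.a_closed[OF abelian_group.axioms(1)[OF hom_abelian[of x y]], of f g]
    cat_Src_Ob[OF is_category, of f] cat_Tgt_Ob[OF is_category, of f]
  by (auto simp: hom_module_def Hom_def)

lemma Scal_in_Hom: "c \<in> carrier k \<Longrightarrow> f \<in> Hom C x y \<Longrightarrow> Scal C c f \<in> Hom C x y"
  using module.smult_closed[OF Hom_module[of x y], of c f]
    cat_Src_Ob[OF is_category, of f] cat_Tgt_Ob[OF is_category, of f]
  by (auto simp: hom_module_def Hom_def)

lemma Zero_in_Hom: "x \<in> Ob C \<Longrightarrow> y \<in> Ob C \<Longrightarrow> Zero C x y \<in> Hom C x y"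
  using abelian_monoid.zero_closed[OF abelian_group.axioms(1)[OF hom_abelian[of x y]]]
  by (auto simp: hom_module_def)

lemma Add_Zero_right: "f \<in> Hom C x y \<Longrightarrow> Add C f (Zero C x y) = f"
  using abelian_monoid.r_zero[OF abelian_group.axioms(1)[OF hom_abelian[of x y]], of f]
    cat_Src_Ob[OF is_category, of f] cat_Tgt_Ob[OF is_category, of f]
  by (auto simp: hom_module_def Hom_def)

lemma Add_Zero_left: "f \<in> Hom C x y \<Longrightarrow> Add C (Zero C x y) f = f"
  using abelian_monoid.l_zero[OF abelian_group.axioms(1)[OF hom_abelian[of x y]], of f]
    cat_Src_Ob[OF is_category, of f] cat_Tgt_Ob[OF is_category, of f]
  by (auto simp: hom_module_def Hom_def)

text \<open>In a group only the neutral element satisfies \<open>f + f = f\<close>; this is how additive maps are seen to preserve zero.\<close>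

lemma Add_idem_Zero:
  assumes f: "f \<in> Hom C x y" and i: "Add C f f = f" shows "f = Zero C x y"
proof -
  have "x \<in> Ob C" "y \<in> Ob C" using f cat_simps[OF is_category] by (auto simp: Hom_def)
  then interpret abelian_group "hom_module C x y" by (rule hom_abelian)
  show ?thesis using add.l_cancel_one[of f f] f i by (simp add: hom_module_def)
qed

lemma Cmp_Zero_left:
  assumes f: "f \<in> Hom C x y" and z: "z \<in> Ob C"
  shows "Zero C y z \<cdot>\<^bsub>C\<^esub> f = Zero C x z"
proof (rule Add_idem_Zero)
  have y: "Zero C y z \<in> Hom C y z" using f z by (auto simp: Hom_def intro!: Zero_in_Hom[unfolded Hom_def, simplified] cat_Tgt_Ob[OF is_category])
  show "Zero C y z \<cdot>\<^bsub>C\<^esub> f \<in> Hom C x z" using Cmp_in_Hom[OF f y] .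
  show "Add C (Zero C y z \<cdot>\<^bsub>C\<^esub> f) (Zero C y z \<cdot>\<^bsub>C\<^esub> f) = Zero C y z \<cdot>\<^bsub>C\<^esub> f"
    using Cmp_Add_left[OF f y y] Add_Zero_right[OF y] by simp
qed

lemma Cmp_Zero_right:
  assumes g: "g \<in> Hom C y z" and x: "x \<in> Ob C"
  shows "g \<cdot>\<^bsub>C\<^esub> Zero C x y = Zero C x z"
proof (rule Add_idem_Zero)
  have y: "Zero C x y \<in> Hom C x y" using g x by (auto simp: Hom_def intro!: Zero_in_Hom[unfolded Hom_def, simplified] cat_Src_Ob[OF is_category])
  show "g \<cdot>\<^bsub>C\<^esub> Zero C x y \<in> Hom C x z" using Cmp_in_Hom[OF y g] .
  show "Add C (g \<cdot>\<^bsub>C\<^esub> Zero C x y) (g \<cdot>\<^bsub>C\<^esub> Zero C x y) = g \<cdot>\<^bsub>C\<^esub> Zero C x y"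
    using Cmp_Add_right[OF y y g] Add_Zero_right[OF y] by simp
qed

text \<open>An object isomorphic to a zero object has vanishing identity. This form is used because an arrow that
factors through such an object then vanishes by bilinearity of composition.\<close>

lemma Ide_eq_Zero:
  assumes z: "zero_object C z" and t: "t \<in> Hom C w z" "is_iso C t"
  shows "Ide C w = Zero C w w"
proof -
  obtain t' where i: "inverse_arrows C t t'" using t(2) by (auto simp: is_iso_def)
  note t' = inverse_arrowsD[OF i t(1)]
  have w: "w \<in> Ob C" "z \<in> Ob C" using t(1) cat_simps[OF is_category] by (auto simp: Hom_def)
  have "t = Zero C w z" using z w t(1) Zero_in_Hom[OF w] unfolding zero_object_def by blast
  then show ?thesis using t' Cmp_Zero_right[OF t'(1) w(1)] by simp
qed

end

lemma linear_functor_Add: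
  assumes "linear_functor k C D F" "category C" "f \<in> Hom C x y" "g \<in> Hom C x y"
  shows "FA F (Add C f g) = Add D (FA F f) (FA F g)"
  using assms cat_Src_Ob[OF assms(2), of f] cat_Tgt_Ob[OF assms(2), of f]
  by (auto simp: linear_functor_def Hom_def)

lemma (in linear_category) ring_End_ring:
  assumes x: "x \<in> Ob C" shows "ring (End_ring C x)"
proof -
  interpret H: abelian_group "hom_module C x x" using hom_abelian[OF x x] .
  have i: "Ide C x \<in> Hom C x x" using Ide_in_Hom[OF x] .
  show ?thesis
  proof (intro ringI)
    show "abelian_group (End_ring C x)"
    proof (rule abelian_groupI)
      fix f assume "f \<in> carrier (End_ring C x)"
      then have "\<ominus>\<^bsub>hom_module C x x\<^esub> f \<in> carrier (End_ring C x)"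
        "\<ominus>\<^bsub>hom_module C x x\<^esub> f \<oplus>\<^bsub>End_ring C x\<^esub> f = \<zero>\<^bsub>End_ring C x\<^esub>"
        using H.a_inv_closed[of f] H.l_neg[of f] by (simp_all add: End_ring_def hom_module_def)
      then show "\<exists>g \<in> carrier (End_ring C x). g \<oplus>\<^bsub>End_ring C x\<^esub> f = \<zero>\<^bsub>End_ring C x\<^esub>" by blast
    qed (use H.a_closed H.zero_closed H.a_assoc H.a_comm H.l_zero in \<open>auto simp: End_ring_def hom_module_def\<close>)
    show "Group.monoid (End_ring C x)"
      by (rule monoidI) (auto simp: End_ring_def Ide_in_Hom[OF x] intro: Cmp_in_Hom Cmp_assoc Cmp_Ide Ide_Cmp)
  qed (auto simp: End_ring_def intro: Cmp_Add_left Cmp_Add_right)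
qed

section \<open>Adjunctions in a rectified Mackey 2-functor\<close>

context rectified_mackey_2_functor
begin

text \<open>For \<open>u: H \<rightarrow> K\<close>, the functor \<open>u\<^sup>*\<close> is \<open>pull_ob u\<close> on objects and \<open>pull u\<close> on arrows; \<open>push_ob u\<close> and \<open>push u\<close>
denote \<open>u\<^sub>*\<close>, which also stands for \<open>u\<^sub>!\<close> since the two agree on objects and arrows.\<close>

abbreviation V where "V \<equiv> Val M"
abbreviation pull_ob where "pull_ob u \<equiv> FO (Pull M u)"
abbreviation pull where "pull u \<equiv> FA (Pull M u)"
abbreviation push_ob where "push_ob u \<equiv> FO (Rsh M u)"
abbreviation push where "push u \<equiv> FA (Rsh M u)"

lemma G_category: "category G" ..

lemma Two_category: "category (Two G)" by (rule Two.category_axioms)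

lemmas G_simps = cat_simps[OF G_category]
lemmas Two_simps = cat_simps[OF Two_category]

lemma J_Ar: "i \<in> J \<Longrightarrow> i \<in> Ar G" using J_subset by blast

lemma V_additive: "x \<in> Ob G \<Longrightarrow> additive_category k (V x)"
  using Val_ambient by (simp add: in_ambient_def)

lemma V_linear: "x \<in> Ob G \<Longrightarrow> linear_category k (V x)"
  using V_additive additive_category.axioms(1) by blast

lemma V_category: "x \<in> Ob G \<Longrightarrow> category (V x)"
  using V_linear linear_category.axioms(1) by blast

lemmas V_simps = cat_simps[OF V_category]

lemma ends_in_Ob: "u \<in> Ar G \<Longrightarrow> Tgt G u = K \<Longrightarrow> Src G u = H \<Longrightarrow> K \<in> Ob G \<and> H \<in> Ob G"
  by (auto simp: G_simps)

lemma Pull_linear_functor: "u \<in> Ar G \<Longrightarrow> Tgt G u = K \<Longrightarrow> Src G u = H \<Longrightarrow>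
    linear_functor k (V K) (V H) (Pull M u)"
  using Pull_functor by blast

lemma Pull_is_functor: "u \<in> Ar G \<Longrightarrow> Tgt G u = K \<Longrightarrow> Src G u = H \<Longrightarrow> is_functor (V K) (V H) (Pull M u)"
  using Pull_linear_functor by (auto simp: linear_functor_def)

lemma Rsh_linear_functor: "i \<in> J \<Longrightarrow> Tgt G i = K \<Longrightarrow> Src G i = H \<Longrightarrow>
    linear_functor k (V H) (V K) (Rsh M i)"
  using Rsh_functor by blast

lemma Rsh_is_functor: "i \<in> J \<Longrightarrow> Tgt G i = K \<Longrightarrow> Src G i = H \<Longrightarrow> is_functor (V H) (V K) (Rsh M i)"
  using Rsh_linear_functor by (auto simp: linear_functor_def)

text \<open>The endpoints \<open>H\<close> and \<open>K\<close> of \<open>u\<close> are variables, because in a square the same object is the endpoint of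
several 1-cells and a rule stated for \<open>Src G u\<close> alone would apply to only one of its names.\<close>

lemma Pull_simps:
  assumes u: "u \<in> Ar G" and K: "Tgt G u = K" and H: "Src G u = H"
  shows pull_Ob: "W \<in> Ob (V (Tgt G u)) \<Longrightarrow> pull_ob u W \<in> Ob (V H)"
    and pull_Ide: "W \<in> Ob (V K) \<Longrightarrow> pull u (Ide (V K) W) = Ide (V (Src G u)) (pull_ob u W)"
    and pull_Cmp: "f \<in> Ar (V K) \<Longrightarrow> g \<in> Ar (V K) \<Longrightarrow> Src (V K) g = Tgt (V K) f \<Longrightarrow>
      pull u (g \<cdot>\<^bsub>V K\<^esub> f) = pull u g \<cdot>\<^bsub>V (Src G u)\<^esub> pull u f"
    and pull_Ar: "f \<in> Ar (V (Tgt G u)) \<Longrightarrow> pull u f \<in> Ar (V H)"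
    and pull_Src: "f \<in> Ar (V (Tgt G u)) \<Longrightarrow> Src (V H) (pull u f) = pull_ob u (Src (V (Tgt G u)) f)"
    and pull_Tgt: "f \<in> Ar (V (Tgt G u)) \<Longrightarrow> Tgt (V H) (pull u f) = pull_ob u (Tgt (V (Tgt G u)) f)"
  using functor_simps[OF Pull_is_functor[OF u K H]]
    functor_arrow_simps[OF Pull_is_functor[OF u K H] V_category] K H Tgt_in_Ob[OF u] by auto

lemma Rsh_simps:
  assumes u: "u \<in> J" and K: "Tgt G u = K" and H: "Src G u = H"
  shows push_Ob: "W \<in> Ob (V (Src G u)) \<Longrightarrow> push_ob u W \<in> Ob (V K)"
    and push_Ide: "W \<in> Ob (V H) \<Longrightarrow> push u (Ide (V H) W) = Ide (V (Tgt G u)) (push_ob u W)"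
    and push_Cmp: "f \<in> Ar (V H) \<Longrightarrow> g \<in> Ar (V H) \<Longrightarrow> Src (V H) g = Tgt (V H) f \<Longrightarrow>
      push u (g \<cdot>\<^bsub>V H\<^esub> f) = push u g \<cdot>\<^bsub>V (Tgt G u)\<^esub> push u f"
    and push_Ar: "f \<in> Ar (V (Src G u)) \<Longrightarrow> push u f \<in> Ar (V K)"
    and push_Src: "f \<in> Ar (V (Src G u)) \<Longrightarrow> Src (V K) (push u f) = push_ob u (Src (V (Src G u)) f)"
    and push_Tgt: "f \<in> Ar (V (Src G u)) \<Longrightarrow> Tgt (V K) (push u f) = push_ob u (Tgt (V (Src G u)) f)"
  using functor_simps[OF Rsh_is_functor[OF u K H]]
    functor_arrow_simps[OF Rsh_is_functor[OF u K H] V_category] K H Src_in_Ob[OF J_Ar[OF u]] by auto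

lemma Lsh_simps:
  assumes "u \<in> J"
  shows Lsh_Ob_eq: "W \<in> Ob (V (Src G u)) \<Longrightarrow> FO (Lsh M u) W = push_ob u W"
    and Lsh_Ar_eq: "f \<in> Ar (V (Src G u)) \<Longrightarrow> FA (Lsh M u) f = push u f"
  using Lsh_eq_Rsh[OF assms] by (auto simp: func_eq_def)

lemma Pull_Ide_simps:
  assumes "x \<in> Ob G"
  shows pull_Ide_Ob: "W \<in> Ob (V x) \<Longrightarrow> pull_ob (Ide G x) W = W"
    and pull_Ide_Ar: "f \<in> Ar (V x) \<Longrightarrow> pull (Ide G x) f = f"
  using Pull_Ide[OF assms] by (auto simp: func_eq_def func_id_def)

lemma Pull_Cmp_simps:
  assumes "u \<in> Ar G" "v \<in> Ar G" "Src G u = Tgt G v"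
  shows pull_Cmp_Ob: "W \<in> Ob (V (Tgt G u)) \<Longrightarrow> pull_ob (u \<cdot>\<^bsub>G\<^esub> v) W = pull_ob v (pull_ob u W)"
    and pull_Cmp_Ar: "f \<in> Ar (V (Tgt G u)) \<Longrightarrow> pull (u \<cdot>\<^bsub>G\<^esub> v) f = pull v (pull u f)"
  using Pull_Cmp[OF assms] by (auto simp: func_eq_def func_comp_def)

lemma right_adjunction: "i \<in> J \<Longrightarrow> Tgt G i = K \<Longrightarrow> Src G i = H \<Longrightarrow>
    adjunction (V K) (V H) (Pull M i) (Rsh M i) (runit M i) (rcounit M i)"
  using right_adjoint by blast

text \<open>Rectification lets \<open>i\<^sub>*\<close> be the left adjoint of \<open>i\<^sup>*\<close> itself, so that \<open>i\<^sub>!\<close> does not appear in the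
calculations.\<close>

lemma left_adjunction:
  assumes i: "i \<in> J" and K: "Tgt G i = K" and H: "Src G i = H"
  shows "adjunction (V H) (V K) (Rsh M i) (Pull M i) (lunit M i) (lcounit M i)"
proof -
  note iA = J_Ar[OF i]
  have ob: "H \<in> Ob G" "K \<in> Ob G" using iA K H by (auto simp: G_simps)
  have W: "adjunction (V H) (V K) (Lsh M i) (Pull M i) (lunit M i) (lcounit M i)"
    using left_adjoint[OF i] K H by simp
  note s = V_simps[OF ob(1)] V_simps[OF ob(2)] Pull_simps[OF iA K H] Lsh_simps[OF i, unfolded H]
  have ty: "lunit M i x \<in> Ar (V H)" if "x \<in> Ob (V H)" for x
    using W that by (auto simp: adjunction_def nat_trans_def Hom_def)
  show ?thesis
    using W Rsh_is_functor[OF i K H] ty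
    by (auto simp: adjunction_def nat_trans_def func_comp_def func_id_def s K H)
qed

lemma unit_simps:
  assumes i: "i \<in> J" and K: "Tgt G i = K" and H: "Src G i = H"
  shows lunit_Ar: "W \<in> Ob (V (Src G i)) \<Longrightarrow> lunit M i W \<in> Ar (V H)"
    and lunit_Src: "W \<in> Ob (V (Src G i)) \<Longrightarrow> Src (V H) (lunit M i W) = W"
    and lunit_Tgt: "W \<in> Ob (V (Src G i)) \<Longrightarrow> Tgt (V H) (lunit M i W) = pull_ob i (push_ob i W)"
    and rcounit_Ar: "W \<in> Ob (V (Src G i)) \<Longrightarrow> rcounit M i W \<in> Ar (V H)"
    and rcounit_Tgt: "W \<in> Ob (V (Src G i)) \<Longrightarrow> Tgt (V H) (rcounit M i W) = W"
    and rcounit_Src: "W \<in> Ob (V (Src G i)) \<Longrightarrow> Src (V H) (rcounit M i W) = pull_ob i (push_ob i W)"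
    and runit_Ar: "B \<in> Ob (V (Tgt G i)) \<Longrightarrow> runit M i B \<in> Ar (V K)"
    and runit_Src: "B \<in> Ob (V (Tgt G i)) \<Longrightarrow> Src (V K) (runit M i B) = B"
    and runit_Tgt: "B \<in> Ob (V (Tgt G i)) \<Longrightarrow> Tgt (V K) (runit M i B) = push_ob i (pull_ob i B)"
    and lcounit_Ar: "B \<in> Ob (V (Tgt G i)) \<Longrightarrow> lcounit M i B \<in> Ar (V K)"
    and lcounit_Tgt: "B \<in> Ob (V (Tgt G i)) \<Longrightarrow> Tgt (V K) (lcounit M i B) = B"
    and lcounit_Src: "B \<in> Ob (V (Tgt G i)) \<Longrightarrow> Src (V K) (lcounit M i B) = push_ob i (pull_ob i B)"
  using left_adjunction[OF assms] right_adjunction[OF assms] K H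
  by (auto simp: adjunction_def nat_trans_def func_comp_def func_id_def Hom_def)

lemmas mackey_simps = Hom_def J_Ar G_simps V_simps Pull_simps Rsh_simps Pull_Ide_simps Pull_Cmp_simps unit_simps

section \<open>Transfer of morphisms\<close>

text \<open>The objects \<open>W\<close> and \<open>B\<close> are arguments since \<open>f: i\<^sup>*W \<rightarrow> i\<^sup>*B\<close> does not determine them.\<close>

definition transfer :: "'u \<Rightarrow> 'o \<Rightarrow> 'o \<Rightarrow> 'm \<Rightarrow> 'm" where
  "transfer i W B f = lcounit M i B \<cdot>\<^bsub>V (Tgt G i)\<^esub> (push i f \<cdot>\<^bsub>V (Tgt G i)\<^esub> runit M i W)"

lemma transfer_in_Hom:
  assumes "i \<in> J" "Tgt G i = K" "Src G i = H" "W \<in> Ob (V K)" "B \<in> Ob (V K)"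
    and "f \<in> Hom (V H) (pull_ob i W) (pull_ob i B)"
  shows "transfer i W B f \<in> Hom (V K) W B"
  using assms ends_in_Ob[OF J_Ar[OF assms(1)] assms(2,3)] by (simp add: transfer_def mackey_simps)

text \<open>Transfer is natural in both variables because the left counit and the right unit are. These two rules are the
source of the Frobenius formulas.\<close>

lemma Cmp_transfer:
  assumes i: "i \<in> J" "Tgt G i = K" "Src G i = H" and W: "W \<in> Ob (V K)" 
    and b: "b \<in> Hom (V K) B B'" and f: "f \<in> Hom (V H) (pull_ob i W) (pull_ob i B)"
  shows "b \<cdot>\<^bsub>V K\<^esub> transfer i W B f = transfer i W B' (pull i b \<cdot>\<^bsub>V H\<^esub> f)"
proof -
  have cat: "category (V H)" "category (V K)" and B: "B \<in> Ob (V K)" "B' \<in> Ob (V K)"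
    and ob: "K \<in> Ob G" "H \<in> Ob G"
    using i b V_category ends_in_Ob[OF J_Ar[OF i(1)] i(2,3)] by (auto simp: mackey_simps)
  have "b \<cdot>\<^bsub>V K\<^esub> transfer i W B f = (b \<cdot>\<^bsub>V K\<^esub> (lcounit M i B \<cdot>\<^bsub>V K\<^esub> push i f)) \<cdot>\<^bsub>V K\<^esub> runit M i W"
    using assms B ob by (simp add: transfer_def mackey_simps)
  also have "\<dots> = transfer i W B' (pull i b \<cdot>\<^bsub>V H\<^esub> f)"
    unfolding adjunct_left_natural[OF left_adjunction[OF i] cat b f]
    using assms B ob by (simp add: transfer_def mackey_simps)
  finally show ?thesis .
qed

lemma transfer_Cmp:
  assumes i: "i \<in> J" "Tgt G i = K" "Src G i = H" and B: "B \<in> Ob (V K)" 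
    and a: "a \<in> Hom (V K) W' W" and f: "f \<in> Hom (V H) (pull_ob i W) (pull_ob i B)"
  shows "transfer i W B f \<cdot>\<^bsub>V K\<^esub> a = transfer i W' B (f \<cdot>\<^bsub>V H\<^esub> pull i a)"
proof -
  have cat: "category (V H)" "category (V K)" and W: "W \<in> Ob (V K)" "W' \<in> Ob (V K)"
    and ob: "K \<in> Ob G" "H \<in> Ob G"
    using i a V_category ends_in_Ob[OF J_Ar[OF i(1)] i(2,3)] by (auto simp: mackey_simps)
  have "transfer i W B f \<cdot>\<^bsub>V K\<^esub> a = lcounit M i B \<cdot>\<^bsub>V K\<^esub> ((push i f \<cdot>\<^bsub>V K\<^esub> runit M i W) \<cdot>\<^bsub>V K\<^esub> a)"
    using assms W ob by (simp add: transfer_def mackey_simps)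
  also have "\<dots> = transfer i W' B (f \<cdot>\<^bsub>V H\<^esub> pull i a)"
    unfolding adjunct_right_natural[OF right_adjunction[OF i] cat(2,1) a f]
    using assms W ob by (simp add: transfer_def mackey_simps)
  finally show ?thesis .
qed

lemma Cell_in_Hom:
  assumes "\<gamma> \<in> Hom2 G v w" "Tgt G v = K" "Src G v = H" "W \<in> Ob (V K)"
  shows "Cell M \<gamma> W \<in> Hom (V H) (pull_ob v W) (pull_ob w W)"
  using Cell_nat_trans[OF assms(1)] assms by (auto simp: nat_trans_def)

lemma Cell_natural:
  assumes "\<gamma> \<in> Hom2 G v w" "Tgt G v = K" "Src G v = H" "f \<in> Hom (V K) W B"
  shows "Cell M \<gamma> B \<cdot>\<^bsub>V H\<^esub> pull v f = pull w f \<cdot>\<^bsub>V H\<^esub> Cell M \<gamma> W"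
  using Cell_nat_trans[OF assms(1)] assms by (auto simp: nat_trans_def Hom_def)

text \<open>The left mate is the left adjunct of \<open>\<gamma> p\<^sup>*\<eta>\<close>. By naturality of adjuncts, postcomposing with \<open>u\<^sup>*\<epsilon>\<close> puts
\<open>q\<^sup>*u\<^sup>*\<epsilon>\<close> in front of that arrow; naturality of \<open>\<gamma>\<close> moves it past \<open>\<gamma>\<close>, where a triangle identity cancels it
against \<open>\<eta>\<close>.\<close>

lemma lcounit_lmate:
  assumes J: "i \<in> J" "q \<in> J" and Ar: "p \<in> Ar G" "u \<in> Ar G"
    and eqs: "Tgt G i = K" "Tgt G u = K" "Src G i = H" "Tgt G p = H" "Src G u = L" "Tgt G q = L"
      "Src G p = P" "Src G q = P"
    and c: "\<gamma> \<in> Hom2 G (i \<cdot>\<^bsub>G\<^esub> p) (u \<cdot>\<^bsub>G\<^esub> q)" and B: "B \<in> Ob (V K)"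
  shows "pull u (lcounit M i B) \<cdot>\<^bsub>V L\<^esub> lmate G M i u p q \<gamma> (pull_ob i B) =
    lcounit M q (pull_ob u B) \<cdot>\<^bsub>V L\<^esub> push q (Cell M \<gamma> B)"
    and "lmate G M i u p q \<gamma> (pull_ob i B) \<in> Hom (V L) (push_ob q (pull_ob p (pull_ob i B))) (pull_ob u (push_ob i (pull_ob i B)))"
proof -
  define W where "W = push_ob i (pull_ob i B)"
  have cat: "category (V P)" "category (V L)" "category (V H)" "category (V K)"
    and ob: "P \<in> Ob G" "L \<in> Ob G" "H \<in> Ob G" "K \<in> Ob G"
    using V_category ends_in_Ob[OF Ar(1) eqs(4,7)] ends_in_Ob[OF Ar(2) eqs(2,5)] by auto
  have W: "W \<in> Ob (V K)" using W_def B J eqs ob by (simp add: mackey_simps)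
  have src: "Tgt G (i \<cdot>\<^bsub>G\<^esub> p) = K" "Src G (i \<cdot>\<^bsub>G\<^esub> p) = P" using J Ar eqs ob by (auto simp: mackey_simps)
  have cA: "Cell M \<gamma> W \<in> Hom (V P) (pull_ob p (pull_ob i W)) (pull_ob q (pull_ob u W))"
    and cB: "Cell M \<gamma> B \<in> Hom (V P) (pull_ob p (pull_ob i B)) (pull_ob q (pull_ob u B))"
    using Cell_in_Hom[OF c src W] Cell_in_Hom[OF c src B] W B J Ar eqs ob by (auto simp: mackey_simps)
  define g where "g = Cell M \<gamma> W \<cdot>\<^bsub>V P\<^esub> pull p (lunit M i (pull_ob i B))"
  have un: "lunit M i (pull_ob i B) \<in> Hom (V H) (pull_ob i B) (pull_ob i W)"
    using B J Ar eqs ob by (simp add: mackey_simps W_def)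
  have co: "lcounit M i B \<in> Hom (V K) W B" using B J Ar eqs ob by (simp add: mackey_simps W_def)
  have g: "g \<in> Hom (V P) (pull_ob p (pull_ob i B)) (pull_ob q (pull_ob u W))"
    unfolding g_def using cA un Ar eqs ob by (simp add: mackey_simps)
  have L: "lmate G M i u p q \<gamma> (pull_ob i B) = lcounit M q (pull_ob u W) \<cdot>\<^bsub>V L\<^esub> push q g"
    using cA un W B J Ar eqs ob unfolding lmate_def g_def
    by (simp add: mackey_simps Lsh_simps W_def[symmetric])
  show "lmate G M i u p q \<gamma> (pull_ob i B) \<in> Hom (V L) (push_ob q (pull_ob p (pull_ob i B))) (pull_ob u (push_ob i (pull_ob i B)))"
    unfolding L W_def[symmetric] using W g J Ar eqs ob by (simp add: mackey_simps)
  have ph: "pull u (lcounit M i B) \<in> Hom (V L) (pull_ob u W) (pull_ob u B)"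
    using co Ar eqs ob by (simp add: mackey_simps)
  have "pull q (pull u (lcounit M i B)) \<cdot>\<^bsub>V P\<^esub> g = (pull (u \<cdot>\<^bsub>G\<^esub> q) (lcounit M i B) \<cdot>\<^bsub>V P\<^esub> Cell M \<gamma> W) \<cdot>\<^bsub>V P\<^esub> pull p (lunit M i (pull_ob i B))"
    using co cA un J Ar eqs ob unfolding g_def by (simp add: mackey_simps)
  also have "\<dots> = (Cell M \<gamma> B \<cdot>\<^bsub>V P\<^esub> pull (i \<cdot>\<^bsub>G\<^esub> p) (lcounit M i B)) \<cdot>\<^bsub>V P\<^esub> pull p (lunit M i (pull_ob i B))"
    by (simp add: Cell_natural[OF c src co])
  also have "\<dots> = Cell M \<gamma> B \<cdot>\<^bsub>V P\<^esub> pull p (pull i (lcounit M i B) \<cdot>\<^bsub>V H\<^esub> lunit M i (pull_ob i B))"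
    using co cB un J Ar eqs ob by (simp add: mackey_simps)
  also have "pull i (lcounit M i B) \<cdot>\<^bsub>V H\<^esub> lunit M i (pull_ob i B) = Ide (V H) (pull_ob i B)"
    using left_adjunction[OF J(1) eqs(1,3)] B by (auto simp: adjunction_def)
  also have "Cell M \<gamma> B \<cdot>\<^bsub>V P\<^esub> pull p \<dots> = Cell M \<gamma> B"
    using cB B J Ar eqs ob by (simp add: mackey_simps)
  finally have *: "pull q (pull u (lcounit M i B)) \<cdot>\<^bsub>V P\<^esub> g = Cell M \<gamma> B" .
  show "pull u (lcounit M i B) \<cdot>\<^bsub>V L\<^esub> lmate G M i u p q \<gamma> (pull_ob i B) =
    lcounit M q (pull_ob u B) \<cdot>\<^bsub>V L\<^esub> push q (Cell M \<gamma> B)"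
    unfolding L using adjunct_left_natural[OF left_adjunction[OF J(2) eqs(6,8)] cat(1,2) ph g]
    by (simp add: *)
qed

lemma adjunct_eval:
  assumes J: "i \<in> J" and eqs: "Tgt G i = K" "Src G i = H"
    and W: "W \<in> Ob (V K)" and X: "X \<in> Ob (V H)" and f: "f \<in> Hom (V H) (pull_ob i W) X"
  shows "rcounit M i X \<cdot>\<^bsub>V H\<^esub> pull i (push i f \<cdot>\<^bsub>V K\<^esub> runit M i W) = f"
  using adjunct_right_inverse[OF right_adjunction[OF J eqs] _ _ W X f] V_category
    ends_in_Ob[OF J_Ar[OF J] eqs] by blast

text \<open>The counterpart of \<open>lcounit_lmate\<close> for right mates. It is stated for the right adjunct of an arbitrary
\<open>f: i\<^sup>*W \<rightarrow> X\<close>, not only for the unit, so that naturality of the mate in \<open>X\<close> is included.\<close>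

lemma rmate_transpose:
  assumes J: "i \<in> J" "q \<in> J" and Ar: "p \<in> Ar G" "u \<in> Ar G"
    and eqs: "Tgt G i = K" "Tgt G u = K" "Src G i = H" "Tgt G p = H" "Src G u = L" "Tgt G q = L"
      "Src G p = P" "Src G q = P"
    and c: "\<delta> \<in> Hom2 G (u \<cdot>\<^bsub>G\<^esub> q) (i \<cdot>\<^bsub>G\<^esub> p)" and W: "W \<in> Ob (V K)" 
    and X: "X \<in> Ob (V H)" and f: "f \<in> Hom (V H) (pull_ob i W) X"
  shows "rmate G M i u p q \<delta> X \<cdot>\<^bsub>V L\<^esub> pull u (push i f \<cdot>\<^bsub>V K\<^esub> runit M i W) =
    push q (pull p f \<cdot>\<^bsub>V P\<^esub> Cell M \<delta> W) \<cdot>\<^bsub>V L\<^esub> runit M q (pull_ob u W)"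
    and "rmate G M i u p q \<delta> X \<in> Hom (V L) (pull_ob u (push_ob i X)) (push_ob q (pull_ob p X))"
proof -
  define Y where "Y = push_ob i X"
  define h where "h = push i f \<cdot>\<^bsub>V K\<^esub> runit M i W"
  have cat: "category (V P)" "category (V L)" "category (V H)" "category (V K)"
    and ob: "P \<in> Ob G" "L \<in> Ob G" "H \<in> Ob G" "K \<in> Ob G"
    using V_category ends_in_Ob[OF Ar(1) eqs(4,7)] ends_in_Ob[OF Ar(2) eqs(2,5)] by auto
  have Y: "Y \<in> Ob (V K)" using Y_def X J eqs ob by (simp add: mackey_simps)
  have h: "h \<in> Hom (V K) W Y" using W X f J eqs ob by (simp add: h_def Y_def mackey_simps)
  have src: "Tgt G (u \<cdot>\<^bsub>G\<^esub> q) = K" "Src G (u \<cdot>\<^bsub>G\<^esub> q) = P" using J Ar eqs ob by (auto simp: mackey_simps)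
  have cA: "Cell M \<delta> W \<in> Hom (V P) (pull_ob q (pull_ob u W)) (pull_ob p (pull_ob i W))"
    and cY: "Cell M \<delta> Y \<in> Hom (V P) (pull_ob q (pull_ob u Y)) (pull_ob p (pull_ob i Y))"
    using Cell_in_Hom[OF c src W] Cell_in_Hom[OF c src Y] W Y J Ar eqs ob by (auto simp: mackey_simps)
  have co: "rcounit M i X \<in> Hom (V H) (pull_ob i Y) X"
    using X J Ar eqs ob by (simp add: mackey_simps Y_def)
  define g where "g = pull p (rcounit M i X) \<cdot>\<^bsub>V P\<^esub> Cell M \<delta> Y"
  have g: "g \<in> Hom (V P) (pull_ob q (pull_ob u Y)) (pull_ob p X)"
    unfolding g_def using cY co Ar eqs ob by (simp add: mackey_simps)
  have R: "rmate G M i u p q \<delta> X = push q g \<cdot>\<^bsub>V L\<^esub> runit M q (pull_ob u Y)"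
    using cY co Y X J Ar eqs ob unfolding rmate_def g_def
    by (simp add: mackey_simps Y_def[symmetric])
  show "rmate G M i u p q \<delta> X \<in> Hom (V L) (pull_ob u (push_ob i X)) (push_ob q (pull_ob p X))"
    unfolding R Y_def[symmetric] using Y g J Ar eqs ob by (simp add: mackey_simps)
  have ph: "pull u h \<in> Hom (V L) (pull_ob u W) (pull_ob u Y)"
    using h Ar eqs ob by (simp add: mackey_simps)
  have "g \<cdot>\<^bsub>V P\<^esub> pull q (pull u h) = pull p (rcounit M i X) \<cdot>\<^bsub>V P\<^esub> (Cell M \<delta> Y \<cdot>\<^bsub>V P\<^esub> pull (u \<cdot>\<^bsub>G\<^esub> q) h)"
    using co cY h J Ar eqs ob unfolding g_def by (simp add: mackey_simps)
  also have "\<dots> = pull p (rcounit M i X) \<cdot>\<^bsub>V P\<^esub> (pull (i \<cdot>\<^bsub>G\<^esub> p) h \<cdot>\<^bsub>V P\<^esub> Cell M \<delta> W)"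
    by (simp add: Cell_natural[OF c src h])
  also have "\<dots> = pull p (rcounit M i X \<cdot>\<^bsub>V H\<^esub> pull i h) \<cdot>\<^bsub>V P\<^esub> Cell M \<delta> W"
    using co cA h J Ar eqs ob by (simp add: mackey_simps)
  also have "rcounit M i X \<cdot>\<^bsub>V H\<^esub> pull i h = f"
    using adjunct_eval[OF J(1) eqs(1,3) W X f] by (simp add: h_def)
  finally show "rmate G M i u p q \<delta> X \<cdot>\<^bsub>V L\<^esub> pull u (push i f \<cdot>\<^bsub>V K\<^esub> runit M i W) =
    push q (pull p f \<cdot>\<^bsub>V P\<^esub> Cell M \<delta> W) \<cdot>\<^bsub>V L\<^esub> runit M q (pull_ob u W)"
    unfolding R h_def[symmetric] 
    using adjunct_right_natural[OF right_adjunction[OF J(2) eqs(6,8)] cat(2,1) ph g] by simp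
qed

text \<open>Insert the identity \<open>l r\<close> of \<open>u\<^sup>*i\<^sub>*i\<^sup>*B\<close> between the two halves of \<open>u\<^sup>*(tr\<^sub>i f)\<close>, where \<open>l\<close> and \<open>r\<close> are the two mates of
the square. The left mate turns the counit of \<open>i\<close> into that of \<open>q\<close>, the right mate turns the unit of \<open>i\<close> into
that of \<open>q\<close>.\<close>

lemma transfer_base_change:
  assumes sq: "mackey_square G J i u p q \<gamma>"
    and W: "W \<in> Ob (V (Tgt G i))" and B: "B \<in> Ob (V (Tgt G i))"
    and f: "f \<in> Hom (V (Src G i)) (pull_ob i W) (pull_ob i B)"
  shows "pull u (transfer i W B f) = transfer q (pull_ob u W) (pull_ob u B)
    (Cell M \<gamma> B \<cdot>\<^bsub>V (Src G q)\<^esub> pull p f \<cdot>\<^bsub>V (Src G q)\<^esub> Cell M (inv_arr (Two G) \<gamma>) W)"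
proof -
  define H K L P where "H = Src G i" and "K = Tgt G i" and "L = Src G u" and "P = Src G q"
  let ?\<delta> = "inv_arr (Two G) \<gamma>"
  have J: "i \<in> J" "q \<in> J" and Ar: "p \<in> Ar G" "u \<in> Ar G"
    and eqs: "Tgt G i = K" "Tgt G u = K" "Src G i = H" "Tgt G p = H" "Src G u = L" "Tgt G q = L"
      "Src G p = P" "Src G q = P"
    and c: "\<gamma> \<in> Hom2 G (i \<cdot>\<^bsub>G\<^esub> p) (u \<cdot>\<^bsub>G\<^esub> q)" and iso: "is_iso (Two G) \<gamma>"
    using sq by (auto simp: mackey_square_def pseudopullback_def Hom_def H_def K_def L_def P_def)
  have d: "?\<delta> \<in> Hom2 G (u \<cdot>\<^bsub>G\<^esub> q) (i \<cdot>\<^bsub>G\<^esub> p)"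
    using inverse_arrowsD(1)[OF inverse_arrows_inv_arr[OF Two_category iso] c] .
  have ob: "P \<in> Ob G" "L \<in> Ob G" "H \<in> Ob G" "K \<in> Ob G"
    using ends_in_Ob[OF Ar(1) eqs(4,7)] ends_in_Ob[OF Ar(2) eqs(2,5)] by auto
  have src: "Tgt G (i \<cdot>\<^bsub>G\<^esub> p) = K" "Src G (i \<cdot>\<^bsub>G\<^esub> p) = P"
      "Tgt G (u \<cdot>\<^bsub>G\<^esub> q) = K" "Src G (u \<cdot>\<^bsub>G\<^esub> q) = P" using J Ar eqs by (auto simp: mackey_simps)
  have W: "W \<in> Ob (V K)" and B: "B \<in> Ob (V K)" and f: "f \<in> Hom (V H) (pull_ob i W) (pull_ob i B)"
    using assms eqs by auto
  have cB: "Cell M \<gamma> B \<in> Hom (V P) (pull_ob p (pull_ob i B)) (pull_ob q (pull_ob u B))"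
    and dW: "Cell M ?\<delta> W \<in> Hom (V P) (pull_ob q (pull_ob u W)) (pull_ob p (pull_ob i W))"
    using Cell_in_Hom[OF c src(1,2) B] Cell_in_Hom[OF d src(3,4) W] B W J Ar eqs
    by (auto simp: mackey_simps)
  define X where "X = pull_ob i B"
  have X: "X \<in> Ob (V H)" using B J eqs ob by (simp add: X_def mackey_simps)
  define l r where "l = lmate G M i u p q \<gamma> X" and "r = rmate G M i u p q ?\<delta> X"
  have l: "l \<in> Hom (V L) (push_ob q (pull_ob p X)) (pull_ob u (push_ob i X))"
    and lE: "pull u (lcounit M i B) \<cdot>\<^bsub>V L\<^esub> l = lcounit M q (pull_ob u B) \<cdot>\<^bsub>V L\<^esub> push q (Cell M \<gamma> B)"
    unfolding l_def X_def using lcounit_lmate[OF J Ar eqs c B] by auto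
  define g where "g = push i f \<cdot>\<^bsub>V K\<^esub> runit M i W"
  have g: "g \<in> Hom (V K) W (push_ob i X)" using W f J eqs ob by (simp add: g_def X_def mackey_simps)
  have r: "r \<in> Hom (V L) (pull_ob u (push_ob i X)) (push_ob q (pull_ob p X))"
    and rE: "r \<cdot>\<^bsub>V L\<^esub> pull u g = push q (pull p f \<cdot>\<^bsub>V P\<^esub> Cell M ?\<delta> W) \<cdot>\<^bsub>V L\<^esub> runit M q (pull_ob u W)"
    unfolding r_def g_def using rmate_transpose[OF J Ar eqs d W X] f by (auto simp: X_def)
  have "inv_arr (V L) l = r" "is_iso (V L) l"
    using base_change_inverse[OF sq] base_change_left[OF sq] X eqs by (auto simp: l_def r_def)
  hence lr: "l \<cdot>\<^bsub>V L\<^esub> r = Ide (V L) (pull_ob u (push_ob i X))"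
    using inverse_arrowsD(3)[OF inverse_arrows_inv_arr[OF V_category[OF ob(2)]] l] by simp
  \<comment> \<open>The identity written out here is the one that is then replaced by \<open>l r\<close>.\<close>
  have "pull u (transfer i W B f) = pull u (lcounit M i B) \<cdot>\<^bsub>V L\<^esub> (Ide (V L) (pull_ob u (push_ob i X)) \<cdot>\<^bsub>V L\<^esub> pull u g)"
    using g W B J Ar eqs ob by (simp add: transfer_def g_def[symmetric] mackey_simps X_def)
  also have "\<dots> = (pull u (lcounit M i B) \<cdot>\<^bsub>V L\<^esub> l) \<cdot>\<^bsub>V L\<^esub> (r \<cdot>\<^bsub>V L\<^esub> pull u g)"
    unfolding lr[symmetric] using g l r W B J Ar eqs ob by (simp add: mackey_simps X_def)
  also have "\<dots> = transfer q (pull_ob u W) (pull_ob u B) (Cell M \<gamma> B \<cdot>\<^bsub>V P\<^esub> pull p f \<cdot>\<^bsub>V P\<^esub> Cell M ?\<delta> W)"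
    unfolding lE rE transfer_def using f cB dW W B J Ar eqs ob by (simp add: mackey_simps)
  finally show ?thesis by (simp add: P_def)
qed

text \<open>Both mates of \<open>\<alpha>\<close>, seen as a square with two identity sides, are the same map \<open>m: j\<^sub>*X \<rightarrow> i\<^sub>*X\<close>. Read as a left
mate, it changes the counit of \<open>i\<close> to that of \<open>j\<close>; read as a right mate, it changes the unit of \<open>j\<close> to that of
\<open>i\<close>. The dinatural form avoids the inverse of \<open>\<alpha>\<close>.\<close>

lemma transfer_dinatural:
  assumes J: "i \<in> J" "j \<in> J" and c: "\<alpha> \<in> Hom2 G i j"
    and W: "W \<in> Ob (V (Tgt G i))" and B: "B \<in> Ob (V (Tgt G i))"
    and h: "h \<in> Hom (V (Src G i)) (pull_ob j W) (pull_ob i B)"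
  shows "transfer i W B (h \<cdot>\<^bsub>V (Src G i)\<^esub> Cell M \<alpha> W) = transfer j W B (Cell M \<alpha> B \<cdot>\<^bsub>V (Src G i)\<^esub> h)"
proof -
  define H K where "H = Src G i" and "K = Tgt G i"
  have eqs: "Tgt G i = K" "Src G i = H" "Tgt G j = K" "Src G j = H"
    using parallel[OF c] by (auto simp: H_def K_def)
  have ob: "K \<in> Ob G" "H \<in> Ob G" using ends_in_Ob[OF J_Ar[OF J(1)] eqs(1,2)] by auto
  have W: "W \<in> Ob (V K)" and B: "B \<in> Ob (V K)" and h: "h \<in> Hom (V H) (pull_ob j W) (pull_ob i B)"
    using assms eqs by auto
  define X where "X = pull_ob i B"
  have X: "X \<in> Ob (V H)" using B J eqs ob by (simp add: X_def mackey_simps)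
  have I: "Ide G H \<in> Ar G" "Ide G K \<in> Ar G" "Tgt G (Ide G H) = H" "Src G (Ide G H) = H"
     "Tgt G (Ide G K) = K" "Src G (Ide G K) = K" using ob by (auto simp: G_simps)
  have c1: "\<alpha> \<in> Hom2 G (i \<cdot>\<^bsub>G\<^esub> Ide G H) (Ide G K \<cdot>\<^bsub>G\<^esub> j)" 
    "\<alpha> \<in> Hom2 G (Ide G K \<cdot>\<^bsub>G\<^esub> i) (j \<cdot>\<^bsub>G\<^esub> Ide G H)"
    using c J eqs by (auto simp: mackey_simps)
  have aW: "Cell M \<alpha> W \<in> Hom (V H) (pull_ob i W) (pull_ob j W)"
    and aB: "Cell M \<alpha> B \<in> Hom (V H) (pull_ob i B) (pull_ob j B)"
    using Cell_in_Hom[OF c eqs(1,2)] W B by auto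
  define m where "m = lmate G M i (Ide G K) (Ide G H) j \<alpha> X"
  have m': "m = rmate G M j (Ide G K) (Ide G H) i \<alpha> X"
    using pseudofunctors_2cells[OF J c] X eqs by (simp add: m_def)
  note ml = lcounit_lmate[OF J I(1,2) eqs(1) I(5) eqs(2) I(3,6) eqs(3) I(4) eqs(4) c1(1) B]
  define g where "g = push j h \<cdot>\<^bsub>V K\<^esub> runit M j W"
  have g: "g \<in> Hom (V K) W (push_ob j X)" using W h J eqs ob by (simp add: g_def X_def mackey_simps)
  note mr = rmate_transpose[OF J(2,1) I(1,2) eqs(3) I(5) eqs(4) I(3,6) eqs(1) I(4) eqs(2) c1(2) W X]
  have m: "m \<in> Hom (V K) (push_ob j X) (push_ob i X)" 
    and lE: "lcounit M i B \<cdot>\<^bsub>V K\<^esub> m = lcounit M j B \<cdot>\<^bsub>V K\<^esub> push j (Cell M \<alpha> B)"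
    using ml B J eqs ob unfolding m_def X_def by (simp_all add: mackey_simps)
  have rE: "m \<cdot>\<^bsub>V K\<^esub> g = push i (h \<cdot>\<^bsub>V H\<^esub> Cell M \<alpha> W) \<cdot>\<^bsub>V K\<^esub> runit M i W"
    using mr[of h] W h g J eqs ob unfolding m' g_def X_def by (simp add: mackey_simps)
  have "transfer i W B (h \<cdot>\<^bsub>V H\<^esub> Cell M \<alpha> W) = (lcounit M i B \<cdot>\<^bsub>V K\<^esub> m) \<cdot>\<^bsub>V K\<^esub> g"
    using m g B W J eqs ob by (simp add: transfer_def rE[symmetric] mackey_simps X_def)
  also have "\<dots> = transfer j W B (Cell M \<alpha> B \<cdot>\<^bsub>V H\<^esub> h)"
    unfolding lE transfer_def g_def using h aB aW W B J eqs ob by (simp add: mackey_simps)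
  finally show ?thesis by (simp add: H_def)
qed

lemma isomorphic_1cells_refl: "u \<in> Ar G \<Longrightarrow> isomorphic_1cells G u u"
  unfolding isomorphic_1cells_def is_iso_def inverse_arrows_def
  by (intro bexI[of _ "Ide2 G u"] exI[of _ "Ide2 G u"]) (auto simp: Hom_def Two_simps Ob_Two)

lemma Ide_in_J:
  assumes x: "x \<in> Ob G" shows "Ide G x \<in> J"
proof (rule J_equivalence)
  have I: "Ide G x \<in> Ar G" "Src G (Ide G x) = x" "Tgt G (Ide G x) = x"
    "Ide G x \<cdot>\<^bsub>G\<^esub> Ide G x = Ide G x"
    using x by (auto simp: G_simps)
  then have "Ide G x \<in> Hom G (Tgt G (Ide G x)) (Src G (Ide G x))" by (simp add: Hom_def)
  with I show "is_equivalence_1cell G (Ide G x)"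
    unfolding is_equivalence_1cell_def
    by (intro conjI bexI[of _ "Ide G x"]) (simp_all add: isomorphic_1cells_refl)
qed

text \<open>Since \<open>Id\<^sup>*\<close> is the identity, naturality of the right unit takes \<open>f\<close> out of \<open>Id\<^sub>*f\<close> to the right, and the left
counit and the right unit of the identity 1-cell that remain are mutually inverse.\<close>

lemma transfer_Ide:
  assumes x: "x \<in> Ob G" and W: "W \<in> Ob (V x)" and B: "B \<in> Ob (V x)"
    and f: "f \<in> Hom (V x) W B"
  shows "transfer (Ide G x) W B f = f"
proof -
  have J: "Ide G x \<in> J" using x by (rule Ide_in_J)
  have eqs: "Tgt G (Ide G x) = x" "Src G (Ide G x) = x" using x by (auto simp: mackey_simps)
  have n: "runit M (Ide G x) B \<cdot>\<^bsub>V x\<^esub> f = push (Ide G x) f \<cdot>\<^bsub>V x\<^esub> runit M (Ide G x) W"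
    using right_adjunction[OF J eqs] f x 
    by (auto simp: adjunction_def nat_trans_def func_id_def func_comp_def mackey_simps)
  have i: "lcounit M (Ide G x) B \<cdot>\<^bsub>V x\<^esub> runit M (Ide G x) B = Ide (V x) B"
    using inverse_arrowsD(3)[OF pseudofunctors_Ide[OF x B], of _ B] B x J eqs by (simp add: mackey_simps)
  have "transfer (Ide G x) W B f = (lcounit M (Ide G x) B \<cdot>\<^bsub>V x\<^esub> runit M (Ide G x) B) \<cdot>\<^bsub>V x\<^esub> f"
    using x W B f J eqs n[symmetric] by (simp add: transfer_def mackey_simps)
  also have "\<dots> = f" using f B x by (simp add: i mackey_simps)
  finally show ?thesis .
qed

text \<open>The left and right structure isomorphisms \<open>S: (i j)\<^sub>! \<rightarrow> i\<^sub>! j\<^sub>!\<close> and \<open>T: i\<^sub>* j\<^sub>* \<rightarrow> (i j)\<^sub>*\<close> play the part of the two mates in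
\<open>transfer_base_change\<close>, and \<open>S T = 1\<close> is inserted in the same way.\<close>

lemma transfer_comp:
  assumes J: "i \<in> J" "j \<in> J" and eqs: "Tgt G i = K" "Src G i = H" "Tgt G j = H" "Src G j = L"
    and W: "W \<in> Ob (V K)" and B: "B \<in> Ob (V K)"
    and f: "f \<in> Hom (V L) (pull_ob j (pull_ob i W)) (pull_ob j (pull_ob i B))"
  shows "transfer (i \<cdot>\<^bsub>G\<^esub> j) W B f = transfer i W B (transfer j (pull_ob i W) (pull_ob i B) f)"
proof -
  define ij where "ij = i \<cdot>\<^bsub>G\<^esub> j"
  have ijJ: "ij \<in> J" and ije: "Tgt G ij = K" "Src G ij = L"
    using J_Cmp[OF J] J eqs by (auto simp: ij_def mackey_simps)
  have ob: "K \<in> Ob G" "H \<in> Ob G" "L \<in> Ob G" 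
    using ends_in_Ob[OF J_Ar[OF J(1)] eqs(1,2)] ends_in_Ob[OF J_Ar[OF J(2)] eqs(3,4)] by auto
  have cat: "category (V K)" "category (V H)" "category (V L)" using ob V_category by auto
  have ijO: "pull_ob ij Y = pull_ob j (pull_ob i Y)" if "Y \<in> Ob (V K)" for Y
    using that J eqs unfolding ij_def by (simp add: mackey_simps)
  have ijA: "pull ij h = pull j (pull i h)" if "h \<in> Ar (V K)" for h
    using that J eqs unfolding ij_def by (simp add: mackey_simps)
  define D where "D = pull_ob i B"
  define X where "X = pull_ob j D"
  have D: "D \<in> Ob (V H)" using B J eqs ob by (simp add: D_def mackey_simps)
  have X: "X \<in> Ob (V L)" using D J eqs ob by (simp add: X_def mackey_simps)
  have f: "f \<in> Hom (V L) (pull_ob j (pull_ob i W)) X" using f by (simp add: X_def D_def)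
  define Y where "Y = push_ob i (push_ob j X)"
  have Y: "Y \<in> Ob (V K)" using X J eqs ob by (simp add: Y_def mackey_simps)
  \<comment> \<open>\<open>sg\<close> and \<open>tg\<close> are the composite unit and counit; \<open>S\<close> and \<open>T\<close> are their adjuncts for \<open>i j\<close>.\<close>
  define sg where "sg = pull j (lunit M i (push_ob j X)) \<cdot>\<^bsub>V L\<^esub> lunit M j X"
  define S where "S = lcounit M ij Y \<cdot>\<^bsub>V K\<^esub> push ij sg"
  define tg where "tg = rcounit M j X \<cdot>\<^bsub>V L\<^esub> pull j (rcounit M i (push_ob j X))"
  define T where "T = push ij tg \<cdot>\<^bsub>V K\<^esub> runit M ij Y"
  have sg: "sg \<in> Hom (V L) X (pull_ob ij Y)" and tg: "tg \<in> Hom (V L) (pull_ob ij Y) X"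
    using X Y J eqs ob by (simp_all add: sg_def tg_def Y_def mackey_simps ijO)
  have S: "S \<in> Hom (V K) (push_ob ij X) Y" and T: "T \<in> Hom (V K) Y (push_ob ij X)"
    using sg tg X Y ijJ ije ob unfolding S_def T_def by (simp_all add: mackey_simps)
  have "inverse_arrows (V K) S T"
    using pseudofunctors_Cmp[OF J, of X] eqs X sg J ijJ ije ob
    unfolding S_def T_def sg_def tg_def Y_def
    by (simp add: ij_def[symmetric] Lsh_simps mackey_simps)
  hence ST: "S \<cdot>\<^bsub>V K\<^esub> T = Ide (V K) Y" by (rule inverse_arrowsD(3)[OF _ S])
  \<comment> \<open>The left counit of the composite adjunction.\<close>
  define e where "e = lcounit M i B \<cdot>\<^bsub>V K\<^esub> push i (lcounit M j D)"
  have e: "e \<in> Hom (V K) Y B" using D B J eqs ob by (simp add: e_def Y_def X_def D_def[symmetric] mackey_simps)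
  define g where "g = push j f \<cdot>\<^bsub>V H\<^esub> runit M j (pull_ob i W)"
  have g: "g \<in> Hom (V H) (pull_ob i W) (push_ob j X)" using f W X J eqs ob by (simp add: g_def mackey_simps)
  \<comment> \<open>The iterated right adjunct of \<open>f\<close>, along \<open>j\<close> and then along \<open>i\<close>.\<close>
  define h where "h = push i g \<cdot>\<^bsub>V K\<^esub> runit M i W"
  have h: "h \<in> Hom (V K) W Y" using g W X J eqs ob by (simp add: h_def Y_def mackey_simps)
  have jD: "lcounit M j D \<in> Hom (V H) (push_ob j X) D" using D J eqs ob by (simp add: mackey_simps X_def)
  have "pull ij e \<cdot>\<^bsub>V L\<^esub> sg = pull j (pull i e \<cdot>\<^bsub>V H\<^esub> lunit M i (push_ob j X)) \<cdot>\<^bsub>V L\<^esub> lunit M j X"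
    using e X J eqs ob unfolding sg_def Y_def by (simp add: ijA mackey_simps)
  also have "pull i e \<cdot>\<^bsub>V H\<^esub> lunit M i (push_ob j X) = lcounit M j D"
    unfolding e_def
    using adjunct_left_inverse[OF left_adjunction[OF J(1) eqs(1,2)] cat(2,1) _ B jD[unfolded D_def]]
      X J eqs ob by (simp add: D_def mackey_simps)
  also have "pull j (lcounit M j D) \<cdot>\<^bsub>V L\<^esub> lunit M j X = Ide (V L) X"
    using left_adjunction[OF J(2) eqs(3,4)] D by (auto simp: adjunction_def X_def)
  finally have esg: "pull ij e \<cdot>\<^bsub>V L\<^esub> sg = Ide (V L) X" .
  have eS: "e \<cdot>\<^bsub>V K\<^esub> S = lcounit M ij B"
    unfolding S_def adjunct_left_natural[OF left_adjunction[OF ijJ ije] cat(3,1) e sg] esg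
    using X B ijJ ije ob ijO by (simp add: mackey_simps X_def D_def)
  have "tg \<cdot>\<^bsub>V L\<^esub> pull ij h = rcounit M j X \<cdot>\<^bsub>V L\<^esub> pull j (rcounit M i (push_ob j X) \<cdot>\<^bsub>V H\<^esub> pull i h)"
    using h X J eqs ob unfolding tg_def Y_def by (simp add: ijA mackey_simps)
  also have "rcounit M i (push_ob j X) \<cdot>\<^bsub>V H\<^esub> pull i h = g"
    unfolding h_def using adjunct_eval[OF J(1) eqs(1,2) W _ g] X J eqs ob by (simp add: mackey_simps)
  also have "rcounit M j X \<cdot>\<^bsub>V L\<^esub> pull j g = f"
    unfolding g_def using adjunct_eval[OF J(2) eqs(3,4) _ X f] W J eqs ob by (simp add: mackey_simps)
  finally have tgh: "tg \<cdot>\<^bsub>V L\<^esub> pull ij h = f" .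
  have Th: "T \<cdot>\<^bsub>V K\<^esub> h = push ij f \<cdot>\<^bsub>V K\<^esub> runit M ij W"
    unfolding T_def adjunct_right_natural[OF right_adjunction[OF ijJ ije] cat(1,3) h tg] tgh ..
  have "transfer ij W B f = (e \<cdot>\<^bsub>V K\<^esub> S) \<cdot>\<^bsub>V K\<^esub> (T \<cdot>\<^bsub>V K\<^esub> h)"
    using ije by (simp add: transfer_def eS Th)
  also have "\<dots> = e \<cdot>\<^bsub>V K\<^esub> ((S \<cdot>\<^bsub>V K\<^esub> T) \<cdot>\<^bsub>V K\<^esub> h)"
    using e S T h ob by (simp add: mackey_simps)
  also have "\<dots> = e \<cdot>\<^bsub>V K\<^esub> h" unfolding ST using h ob by (simp add: mackey_simps)
  also have "\<dots> = transfer i W B (lcounit M j D \<cdot>\<^bsub>V H\<^esub> g)"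
    using jD g W B J eqs ob unfolding transfer_def e_def h_def by (simp add: mackey_simps D_def)
  also have "lcounit M j D \<cdot>\<^bsub>V H\<^esub> g = transfer j (pull_ob i W) (pull_ob i B) f"
    using eqs by (simp add: transfer_def g_def D_def)
  finally show ?thesis by (simp add: ij_def)
qed

lemmas Add_in_Hom = linear_category.Add_in_Hom[OF V_linear]
lemmas Scal_in_Hom = linear_category.Scal_in_Hom[OF V_linear]

lemma transfer_Add:
  assumes i: "i \<in> J" and eqs: "Tgt G i = K" "Src G i = H" and W: "W \<in> Ob (V K)" and B: "B \<in> Ob (V K)"
    and f: "f \<in> Hom (V H) (pull_ob i W) (pull_ob i B)" and g: "g \<in> Hom (V H) (pull_ob i W) (pull_ob i B)"
  shows "transfer i W B (Add (V H) f g) = Add (V K) (transfer i W B f) (transfer i W B g)"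
proof -
  have ob: "K \<in> Ob G" "H \<in> Ob G" using ends_in_Ob[OF J_Ar[OF i] eqs] by auto
  interpret K: linear_category k "V K" using ob by (simp add: V_linear)
  have p: "push i (Add (V H) f g) = Add (V K) (push i f) (push i g)"
    by (rule linear_functor_Add[OF Rsh_linear_functor[OF i eqs] V_category[OF ob(2)] f g])
  have ty: "push i f \<in> Hom (V K) (push_ob i (pull_ob i W)) (push_ob i (pull_ob i B))"
    "push i g \<in> Hom (V K) (push_ob i (pull_ob i W)) (push_ob i (pull_ob i B))"
    "runit M i W \<in> Hom (V K) W (push_ob i (pull_ob i W))"
    "lcounit M i B \<in> Hom (V K) (push_ob i (pull_ob i B)) B"
    using f g i eqs W B by (auto simp: mackey_simps)
  show ?thesis unfolding transfer_def p eqs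
    by (simp add: K.Cmp_Add_left[OF ty(3,1,2)]
      K.Cmp_Add_right[OF K.Cmp_in_Hom[OF ty(3,1)] K.Cmp_in_Hom[OF ty(3,2)] ty(4)])
qed

lemma transfer_Scal:
  assumes i: "i \<in> J" and eqs: "Tgt G i = K" "Src G i = H" and W: "W \<in> Ob (V K)" and B: "B \<in> Ob (V K)"
    and f: "f \<in> Hom (V H) (pull_ob i W) (pull_ob i B)" and c: "c \<in> carrier k"
  shows "transfer i W B (Scal (V H) c f) = Scal (V K) c (transfer i W B f)"
proof -
  have ob: "K \<in> Ob G" "H \<in> Ob G" using ends_in_Ob[OF J_Ar[OF i] eqs] by auto
  interpret K: linear_category k "V K" using ob by (simp add: V_linear)
  have p: "push i (Scal (V H) c f) = Scal (V K) c (push i f)"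
    using Rsh_linear_functor[OF i eqs] c f by (auto simp: linear_functor_def Hom_def)
  have ty: "push i f \<in> Hom (V K) (push_ob i (pull_ob i W)) (push_ob i (pull_ob i B))"
    "runit M i W \<in> Hom (V K) W (push_ob i (pull_ob i W))"
    "lcounit M i B \<in> Hom (V K) (push_ob i (pull_ob i B)) B"
    using f i eqs W B by (auto simp: mackey_simps)
  show ?thesis unfolding transfer_def p eqs
    by (simp add: K.Cmp_Scal_left[OF c ty(2,1)] K.Cmp_Scal_right[OF c K.Cmp_in_Hom[OF ty(2,1)] ty(3)])
qed

lemma pull_Add:
  assumes u: "u \<in> Ar G" and eqs: "Tgt G u = K" "Src G u = H"
    and f: "f \<in> Hom (V K) W B" and g: "g \<in> Hom (V K) W B"
  shows "pull u (Add (V K) f g) = Add (V H) (pull u f) (pull u g)"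
  using linear_functor_Add[OF Pull_linear_functor[OF u eqs] V_category f g] ends_in_Ob[OF u eqs] by simp

section \<open>Transfer along coproduct inclusions\<close>

text \<open>Says that \<open>(i\<^sup>*, j\<^sup>*)\<close> is an equivalence onto the product of \<open>V x\<close> and \<open>V y\<close>, spelled out as joint fullness,
joint faithfulness and essential surjectivity. In this form the roles of \<open>i\<close> and \<open>j\<close> can be exchanged at once.\<close>

definition joint_equivalence :: "'g \<Rightarrow> 'g \<Rightarrow> 'g \<Rightarrow> 'u \<Rightarrow> 'u \<Rightarrow> bool" where
  "joint_equivalence c x y i j \<longleftrightarrow>
     (\<forall>W \<in> Ob (V c). \<forall>B \<in> Ob (V c). \<forall>f \<in> Hom (V x) (pull_ob i W) (pull_ob i B).
        \<forall>g \<in> Hom (V y) (pull_ob j W) (pull_ob j B).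
        \<exists>h \<in> Hom (V c) W B. pull i h = f \<and> pull j h = g) \<and>
     (\<forall>W \<in> Ob (V c). \<forall>B \<in> Ob (V c). \<forall>h \<in> Hom (V c) W B. \<forall>h' \<in> Hom (V c) W B.
        pull i h = pull i h' \<longrightarrow> pull j h = pull j h' \<longrightarrow> h = h') \<and>
     (\<forall>a \<in> Ob (V x). \<forall>b \<in> Ob (V y). \<exists>Z \<in> Ob (V c).
        (\<exists>s \<in> Hom (V x) (pull_ob i Z) a. is_iso (V x) s) \<and> (\<exists>t \<in> Hom (V y) (pull_ob j Z) b. is_iso (V y) t))"

lemma joint_equivalence_sym: "joint_equivalence c x y i j \<Longrightarrow> joint_equivalence c y x j i"
  unfolding joint_equivalence_def by blast

lemma coproduct_Ar:
  assumes "coproduct G [x, y] c [i, j]"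
  shows "i \<in> Ar G" "j \<in> Ar G" "Src G i = x" "Src G j = y" "Tgt G i = c" "Tgt G j = c"
    "x \<in> Ob G" "y \<in> Ob G" "c \<in> Ob G"
  using assms by (auto simp: coproduct_def Hom_def)

lemma coproduct_inclusions_in_J:
  assumes c: "coproduct G [x, y] c [i, j]"
  shows "i \<in> J" "j \<in> J"
proof -
  note cp = coproduct_Ar[OF c]
  \<comment> \<open>The closure of \<open>J\<close> under coproducts, for the 1-cell induced by \<open>i\<close> and \<open>j\<close> themselves.\<close>
  have "Ide G c \<in> J \<longleftrightarrow> set [i, j] \<subseteq> J"
    by (rule J_coproduct[OF c, where X = c]) (use cp in \<open>auto simp: mackey_simps intro!: isomorphic_1cells_refl\<close>)
  thus "i \<in> J" "j \<in> J" using Ide_in_J cp by auto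
qed

lemma coproduct_joint_equivalence:
  assumes c: "coproduct G [x, y] c [i, j]"
  shows "joint_equivalence c x y i j"
proof -
  let ?F = "\<lparr>FO = (\<lambda>X. map (\<lambda>i. FO (Pull M i) X) [i, j]), FA = (\<lambda>f. map (\<lambda>i. FA (Pull M i) f) [i, j])\<rparr>
    :: ('o, 'm, 'o list, 'm list) func"
  have E: "is_equivalence_functor (V c) (list_cat [V x, V y]) ?F"
    using additivity[OF c] by simp
  have bij: "bij_betw (FA ?F) (Hom (V c) W B)
      {[f, g] |f g. f \<in> Hom (V x) (pull_ob i W) (pull_ob i B) \<and> g \<in> Hom (V y) (pull_ob j W) (pull_ob j B)}"
    if "W \<in> Ob (V c)" "B \<in> Ob (V c)" for W B
    using E that unfolding is_equivalence_functor_def by (simp add: Hom_list_cat)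
  have ess: "\<exists>Z \<in> Ob (V c). \<exists>f \<in> Hom (list_cat [V x, V y]) [pull_ob i Z, pull_ob j Z] [a, b]. is_iso (list_cat [V x, V y]) f"
    if "a \<in> Ob (V x)" "b \<in> Ob (V y)" for a b
    using E that unfolding is_equivalence_functor_def by (simp add: list_cat_def)
  show ?thesis unfolding joint_equivalence_def
  proof (intro conjI ballI impI)
    fix W B f g assume *: "W \<in> Ob (V c)" "B \<in> Ob (V c)"
      "f \<in> Hom (V x) (pull_ob i W) (pull_ob i B)" "g \<in> Hom (V y) (pull_ob j W) (pull_ob j B)"
    have "[f, g] \<in> FA ?F ` Hom (V c) W B" 
      using bij_betw_imp_surj_on[OF bij[OF *(1,2)]] *(3,4) by blast
    thus "\<exists>h \<in> Hom (V c) W B. pull i h = f \<and> pull j h = g" by auto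
  next
    fix W B h h' assume *: "W \<in> Ob (V c)" "B \<in> Ob (V c)" "h \<in> Hom (V c) W B" "h' \<in> Hom (V c) W B"
      "pull i h = pull i h'" "pull j h = pull j h'"
    show "h = h'"
      using inj_onD[OF bij_betw_imp_inj_on[OF bij[OF *(1,2)]], of h h'] *(3-6) by simp
  next
    fix a b assume *: "a \<in> Ob (V x)" "b \<in> Ob (V y)"
    show "\<exists>Z \<in> Ob (V c). (\<exists>s \<in> Hom (V x) (pull_ob i Z) a. is_iso (V x) s) \<and>
      (\<exists>t \<in> Hom (V y) (pull_ob j Z) b. is_iso (V y) t)"
    proof -
      obtain Z h where Z: "Z \<in> Ob (V c)" "h \<in> Hom (list_cat [V x, V y]) [pull_ob i Z, pull_ob j Z] [a, b]"
        "is_iso (list_cat [V x, V y]) h"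
        using ess[OF *] by blast
      then obtain s t where "h = [s, t]" "s \<in> Hom (V x) (pull_ob i Z) a" "t \<in> Hom (V y) (pull_ob j Z) b"
        by (auto simp: Hom_list_cat)
      with Z is_iso_list_cat[of "V x" "V y" s t] show ?thesis by blast
    qed
  qed
qed

text \<open>Choose \<open>Z\<close> with \<open>i\<^sup>*Z \<cong> X\<close> and \<open>j\<^sup>*Z\<close> zero. Let \<open>h: Z \<rightarrow> i\<^sub>!X\<close> have the components \<open>\<eta>\<close> (up to that isomorphism) and \<open>0\<close>,
and let \<open>g: i\<^sub>!X \<rightarrow> Z\<close> be adjunct to \<open>X \<cong> i\<^sup>*Z\<close>. Then \<open>h g = 1\<close>, because both sides have adjunct \<open>\<eta>\<close>. Applying \<open>i\<^sup>*\<close>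
shows that \<open>\<eta>\<close> has a right inverse, and applying \<open>j\<^sup>*\<close> that the identity of \<open>j\<^sup>*i\<^sub>!X\<close> factors through \<open>j\<^sup>*Z\<close>. The
right counit is a left inverse of \<open>\<eta>\<close> by the special Frobenius property, hence equals the right inverse.\<close>

lemma coproduct_lunit:
  assumes je: "joint_equivalence c x y i j" and i: "i \<in> J" and j: "j \<in> Ar G"
    and eqs: "Tgt G i = c" "Src G i = x" "Tgt G j = c" "Src G j = y"
    and X: "X \<in> Ob (V x)"
  shows "lunit M i X \<cdot>\<^bsub>V x\<^esub> rcounit M i X = Ide (V x) (pull_ob i (push_ob i X))"
    and "Ide (V y) (pull_ob j (push_ob i X)) = Zero (V y) (pull_ob j (push_ob i X)) (pull_ob j (push_ob i X))"
proof -
  have ob: "c \<in> Ob G" "x \<in> Ob G" "y \<in> Ob G"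
    using ends_in_Ob[OF J_Ar[OF i] eqs(1,2)] ends_in_Ob[OF j eqs(3,4)] by auto
  interpret Y: linear_category k "V y" using ob by (simp add: V_linear)
  obtain z where z: "zero_object (V y) z"
    using additive_category.has_zero_object[OF V_additive[OF ob(3)]] by auto
  hence "z \<in> Ob (V y)" by (simp add: zero_object_def)
  with je X obtain Z s t where Z: "Z \<in> Ob (V c)" and s: "s \<in> Hom (V x) (pull_ob i Z) X" "is_iso (V x) s"
    and t: "t \<in> Hom (V y) (pull_ob j Z) z" "is_iso (V y) t"
    unfolding joint_equivalence_def by meson
  obtain s' where s': "s' \<in> Hom (V x) X (pull_ob i Z)" "s \<cdot>\<^bsub>V x\<^esub> s' = Ide (V x) X"
    using s inverse_arrowsD[OF _ s(1)] by (auto simp: is_iso_def)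
  have idZ: "Ide (V y) (pull_ob j Z) = Zero (V y) (pull_ob j Z) (pull_ob j Z)"
    by (rule Y.Ide_eq_Zero[OF z t])
  have P: "push_ob i X \<in> Ob (V c)" using X i eqs by (simp add: mackey_simps)
  have e: "lunit M i X \<in> Hom (V x) X (pull_ob i (push_ob i X))"
    and re: "rcounit M i X \<in> Hom (V x) (pull_ob i (push_ob i X)) X" using X i eqs by (simp_all add: mackey_simps)
  define g where "g = lcounit M i Z \<cdot>\<^bsub>V c\<^esub> push i s'"
  have g: "g \<in> Hom (V c) (push_ob i X) Z" using s'(1) Z X i eqs ob by (simp add: g_def mackey_simps)
  have ig: "pull i g \<cdot>\<^bsub>V x\<^esub> lunit M i X = s'"
    unfolding g_def using adjunct_left_inverse[OF left_adjunction[OF i eqs(1,2)] _ _ X Z s'(1)] V_category ob by simp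
  have "\<exists>h \<in> Hom (V c) Z (push_ob i X). pull i h = lunit M i X \<cdot>\<^bsub>V x\<^esub> s \<and>
      pull j h = Zero (V y) (pull_ob j Z) (pull_ob j (push_ob i X))"
  proof -
    have "lunit M i X \<cdot>\<^bsub>V x\<^esub> s \<in> Hom (V x) (pull_ob i Z) (pull_ob i (push_ob i X))"
      using e s ob by (simp add: mackey_simps)
    moreover have "Zero (V y) (pull_ob j Z) (pull_ob j (push_ob i X)) \<in> Hom (V y) (pull_ob j Z) (pull_ob j (push_ob i X))"
      using Z P j eqs by (intro Y.Zero_in_Hom) (auto simp: mackey_simps)
    ultimately show ?thesis using je Z P unfolding joint_equivalence_def by blast
  qed
  then obtain h where h: "h \<in> Hom (V c) Z (push_ob i X)" and ih: "pull i h = lunit M i X \<cdot>\<^bsub>V x\<^esub> s"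
    by auto
  have hg: "h \<cdot>\<^bsub>V c\<^esub> g = Ide (V c) (push_ob i X)"
  proof -
    have hg: "h \<cdot>\<^bsub>V c\<^esub> g \<in> Hom (V c) (push_ob i X) (push_ob i X)" using h g ob by (simp add: mackey_simps)
    have "pull i (h \<cdot>\<^bsub>V c\<^esub> g) \<cdot>\<^bsub>V x\<^esub> lunit M i X = lunit M i X \<cdot>\<^bsub>V x\<^esub> (s \<cdot>\<^bsub>V x\<^esub> (pull i g \<cdot>\<^bsub>V x\<^esub> lunit M i X))"
      using h g e s i eqs ob X by (simp add: mackey_simps ih)
    also have "\<dots> = lunit M i X" using e ob by (simp add: ig s' mackey_simps)
    finally have "pull i (h \<cdot>\<^bsub>V c\<^esub> g) \<cdot>\<^bsub>V x\<^esub> lunit M i X = lunit M i X" .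
    then have "lcounit M i (push_ob i X) \<cdot>\<^bsub>V c\<^esub> push i (lunit M i X) = h \<cdot>\<^bsub>V c\<^esub> g"
      using adjunct_right_inverse[OF left_adjunction[OF i eqs(1,2)] _ _ X P hg] V_category ob by simp
    thus ?thesis using left_adjunction[OF i eqs(1,2)] X by (simp add: adjunction_def)
  qed
  define r where "r = s \<cdot>\<^bsub>V x\<^esub> pull i g"
  have r: "r \<in> Hom (V x) (pull_ob i (push_ob i X)) X" using s g i eqs ob by (simp add: r_def mackey_simps)
  have "lunit M i X \<cdot>\<^bsub>V x\<^esub> r = pull i (h \<cdot>\<^bsub>V c\<^esub> g)"
    using h g e s i eqs ob X by (simp add: r_def mackey_simps ih)
  also have "\<dots> = Ide (V x) (pull_ob i (push_ob i X))" using P i eqs by (simp add: hg mackey_simps)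
  \<comment> \<open>So \<open>r\<close>, which is \<open>i\<^sup>*g\<close> followed by \<open>s\<close>, is a right inverse of the left unit.\<close>
  finally have er: "lunit M i X \<cdot>\<^bsub>V x\<^esub> r = Ide (V x) (pull_ob i (push_ob i X))" .
  have "rcounit M i X = (rcounit M i X \<cdot>\<^bsub>V x\<^esub> lunit M i X) \<cdot>\<^bsub>V x\<^esub> r"
    using e re r ob by (simp add: er mackey_simps)
  also have "\<dots> = r" using special_frobenius[OF i, of X] X eqs r ob by (simp add: mackey_simps)
  finally show "lunit M i X \<cdot>\<^bsub>V x\<^esub> rcounit M i X = Ide (V x) (pull_ob i (push_ob i X))"
    using er by simp
  have jg: "pull j g \<in> Hom (V y) (pull_ob j (push_ob i X)) (pull_ob j Z)"
    and jh: "pull j h \<in> Hom (V y) (pull_ob j Z) (pull_ob j (push_ob i X))"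
    using g h j eqs by (simp_all add: mackey_simps)
  have jP: "pull_ob j (push_ob i X) \<in> Ob (V y)" "pull_ob j Z \<in> Ob (V y)" using P Z j eqs by (simp_all add: mackey_simps)
  have "Ide (V y) (pull_ob j (push_ob i X)) = pull j (h \<cdot>\<^bsub>V c\<^esub> g)" using P j eqs by (simp add: hg mackey_simps)
  also have "\<dots> = pull j h \<cdot>\<^bsub>V y\<^esub> (Ide (V y) (pull_ob j Z) \<cdot>\<^bsub>V y\<^esub> pull j g)"
    using h g j eqs ob by (simp add: mackey_simps)
  also have "\<dots> = Zero (V y) (pull_ob j (push_ob i X)) (pull_ob j (push_ob i X))"
    by (simp add: idZ Y.Cmp_Zero_left[OF jg jP(2)] Y.Cmp_Zero_right[OF jh jP(1)])
  finally show "Ide (V y) (pull_ob j (push_ob i X)) = Zero (V y) (pull_ob j (push_ob i X)) (pull_ob j (push_ob i X))" .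
qed

text \<open>By a triangle identity \<open>i\<^sup>*\<epsilon>\<close> is also inverse to the left unit, so it equals the right counit, and
\<open>i\<^sup>*(tr\<^sub>i f)\<close> becomes the adjunct of the adjunct of \<open>f\<close>. The arrow \<open>j\<^sup>*(tr\<^sub>i f)\<close> factors through the zero object
\<open>j\<^sup>*i\<^sub>*i\<^sup>*B\<close>.\<close>

lemma pull_transfer_coproduct:
  assumes je: "joint_equivalence c x y i j" and i: "i \<in> J" and j: "j \<in> Ar G"
    and eqs: "Tgt G i = c" "Src G i = x" "Tgt G j = c" "Src G j = y"
    and W: "W \<in> Ob (V c)" and B: "B \<in> Ob (V c)" and f: "f \<in> Hom (V x) (pull_ob i W) (pull_ob i B)"
  shows "pull i (transfer i W B f) = f"
    and "pull j (transfer i W B f) = Zero (V y) (pull_ob j W) (pull_ob j B)"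
proof -
  define X where "X = pull_ob i B"
  have ob: "c \<in> Ob G" "x \<in> Ob G" "y \<in> Ob G"
    using ends_in_Ob[OF J_Ar[OF i] eqs(1,2)] ends_in_Ob[OF j eqs(3,4)] by auto
  interpret Y: linear_category k "V y" using ob by (simp add: V_linear)
  have X: "X \<in> Ob (V x)" using B i eqs ob by (simp add: X_def mackey_simps)
  note cl = coproduct_lunit[OF je i j eqs X]
  define g where "g = push i f \<cdot>\<^bsub>V c\<^esub> runit M i W"
  have g: "g \<in> Hom (V c) W (push_ob i X)" using f W i eqs ob by (simp add: g_def X_def mackey_simps)
  have ep: "lcounit M i B \<in> Hom (V c) (push_ob i X) B" using B i eqs by (simp add: X_def mackey_simps)
  have t: "transfer i W B f = lcounit M i B \<cdot>\<^bsub>V c\<^esub> g" by (simp add: transfer_def g_def eqs)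
  have P: "push_ob i X \<in> Ob (V c)" using X i eqs by (simp add: mackey_simps)
  have "pull i (lcounit M i B) \<cdot>\<^bsub>V x\<^esub> lunit M i X = Ide (V x) X"
    using left_adjunction[OF i eqs(1,2)] B by (simp add: adjunction_def X_def)
  then have "rcounit M i X = (pull i (lcounit M i B) \<cdot>\<^bsub>V x\<^esub> lunit M i X) \<cdot>\<^bsub>V x\<^esub> rcounit M i X"
    using X i eqs ob by (simp add: mackey_simps)
  also have "\<dots> = pull i (lcounit M i B)" using X ep i eqs ob by (simp add: mackey_simps cl(1))
  finally have "pull i (transfer i W B f) = rcounit M i X \<cdot>\<^bsub>V x\<^esub> pull i g"
    using g ep i eqs ob by (simp add: t mackey_simps)
  also have "\<dots> = f" unfolding g_def using adjunct_eval[OF i eqs(1,2) W X] f by (simp add: X_def)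
  finally show "pull i (transfer i W B f) = f" .
  have jg: "pull j g \<in> Hom (V y) (pull_ob j W) (pull_ob j (push_ob i X))"
    and je: "pull j (lcounit M i B) \<in> Hom (V y) (pull_ob j (push_ob i X)) (pull_ob j B)"
    using g ep j eqs by (simp_all add: mackey_simps)
  have jP: "pull_ob j (push_ob i X) \<in> Ob (V y)" "pull_ob j W \<in> Ob (V y)" using P W j eqs by (simp_all add: mackey_simps)
  have "pull j (transfer i W B f) =
      pull j (lcounit M i B) \<cdot>\<^bsub>V y\<^esub> (Ide (V y) (pull_ob j (push_ob i X)) \<cdot>\<^bsub>V y\<^esub> pull j g)"
    using g ep j eqs ob by (simp add: t mackey_simps)
  also have "\<dots> = Zero (V y) (pull_ob j W) (pull_ob j B)"
    by (simp add: cl(2) Y.Cmp_Zero_left[OF jg jP(1)] Y.Cmp_Zero_right[OF je jP(2)])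
  finally show "pull j (transfer i W B f) = Zero (V y) (pull_ob j W) (pull_ob j B)" .
qed

text \<open>Both sides have the same image under \<open>i\<^sup>*\<close> and under \<open>j\<^sup>*\<close>, and these functors are jointly faithful.\<close>

lemma transfer_coproduct_sum:
  assumes c: "coproduct G [x, y] c [i, j]" and m: "m \<in> Hom (V c) W B"
  shows "Add (V c) (transfer i W B (pull i m)) (transfer j W B (pull j m)) = m"
proof -
  note cp = coproduct_Ar[OF c] and J = coproduct_inclusions_in_J[OF c]
  note je = coproduct_joint_equivalence[OF c]
  have WB: "W \<in> Ob (V c)" "B \<in> Ob (V c)" using m cp by (auto simp: mackey_simps)
  have mi: "pull i m \<in> Hom (V x) (pull_ob i W) (pull_ob i B)" and mj: "pull j m \<in> Hom (V y) (pull_ob j W) (pull_ob j B)"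
    using m cp by (auto simp: mackey_simps)
  interpret x: linear_category k "V x" using cp by (simp add: V_linear)
  interpret y: linear_category k "V y" using cp by (simp add: V_linear)
  note ti = transfer_in_Hom[OF J(1) cp(5,3) WB mi] and tj = transfer_in_Hom[OF J(2) cp(6,4) WB mj]
  note pi = pull_transfer_coproduct[OF je J(1) cp(2,5,3,6,4) WB mi]
  note pj = pull_transfer_coproduct[OF joint_equivalence_sym[OF je] J(2) cp(1,6,4,5,3) WB mj]
  let ?s = "Add (V c) (transfer i W B (pull i m)) (transfer j W B (pull j m))"
  have s: "?s \<in> Hom (V c) W B" by (rule Add_in_Hom[OF cp(9) ti tj])
  have "pull i ?s = pull i m"
    unfolding pull_Add[OF cp(1,5,3) ti tj] pi(1) pj(2) by (rule x.Add_Zero_right[OF mi])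
  moreover have "pull j ?s = pull j m"
    unfolding pull_Add[OF cp(2,6,4) ti tj] pi(2) pj(1) by (rule y.Add_Zero_left[OF mj])
  ultimately show ?thesis using je WB s m unfolding joint_equivalence_def by blast
qed

end

section \<open>The Hom-decategorification is a Mackey functor\<close>

locale hom_decategorification =
  rectified_mackey_2_functor U G J k A M + coherent_family G M X Y lam rho
  for U :: "'s set" and G :: "('g, 'u, 'a) twocat" and J :: "'u set"
    and k :: "'k ring" and A :: ambient and M :: "('k, 'g, 'u, 'a, 'o, 'm) mackey2"
    and X Y :: "'g \<Rightarrow> 'o" and lam rho :: "'u \<Rightarrow> 'm"
begin

abbreviation N where "N \<equiv> hom_decat G M X Y lam rho"
abbreviation lam_inv where "lam_inv \<equiv> inv_family G M lam"
abbreviation rho_inv where "rho_inv \<equiv> inv_family G M rho"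

lemma carrier_N: "carrier (Mod N x) = Hom (V x) (X x) (Y x)"
  and add_N: "(\<oplus>\<^bsub>Mod N x\<^esub>) = Add (V x)"
  and smult_N: "(\<odot>\<^bsub>Mod N x\<^esub>) = Scal (V x)"
  by (simp_all add: hom_decat_def hom_module_def)

lemma lam_inverse: "u \<in> Ar G \<Longrightarrow> Src G u = H \<Longrightarrow> inverse_arrows (V H) (lam u) (lam_inv u)"
  using inverse_arrows_inv_arr[OF V_category[OF Src_in_Ob] lam_iso, of u] by (auto simp: inv_family_def)

lemma rho_inverse: "u \<in> Ar G \<Longrightarrow> Src G u = H \<Longrightarrow> inverse_arrows (V H) (rho u) (rho_inv u)"
  using inverse_arrows_inv_arr[OF V_category[OF Src_in_Ob] rho_iso, of u] by (auto simp: inv_family_def)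

lemma structure_simps:
  assumes u: "u \<in> Ar G" and H: "Src G u = H"
  shows "lam u \<in> Ar (V H)" "Src (V H) (lam u) = X (Src G u)" "Tgt (V H) (lam u) = pull_ob u (X (Tgt G u))"
    and "lam_inv u \<in> Ar (V H)" "Tgt (V H) (lam_inv u) = X (Src G u)" "Src (V H) (lam_inv u) = pull_ob u (X (Tgt G u))"
    and "rho u \<in> Ar (V H)" "Tgt (V H) (rho u) = Y (Src G u)" "Src (V H) (rho u) = pull_ob u (Y (Tgt G u))"
    and "rho_inv u \<in> Ar (V H)" "Src (V H) (rho_inv u) = Y (Src G u)" "Tgt (V H) (rho_inv u) = pull_ob u (Y (Tgt G u))"
  using lam_in_Hom[OF u] rho_in_Hom[OF u] H
    inverse_arrowsD(1)[OF lam_inverse[OF u H], of "X H" "pull_ob u (X (Tgt G u))"]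
    inverse_arrowsD(1)[OF rho_inverse[OF u H], of "pull_ob u (Y (Tgt G u))" "Y H"]
  by (auto simp: Hom_def)

lemma inverse_simps:
  assumes u: "u \<in> Ar G" and H: "Src G u = H"
  shows "lam u \<cdot>\<^bsub>V H\<^esub> lam_inv u = Ide (V H) (pull_ob u (X (Tgt G u)))" "lam_inv u \<cdot>\<^bsub>V H\<^esub> lam u = Ide (V H) (X H)"
    and "rho_inv u \<cdot>\<^bsub>V H\<^esub> rho u = Ide (V H) (pull_ob u (Y (Tgt G u)))" "rho u \<cdot>\<^bsub>V H\<^esub> rho_inv u = Ide (V H) (Y H)"
  using lam_in_Hom[OF u] rho_in_Hom[OF u] H
    inverse_arrowsD(2,3)[OF lam_inverse[OF u H], of "X H" "pull_ob u (X (Tgt G u))"]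
    inverse_arrowsD(2,3)[OF rho_inverse[OF u H], of "pull_ob u (Y (Tgt G u))" "Y H"]
  by auto

lemma inverse_cancel:
  assumes u: "u \<in> Ar G" and H: "Src G u = H" and r: "r \<in> Ar (V H)"
  shows "Tgt (V H) r = pull_ob u (X (Tgt G u)) \<Longrightarrow> lam u \<cdot>\<^bsub>V H\<^esub> (lam_inv u \<cdot>\<^bsub>V H\<^esub> r) = r"
    and "Tgt (V H) r = X H \<Longrightarrow> lam_inv u \<cdot>\<^bsub>V H\<^esub> (lam u \<cdot>\<^bsub>V H\<^esub> r) = r"
    and "Tgt (V H) r = pull_ob u (Y (Tgt G u)) \<Longrightarrow> rho_inv u \<cdot>\<^bsub>V H\<^esub> (rho u \<cdot>\<^bsub>V H\<^esub> r) = r"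
    and "Tgt (V H) r = Y H \<Longrightarrow> rho u \<cdot>\<^bsub>V H\<^esub> (rho_inv u \<cdot>\<^bsub>V H\<^esub> r) = r"
proof -
  have C: "category (V H)" using u H V_category Src_in_Ob[OF u] by simp
  note l = lam_inverse[OF u H] and r' = rho_inverse[OF u H]
  note s = structure_simps[OF u H]
  show "Tgt (V H) r = pull_ob u (X (Tgt G u)) \<Longrightarrow> lam u \<cdot>\<^bsub>V H\<^esub> (lam_inv u \<cdot>\<^bsub>V H\<^esub> r) = r"
    and "Tgt (V H) r = X H \<Longrightarrow> lam_inv u \<cdot>\<^bsub>V H\<^esub> (lam u \<cdot>\<^bsub>V H\<^esub> r) = r"
    and "Tgt (V H) r = pull_ob u (Y (Tgt G u)) \<Longrightarrow> rho_inv u \<cdot>\<^bsub>V H\<^esub> (rho u \<cdot>\<^bsub>V H\<^esub> r) = r"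
    and "Tgt (V H) r = Y H \<Longrightarrow> rho u \<cdot>\<^bsub>V H\<^esub> (rho_inv u \<cdot>\<^bsub>V H\<^esub> r) = r"
    using inverse_arrows_cancel[OF C l r] inverse_arrows_cancel[OF C inverse_arrows_sym[OF l] r]
      inverse_arrows_cancel[OF C r' r] inverse_arrows_cancel[OF C inverse_arrows_sym[OF r'] r] s H
    by simp_all
qed

lemmas decat_simps = mackey_simps structure_simps inverse_simps inverse_cancel

lemma Res_eq:
  assumes "u \<in> Ar G" "Src G u = H" "Tgt G u = K" "m \<in> Hom (V K) (X K) (Y K)"
  shows "Res N u m = rho u \<cdot>\<^bsub>V H\<^esub> (pull u m \<cdot>\<^bsub>V H\<^esub> lam u)"
  using assms ends_in_Ob[OF assms(1,3,2)] by (simp add: hom_decat_def decat_simps)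

lemma Res_in_Hom:
  assumes "u \<in> Ar G" "Src G u = H" "Tgt G u = K" "m \<in> Hom (V K) (X K) (Y K)"
  shows "Res N u m \<in> Hom (V H) (X H) (Y H)"
  unfolding Res_eq[OF assms] using assms ends_in_Ob[OF assms(1,3,2)] by (simp add: decat_simps)

lemma twist_in_Hom:
  assumes "u \<in> Ar G" "Src G u = H" "Tgt G u = K" "m \<in> Hom (V H) (X H) (Y H)"
  shows "rho_inv u \<cdot>\<^bsub>V H\<^esub> (m \<cdot>\<^bsub>V H\<^esub> lam_inv u) \<in> Hom (V H) (pull_ob u (X K)) (pull_ob u (Y K))"
  using assms ends_in_Ob[OF assms(1,3,2)] by (simp add: decat_simps)

lemma Ind_eq:
  assumes "u \<in> J" "Src G u = H" "Tgt G u = K" "m \<in> Hom (V H) (X H) (Y H)"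
  shows "Ind N u m = transfer u (X K) (Y K) (rho_inv u \<cdot>\<^bsub>V H\<^esub> (m \<cdot>\<^bsub>V H\<^esub> lam_inv u))"
proof -
  have ob: "K \<in> Ob G" "H \<in> Ob G" using ends_in_Ob[OF J_Ar[OF assms(1)] assms(3,2)] by auto
  have t: "rho_inv u \<cdot>\<^bsub>V H\<^esub> (m \<cdot>\<^bsub>V H\<^esub> lam_inv u) \<in> Hom (V H) (pull_ob u (X K)) (pull_ob u (Y K))"
    by (rule twist_in_Hom[OF J_Ar[OF assms(1)] assms(2-4)])
  have e: "inv_arr (V H) (rho u) \<cdot>\<^bsub>V H\<^esub> m \<cdot>\<^bsub>V H\<^esub> inv_arr (V H) (lam u) = rho_inv u \<cdot>\<^bsub>V H\<^esub> (m \<cdot>\<^bsub>V H\<^esub> lam_inv u)"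
    using assms ob by (simp add: decat_simps inv_family_def[of G M lam, symmetric] 
      inv_family_def[of G M lam u, unfolded assms(2), symmetric] 
      inv_family_def[of G M rho u, unfolded assms(2), symmetric])
  have "Ind N u m = lcounit M u (Y K) \<cdot>\<^bsub>V K\<^esub> push u (rho_inv u \<cdot>\<^bsub>V H\<^esub> (m \<cdot>\<^bsub>V H\<^esub> lam_inv u)) \<cdot>\<^bsub>V K\<^esub> runit M u (X K)"
    using assms(2,3) by (simp add: hom_decat_def e)
  also have "\<dots> = transfer u (X K) (Y K) (rho_inv u \<cdot>\<^bsub>V H\<^esub> (m \<cdot>\<^bsub>V H\<^esub> lam_inv u))"
    using t assms ob X_in_Ob[OF ob(1)] Y_in_Ob[OF ob(1)] by (simp add: transfer_def mackey_simps)
  finally show ?thesis .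
qed

lemma Ind_in_Hom:
  assumes "u \<in> J" "Src G u = H" "Tgt G u = K" "m \<in> Hom (V H) (X H) (Y H)"
  shows "Ind N u m \<in> Hom (V K) (X K) (Y K)"
  unfolding Ind_eq[OF assms]
  using transfer_in_Hom[OF assms(1,3,2) _ _ twist_in_Hom[OF J_Ar[OF assms(1)] assms(2-4)]]
    ends_in_Ob[OF J_Ar[OF assms(1)] assms(3,2)] X_in_Ob Y_in_Ob by blast

lemma lam_inv_Cmp:
  assumes u: "u \<in> Ar G" and v: "v \<in> Ar G" and eqs: "Src G u = H" "Tgt G v = H" "Src G v = L"
  shows "lam_inv (u \<cdot>\<^bsub>G\<^esub> v) = lam_inv v \<cdot>\<^bsub>V L\<^esub> pull v (lam_inv u)"
proof (rule inverse_arrows_unique)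
  have ob: "H \<in> Ob G" "L \<in> Ob G" using ends_in_Ob[OF v eqs(2,3)] by auto
  show "category (V L)" using V_category ob by blast
  show "inverse_arrows (V L) (lam (u \<cdot>\<^bsub>G\<^esub> v)) (lam_inv (u \<cdot>\<^bsub>G\<^esub> v))"
    using u v eqs by (intro lam_inverse) (auto simp: mackey_simps)
  have "inverse_arrows (V L) (pull v (lam u) \<cdot>\<^bsub>V L\<^esub> lam v) (lam_inv v \<cdot>\<^bsub>V L\<^esub> pull v (lam_inv u))"
    using functor_inverse_arrows[OF Pull_is_functor[OF v eqs(2,3)] V_category[OF ob(1)] lam_inverse[OF u eqs(1)]]
      lam_inverse[OF v eqs(3)] u v eqs ob
    by (intro inverse_arrows_Cmp V_category) (auto simp: decat_simps)
  then show "inverse_arrows (V L) (lam (u \<cdot>\<^bsub>G\<^esub> v)) (lam_inv v \<cdot>\<^bsub>V L\<^esub> pull v (lam_inv u))"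
    using lam_Cmp[OF u v] eqs by simp
qed

lemma rho_inv_Cmp:
  assumes u: "u \<in> Ar G" and v: "v \<in> Ar G" and eqs: "Src G u = H" "Tgt G v = H" "Src G v = L"
  shows "rho_inv (u \<cdot>\<^bsub>G\<^esub> v) = pull v (rho_inv u) \<cdot>\<^bsub>V L\<^esub> rho_inv v"
proof (rule inverse_arrows_unique)
  have ob: "H \<in> Ob G" "L \<in> Ob G" using ends_in_Ob[OF v eqs(2,3)] by auto
  show "category (V L)" using V_category ob by blast
  show "inverse_arrows (V L) (rho (u \<cdot>\<^bsub>G\<^esub> v)) (rho_inv (u \<cdot>\<^bsub>G\<^esub> v))"
    using u v eqs by (intro rho_inverse) (auto simp: mackey_simps)
  have "inverse_arrows (V L) (rho v \<cdot>\<^bsub>V L\<^esub> pull v (rho u)) (pull v (rho_inv u) \<cdot>\<^bsub>V L\<^esub> rho_inv v)"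
    using functor_inverse_arrows[OF Pull_is_functor[OF v eqs(2,3)] V_category[OF ob(1)] rho_inverse[OF u eqs(1)]]
      rho_inverse[OF v eqs(3)] u v eqs ob
    by (intro inverse_arrows_Cmp V_category) (auto simp: decat_simps)
  then show "inverse_arrows (V L) (rho (u \<cdot>\<^bsub>G\<^esub> v)) (pull v (rho_inv u) \<cdot>\<^bsub>V L\<^esub> rho_inv v)"
    using rho_Cmp[OF u v] eqs by simp
qed

lemma lam_inv_Cell:
  assumes c: "\<alpha> \<in> Hom2 G u v" and eqs: "Tgt G u = K" "Src G u = H"
  shows "lam_inv v \<cdot>\<^bsub>V H\<^esub> Cell M \<alpha> (X K) = lam_inv u"
proof -
  have uv: "u \<in> Ar G" "v \<in> Ar G" "Tgt G v = K" "Src G v = H"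
    using c parallel[OF c] eqs Two_simps(10,11) by (auto simp: Hom_def Ob_Two[symmetric])
  have ob: "K \<in> Ob G" "H \<in> Ob G" using ends_in_Ob[OF uv(1) eqs] by auto
  have C: "Cell M \<alpha> (X K) \<in> Hom (V H) (pull_ob u (X K)) (pull_ob v (X K))"
    using Cell_in_Hom[OF c eqs X_in_Ob[OF ob(1)]] .
  have "lam_inv v \<cdot>\<^bsub>V H\<^esub> Cell M \<alpha> (X K) = lam_inv v \<cdot>\<^bsub>V H\<^esub> ((Cell M \<alpha> (X K) \<cdot>\<^bsub>V H\<^esub> lam u) \<cdot>\<^bsub>V H\<^esub> lam_inv u)"
    using C uv eqs ob by (simp add: decat_simps)
  also have "\<dots> = lam_inv u" using lam_Cell[OF c] uv eqs ob by (simp add: decat_simps)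
  finally show ?thesis .
qed

lemma rho_inv_Cell:
  assumes c: "\<alpha> \<in> Hom2 G u v" and eqs: "Tgt G u = K" "Src G u = H"
  shows "Cell M \<alpha> (Y K) \<cdot>\<^bsub>V H\<^esub> rho_inv u = rho_inv v"
proof -
  have uv: "u \<in> Ar G" "v \<in> Ar G" "Tgt G v = K" "Src G v = H"
    using c parallel[OF c] eqs Two_simps(10,11) by (auto simp: Hom_def Ob_Two[symmetric])
  have ob: "K \<in> Ob G" "H \<in> Ob G" using ends_in_Ob[OF uv(1) eqs] by auto
  have C: "Cell M \<alpha> (Y K) \<in> Hom (V H) (pull_ob u (Y K)) (pull_ob v (Y K))"
    using Cell_in_Hom[OF c eqs Y_in_Ob[OF ob(1)]] .
  have "Cell M \<alpha> (Y K) \<cdot>\<^bsub>V H\<^esub> rho_inv u = rho_inv v \<cdot>\<^bsub>V H\<^esub> ((rho v \<cdot>\<^bsub>V H\<^esub> Cell M \<alpha> (Y K)) \<cdot>\<^bsub>V H\<^esub> rho_inv u)"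
    using C uv eqs ob by (simp add: decat_simps)
  also have "\<dots> = rho_inv v" using rho_Cell[OF c] uv eqs ob by (simp add: decat_simps)
  finally show ?thesis .
qed

lemma Res_comp:
  assumes u: "u \<in> Ar G" and v: "v \<in> Ar G" and eqs: "Src G u = Tgt G v"
    and m: "m \<in> Hom (V (Tgt G u)) (X (Tgt G u)) (Y (Tgt G u))"
  shows "Res N (u \<cdot>\<^bsub>G\<^esub> v) m = Res N v (Res N u m)"
proof -
  define L where "L = Src G v"
  have ob: "Tgt G u \<in> Ob G" "Tgt G v \<in> Ob G" "L \<in> Ob G" using u v by (auto simp: G_simps L_def)
  have uv: "u \<cdot>\<^bsub>G\<^esub> v \<in> Ar G" "Tgt G (u \<cdot>\<^bsub>G\<^esub> v) = Tgt G u" "Src G (u \<cdot>\<^bsub>G\<^esub> v) = L"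
    using u v eqs by (auto simp: G_simps L_def)
  show ?thesis
    unfolding Res_eq[OF uv(1,3,2) m] Res_eq[OF u eqs refl m]
      Res_eq[OF v L_def[symmetric] refl Res_in_Hom[OF u eqs refl m, unfolded Res_eq[OF u eqs refl m]]]
    using lam_Cmp[OF u v eqs] rho_Cmp[OF u v eqs] m u v eqs ob by (simp add: decat_simps L_def[symmetric])
qed

text \<open>The inverse structure isomorphisms of the composite 1-cell are \<open>\<lambda>\<^sub>v\<^sup>-\<^sup>1 v\<^sup>*(\<lambda>\<^sub>u\<^sup>-\<^sup>1)\<close> and \<open>v\<^sup>*(\<rho>\<^sub>u\<^sup>-\<^sup>1) \<rho>\<^sub>v\<^sup>-\<^sup>1\<close>, and naturality takes
the factors in the image of \<open>v\<^sup>*\<close> out of the inner transfer.\<close>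

lemma Ind_comp:
  assumes J: "u \<in> J" "v \<in> J" and uv: "Src G u = Tgt G v"
    and m: "m \<in> Hom (V (Src G v)) (X (Src G v)) (Y (Src G v))"
  shows "Ind N (u \<cdot>\<^bsub>G\<^esub> v) m = Ind N u (Ind N v m)"
proof -
  define K H L where "K = Tgt G u" and "H = Src G u" and "L = Src G v"
  have eqs: "Tgt G u = K" "Src G u = H" "Tgt G v = H" "Src G v = L" 
    using uv by (auto simp: K_def H_def L_def)
  note Ar = J_Ar[OF J(1)] J_Ar[OF J(2)]
  have ob: "K \<in> Ob G" "H \<in> Ob G" "L \<in> Ob G"
    using ends_in_Ob[OF Ar(1) eqs(1,2)] ends_in_Ob[OF Ar(2) eqs(3,4)] by auto
  have m: "m \<in> Hom (V L) (X L) (Y L)" using m eqs by simp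
  have c: "u \<cdot>\<^bsub>G\<^esub> v \<in> J" "Tgt G (u \<cdot>\<^bsub>G\<^esub> v) = K" "Src G (u \<cdot>\<^bsub>G\<^esub> v) = L"
    using J_Cmp[OF J uv] Ar eqs by (auto simp: G_simps)
  have XY: "X K \<in> Ob (V K)" "Y K \<in> Ob (V K)" "X H \<in> Ob (V H)" "Y H \<in> Ob (V H)"
    using X_in_Ob Y_in_Ob ob by auto
  define f where "f = rho_inv v \<cdot>\<^bsub>V L\<^esub> (m \<cdot>\<^bsub>V L\<^esub> lam_inv v)"
  have f: "f \<in> Hom (V L) (pull_ob v (X H)) (pull_ob v (Y H))"
    unfolding f_def by (rule twist_in_Hom[OF Ar(2) eqs(4,3) m])
  have l: "lam_inv u \<in> Hom (V H) (pull_ob u (X K)) (X H)" and r: "rho_inv u \<in> Hom (V H) (Y H) (pull_ob u (Y K))"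
    using Ar eqs by (auto simp: decat_simps)
  \<comment> \<open>The arrow whose transfer along the composite is \<open>Ind (u v) m\<close>.\<close>
  define g where "g = pull v (rho_inv u) \<cdot>\<^bsub>V L\<^esub> (f \<cdot>\<^bsub>V L\<^esub> pull v (lam_inv u))"
  have fl: "f \<cdot>\<^bsub>V L\<^esub> pull v (lam_inv u) \<in> Hom (V L) (pull_ob v (pull_ob u (X K))) (pull_ob v (Y H))"
    using f l r Ar eqs ob by (simp add: mackey_simps)
  have g: "g \<in> Hom (V L) (pull_ob v (pull_ob u (X K))) (pull_ob v (pull_ob u (Y K)))"
    using fl r Ar eqs ob unfolding g_def by (simp add: mackey_simps)
  have pu: "pull_ob u (X K) \<in> Ob (V H)" using XY Ar eqs by (simp add: mackey_simps)
  have "Ind N (u \<cdot>\<^bsub>G\<^esub> v) m = transfer (u \<cdot>\<^bsub>G\<^esub> v) (X K) (Y K) g"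
    using Ind_eq[OF c(1,3,2) m] m l r Ar eqs ob unfolding g_def f_def
    by (simp add: lam_inv_Cmp[OF Ar eqs(2,3,4)] rho_inv_Cmp[OF Ar eqs(2,3,4)] decat_simps)
  also have "\<dots> = transfer u (X K) (Y K) (transfer v (pull_ob u (X K)) (pull_ob u (Y K)) g)"
    by (rule transfer_comp[OF J eqs XY(1,2) g])
  also have "transfer v (pull_ob u (X K)) (pull_ob u (Y K)) g = rho_inv u \<cdot>\<^bsub>V H\<^esub> (transfer v (X H) (Y H) f \<cdot>\<^bsub>V H\<^esub> lam_inv u)"
    unfolding g_def transfer_Cmp[OF J(2) eqs(3,4) XY(4) l f] Cmp_transfer[OF J(2) eqs(3,4) pu r fl] ..
  also have "transfer u (X K) (Y K) \<dots> = Ind N u (Ind N v m)"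
    using Ind_eq[OF J(1) eqs(2,1) Ind_in_Hom[OF J(2) eqs(4,3) m]] Ind_eq[OF J(2) eqs(4,3) m]
    by (simp add: f_def)
  finally show ?thesis .
qed

lemma Res_Cell_eq:
  assumes c: "\<alpha> \<in> Hom2 G u v" and m: "m \<in> Hom (V (Tgt G u)) (X (Tgt G u)) (Y (Tgt G u))"
  shows "Res N u m = Res N v m"
proof -
  define H K where "H = Src G u" and "K = Tgt G u"
  have uv: "u \<in> Ar G" "v \<in> Ar G" and eqs: "Tgt G u = K" "Src G u = H" "Tgt G v = K" "Src G v = H"
    using c parallel[OF c] Two_simps(10,11) by (auto simp: Hom_def Ob_Two[symmetric] K_def H_def)
  have ob: "K \<in> Ob G" "H \<in> Ob G" using ends_in_Ob[OF uv(1) eqs(1,2)] by auto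
  have m: "m \<in> Hom (V K) (X K) (Y K)" using m eqs by simp
  have cX: "Cell M \<alpha> (X K) \<in> Hom (V H) (pull_ob u (X K)) (pull_ob v (X K))"
    and cY: "Cell M \<alpha> (Y K) \<in> Hom (V H) (pull_ob u (Y K)) (pull_ob v (Y K))"
    using Cell_in_Hom[OF c eqs(1,2)] X_in_Ob Y_in_Ob ob by auto
  have "Res N u m = (rho v \<cdot>\<^bsub>V H\<^esub> Cell M \<alpha> (Y K)) \<cdot>\<^bsub>V H\<^esub> (pull u m \<cdot>\<^bsub>V H\<^esub> lam u)"
    using Res_eq[OF uv(1) eqs(2,1) m] rho_Cell[OF c] eqs by simp
  also have "\<dots> = rho v \<cdot>\<^bsub>V H\<^esub> ((Cell M \<alpha> (Y K) \<cdot>\<^bsub>V H\<^esub> pull u m) \<cdot>\<^bsub>V H\<^esub> lam u)"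
    using cY m uv eqs ob by (simp add: decat_simps)
  also have "\<dots> = rho v \<cdot>\<^bsub>V H\<^esub> (pull v m \<cdot>\<^bsub>V H\<^esub> (Cell M \<alpha> (X K) \<cdot>\<^bsub>V H\<^esub> lam u))"
    unfolding Cell_natural[OF c eqs(1,2) m] using cX m uv eqs ob by (simp add: decat_simps)
  also have "\<dots> = Res N v m" using Res_eq[OF uv(2) eqs(4,3) m] lam_Cell[OF c] eqs by simp
  finally show ?thesis .
qed

lemma Ind_Cell_eq:
  assumes c: "\<alpha> \<in> Hom2 G u v" and J: "u \<in> J" "v \<in> J"
    and m: "m \<in> Hom (V (Src G u)) (X (Src G u)) (Y (Src G u))"
  shows "Ind N u m = Ind N v m"
proof -
  define H K where "H = Src G u" and "K = Tgt G u"
  note uv = J_Ar[OF J(1)] J_Ar[OF J(2)] 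
  have eqs: "Tgt G u = K" "Src G u = H" "Tgt G v = K" "Src G v = H"
    using parallel[OF c] by (auto simp: K_def H_def)
  have ob: "K \<in> Ob G" "H \<in> Ob G" using ends_in_Ob[OF uv(1) eqs(1,2)] by auto
  have m: "m \<in> Hom (V H) (X H) (Y H)" using m eqs by simp
  have cX: "Cell M \<alpha> (X K) \<in> Hom (V H) (pull_ob u (X K)) (pull_ob v (X K))"
    and cY: "Cell M \<alpha> (Y K) \<in> Hom (V H) (pull_ob u (Y K)) (pull_ob v (Y K))"
    using Cell_in_Hom[OF c eqs(1,2)] X_in_Ob Y_in_Ob ob by auto
  define h where "h = rho_inv u \<cdot>\<^bsub>V H\<^esub> (m \<cdot>\<^bsub>V H\<^esub> lam_inv v)"
  have h: "h \<in> Hom (V H) (pull_ob v (X K)) (pull_ob u (Y K))"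
    using m uv eqs ob unfolding h_def by (simp add: decat_simps)
  have "Ind N u m = transfer u (X K) (Y K) (rho_inv u \<cdot>\<^bsub>V H\<^esub> (m \<cdot>\<^bsub>V H\<^esub> (lam_inv v \<cdot>\<^bsub>V H\<^esub> Cell M \<alpha> (X K))))"
    using Ind_eq[OF J(1) eqs(2,1) m] lam_inv_Cell[OF c eqs(1,2)] by simp
  also have "\<dots> = transfer u (X K) (Y K) (h \<cdot>\<^bsub>V H\<^esub> Cell M \<alpha> (X K))"
    using cX m uv eqs ob unfolding h_def by (simp add: decat_simps)
  also have "\<dots> = transfer v (X K) (Y K) (Cell M \<alpha> (Y K) \<cdot>\<^bsub>V H\<^esub> h)"
    using transfer_dinatural[OF J c, of "X K" "Y K" h] X_in_Ob Y_in_Ob ob h eqs by simp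
  also have "Cell M \<alpha> (Y K) \<cdot>\<^bsub>V H\<^esub> h = (Cell M \<alpha> (Y K) \<cdot>\<^bsub>V H\<^esub> rho_inv u) \<cdot>\<^bsub>V H\<^esub> (m \<cdot>\<^bsub>V H\<^esub> lam_inv v)"
    using cY m uv eqs ob unfolding h_def by (simp add: decat_simps)
  also have "transfer v (X K) (Y K) \<dots> = Ind N v m"
    using Ind_eq[OF J(2) eqs(4,3) m] rho_inv_Cell[OF c eqs(1,2)] by simp
  finally show ?thesis .
qed

lemma lam_inv_rho_inv_Ide:
  assumes x: "x \<in> Ob G"
  shows "lam_inv (Ide G x) = Ide (V x) (X x)" "rho_inv (Ide G x) = Ide (V x) (Y x)"
proof -
  have I: "Ide G x \<in> Ar G" "Src G (Ide G x) = x" using x by (auto simp: G_simps)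
  have XY: "X x \<in> Ob (V x)" "Y x \<in> Ob (V x)" using X_in_Ob Y_in_Ob x by auto
  have "inverse_arrows (V x) (Ide (V x) W) (Ide (V x) W)" if "W \<in> Ob (V x)" for W
    using that x by (simp add: inverse_arrows_def mackey_simps)
  then show "lam_inv (Ide G x) = Ide (V x) (X x)" "rho_inv (Ide G x) = Ide (V x) (Y x)"
    using lam_inverse[OF I] rho_inverse[OF I] lam_Ide[OF x] rho_Ide[OF x] XY
      inverse_arrows_unique[OF V_category[OF x]] by metis+
qed

lemma Ind_identity:
  assumes x: "x \<in> Ob G" and m: "m \<in> Hom (V x) (X x) (Y x)"
  shows "Ind N (Ide G x) m = m"
proof -
  have I: "Ide G x \<in> J" "Ide G x \<in> Ar G" "Tgt G (Ide G x) = x" "Src G (Ide G x) = x"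
    using x by (auto simp: Ide_in_J G_simps)
  have XY: "X x \<in> Ob (V x)" "Y x \<in> Ob (V x)" using X_in_Ob Y_in_Ob x by auto
  show ?thesis using lam_inv_rho_inv_Ide[OF x] Ind_eq[OF I(1,4,3) m] transfer_Ide[OF x XY m] m XY x by (simp add: mackey_simps)
qed

text \<open>Base change for the transfer leaves an arrow over the top corner of the square, in which \<open>\<rho>\<^sub>u\<close>, \<open>\<gamma>\<close> and \<open>\<rho>\<^sub>i\<^sup>-\<^sup>1\<close> stand to
the left of \<open>p\<^sup>*m\<close>. Coherence of \<open>\<rho>\<close> along \<open>\<gamma>: i p \<Rightarrow> u q\<close> replaces them by \<open>\<rho>\<^sub>q\<^sup>-\<^sup>1 \<rho>\<^sub>p\<close>, and dually for \<open>\<lambda>\<close> on the right.\<close>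

lemma Res_Ind_mackey_square:
  assumes sq: "mackey_square G J i u p q \<gamma>"
    and m: "m \<in> Hom (V (Src G i)) (X (Src G i)) (Y (Src G i))"
  shows "Res N u (Ind N i m) = Ind N q (Res N p m)"
proof -
  define H K L P where "H = Src G i" and "K = Tgt G i" and "L = Src G u" and "P = Src G q"
  let ?\<delta> = "inv_arr (Two G) \<gamma>"
  have J: "i \<in> J" "q \<in> J" and Ar: "p \<in> Ar G" "u \<in> Ar G"
    and eqs: "Tgt G i = K" "Tgt G u = K" "Src G i = H" "Tgt G p = H" "Src G u = L" "Tgt G q = L"
      "Src G p = P" "Src G q = P"
    and c: "\<gamma> \<in> Hom2 G (i \<cdot>\<^bsub>G\<^esub> p) (u \<cdot>\<^bsub>G\<^esub> q)" and iso: "is_iso (Two G) \<gamma>"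
    using sq by (auto simp: mackey_square_def pseudopullback_def Hom_def H_def K_def L_def P_def)
  note iA = J_Ar[OF J(1)] and qA = J_Ar[OF J(2)]
  have d: "?\<delta> \<in> Hom2 G (u \<cdot>\<^bsub>G\<^esub> q) (i \<cdot>\<^bsub>G\<^esub> p)"
    using inverse_arrowsD(1)[OF inverse_arrows_inv_arr[OF Two_category iso] c] .
  have ob: "P \<in> Ob G" "L \<in> Ob G" "H \<in> Ob G" "K \<in> Ob G"
    using ends_in_Ob[OF Ar(1) eqs(4,7)] ends_in_Ob[OF Ar(2) eqs(2,5)] by auto
  have src: "Tgt G (i \<cdot>\<^bsub>G\<^esub> p) = K" "Src G (i \<cdot>\<^bsub>G\<^esub> p) = P"
      "Tgt G (u \<cdot>\<^bsub>G\<^esub> q) = K" "Src G (u \<cdot>\<^bsub>G\<^esub> q) = P" using J Ar eqs by (auto simp: mackey_simps)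
  have m: "m \<in> Hom (V H) (X H) (Y H)" using m eqs by simp
  have XY: "X K \<in> Ob (V K)" "Y K \<in> Ob (V K)" using X_in_Ob Y_in_Ob ob by auto
  have cY: "Cell M \<gamma> (Y K) \<in> Hom (V P) (pull_ob p (pull_ob i (Y K))) (pull_ob q (pull_ob u (Y K)))"
    and dX: "Cell M ?\<delta> (X K) \<in> Hom (V P) (pull_ob q (pull_ob u (X K))) (pull_ob p (pull_ob i (X K)))"
    using Cell_in_Hom[OF c src(1,2) XY(2)] Cell_in_Hom[OF d src(3,4) XY(1)] XY J Ar eqs
    by (auto simp: mackey_simps)
  define f where "f = rho_inv i \<cdot>\<^bsub>V H\<^esub> (m \<cdot>\<^bsub>V H\<^esub> lam_inv i)"
  have f: "f \<in> Hom (V H) (pull_ob i (X K)) (pull_ob i (Y K))"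
    unfolding f_def by (rule twist_in_Hom[OF iA eqs(3,1) m])
  define g where "g = Cell M \<gamma> (Y K) \<cdot>\<^bsub>V P\<^esub> (pull p f \<cdot>\<^bsub>V P\<^esub> Cell M ?\<delta> (X K))"
  have g: "g \<in> Hom (V P) (pull_ob q (pull_ob u (X K))) (pull_ob q (pull_ob u (Y K)))"
    using f cY dX Ar eqs ob by (simp add: g_def mackey_simps)
  have t: "pull u (transfer i (X K) (Y K) f) = transfer q (pull_ob u (X K)) (pull_ob u (Y K)) g"
    using transfer_base_change[OF sq, of "X K" "Y K" f] f cY dX XY Ar J eqs ob by (simp add: g_def mackey_simps)
  have r: "rho u \<in> Hom (V L) (pull_ob u (Y K)) (Y L)" and l: "lam u \<in> Hom (V L) (X L) (pull_ob u (X K))"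
    using Ar eqs by (auto simp: decat_simps)
  have l': "rho q \<cdot>\<^bsub>V P\<^esub> (pull q (rho u) \<cdot>\<^bsub>V P\<^esub> Cell M \<gamma> (Y K)) = rho p \<cdot>\<^bsub>V P\<^esub> pull p (rho i)"
    using rho_Cell[OF c] rho_Cmp[OF iA Ar(1)] rho_Cmp[OF Ar(2) qA] cY iA qA Ar eqs ob by (simp add: decat_simps)
  have r': "(Cell M ?\<delta> (X K) \<cdot>\<^bsub>V P\<^esub> pull q (lam u)) \<cdot>\<^bsub>V P\<^esub> lam q = pull p (lam i) \<cdot>\<^bsub>V P\<^esub> lam p"
    using lam_Cell[OF d] lam_Cmp[OF iA Ar(1)] lam_Cmp[OF Ar(2) qA] dX iA qA Ar eqs ob by (simp add: decat_simps)
  \<comment> \<open>The parts of the transferred arrow to the left and right of \<open>p\<^sup>*f\<close>, with \<open>\<rho>\<^sub>u\<close> and \<open>\<lambda>\<^sub>u\<close> absorbed by naturality.\<close>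
  define a where "a = pull q (rho u) \<cdot>\<^bsub>V P\<^esub> Cell M \<gamma> (Y K)"
  define b where "b = Cell M ?\<delta> (X K) \<cdot>\<^bsub>V P\<^esub> pull q (lam u)"
  have a: "a \<in> Hom (V P) (pull_ob p (pull_ob i (Y K))) (pull_ob q (Y L))"
    and b: "b \<in> Hom (V P) (pull_ob q (X L)) (pull_ob p (pull_ob i (X K)))"
    using cY dX r l qA eqs ob by (simp_all add: a_def b_def mackey_simps)
  have pr: "pull p (rho i) \<cdot>\<^bsub>V P\<^esub> pull p (rho_inv i) = Ide (V P) (pull_ob p (Y H))"
    using iA Ar eqs ob Y_in_Ob[OF ob(3)] by (simp add: decat_simps flip: pull_Cmp[OF Ar(1) eqs(4), unfolded eqs])
  have pl: "pull p (lam_inv i) \<cdot>\<^bsub>V P\<^esub> pull p (lam i) = Ide (V P) (pull_ob p (X H))"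
    using iA Ar eqs ob X_in_Ob[OF ob(3)] by (simp add: decat_simps flip: pull_Cmp[OF Ar(1) eqs(4), unfolded eqs])
  have "a \<cdot>\<^bsub>V P\<^esub> pull p (rho_inv i) = rho_inv q \<cdot>\<^bsub>V P\<^esub> ((rho q \<cdot>\<^bsub>V P\<^esub> a) \<cdot>\<^bsub>V P\<^esub> pull p (rho_inv i))"
    using a iA qA Ar eqs ob by (simp add: decat_simps)
  also have "\<dots> = rho_inv q \<cdot>\<^bsub>V P\<^esub> (rho p \<cdot>\<^bsub>V P\<^esub> (pull p (rho i) \<cdot>\<^bsub>V P\<^esub> pull p (rho_inv i)))"
    unfolding a_def l' using iA qA Ar eqs ob by (simp add: decat_simps)
  also have "\<dots> = rho_inv q \<cdot>\<^bsub>V P\<^esub> rho p" unfolding pr using Ar eqs ob by (simp add: decat_simps)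
  finally have aE: "a \<cdot>\<^bsub>V P\<^esub> pull p (rho_inv i) = rho_inv q \<cdot>\<^bsub>V P\<^esub> rho p" .
  have "pull p (lam_inv i) \<cdot>\<^bsub>V P\<^esub> b = (pull p (lam_inv i) \<cdot>\<^bsub>V P\<^esub> (b \<cdot>\<^bsub>V P\<^esub> lam q)) \<cdot>\<^bsub>V P\<^esub> lam_inv q"
    using b iA qA Ar eqs ob by (simp add: decat_simps)
  also have "\<dots> = ((pull p (lam_inv i) \<cdot>\<^bsub>V P\<^esub> pull p (lam i)) \<cdot>\<^bsub>V P\<^esub> lam p) \<cdot>\<^bsub>V P\<^esub> lam_inv q"
    unfolding b_def r' using iA qA Ar eqs ob by (simp add: decat_simps)
  also have "\<dots> = lam p \<cdot>\<^bsub>V P\<^esub> lam_inv q" unfolding pl using Ar eqs ob by (simp add: decat_simps)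
  finally have bE: "pull p (lam_inv i) \<cdot>\<^bsub>V P\<^esub> b = lam p \<cdot>\<^bsub>V P\<^esub> lam_inv q" .
  have gl: "g \<cdot>\<^bsub>V P\<^esub> pull q (lam u) \<in> Hom (V P) (pull_ob q (X L)) (pull_ob q (pull_ob u (Y K)))"
    using g l qA eqs ob by (simp add: mackey_simps)
  have uX: "pull_ob u (Y K) \<in> Ob (V L)" "X L \<in> Ob (V L)" 
    using XY Ar eqs ob X_in_Ob[OF ob(2)] by (auto simp: mackey_simps)
  have "Res N u (Ind N i m) = rho u \<cdot>\<^bsub>V L\<^esub> (transfer q (pull_ob u (X K)) (pull_ob u (Y K)) g \<cdot>\<^bsub>V L\<^esub> lam u)"
    using Res_eq[OF Ar(2) eqs(5,2) Ind_in_Hom[OF J(1) eqs(3,1) m]] Ind_eq[OF J(1) eqs(3,1) m] t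
    by (simp add: f_def)
  also have "\<dots> = transfer q (X L) (Y L) (pull q (rho u) \<cdot>\<^bsub>V P\<^esub> (g \<cdot>\<^bsub>V P\<^esub> pull q (lam u)))"
    unfolding transfer_Cmp[OF J(2) eqs(6,8) uX(1) l g] Cmp_transfer[OF J(2) eqs(6,8) uX(2) r gl] ..
  also have "pull q (rho u) \<cdot>\<^bsub>V P\<^esub> (g \<cdot>\<^bsub>V P\<^esub> pull q (lam u)) = a \<cdot>\<^bsub>V P\<^esub> (pull p f \<cdot>\<^bsub>V P\<^esub> b)"
    using f cY dX r l qA Ar eqs ob by (simp add: g_def a_def b_def mackey_simps)
  also have "\<dots> = (a \<cdot>\<^bsub>V P\<^esub> pull p (rho_inv i)) \<cdot>\<^bsub>V P\<^esub> (pull p m \<cdot>\<^bsub>V P\<^esub> (pull p (lam_inv i) \<cdot>\<^bsub>V P\<^esub> b))"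
    using a b m iA Ar eqs ob by (simp add: f_def decat_simps)
  also have "\<dots> = rho_inv q \<cdot>\<^bsub>V P\<^esub> (Res N p m \<cdot>\<^bsub>V P\<^esub> lam_inv q)"
    unfolding aE bE Res_eq[OF Ar(1) eqs(7,4) m] using m iA qA Ar eqs ob by (simp add: decat_simps)
  also have "transfer q (X L) (Y L) \<dots> = Ind N q (Res N p m)"
    by (rule Ind_eq[OF J(2) eqs(8,6) Res_in_Hom[OF Ar(1) eqs(7,4) m], symmetric])
  finally show ?thesis .
qed

lemma untwist:
  assumes "u \<in> Ar G" "Src G u = H" "Tgt G u = K" "m \<in> Hom (V H) (X H) (Y H)"
  shows "rho u \<cdot>\<^bsub>V H\<^esub> ((rho_inv u \<cdot>\<^bsub>V H\<^esub> (m \<cdot>\<^bsub>V H\<^esub> lam_inv u)) \<cdot>\<^bsub>V H\<^esub> lam u) = m"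
  using assms ends_in_Ob[OF assms(1,3,2)] by (simp add: decat_simps)

lemma Res_sum_Ind:
  assumes c: "coproduct G [x, y] c [i, j]" 
    and m: "m \<in> Hom (V x) (X x) (Y x)" and n: "n \<in> Hom (V y) (X y) (Y y)"
  shows "Res N i (Add (V c) (Ind N i m) (Ind N j n)) = m"
    and "Res N j (Add (V c) (Ind N i m) (Ind N j n)) = n"
proof -
  note cp = coproduct_Ar[OF c] and J = coproduct_inclusions_in_J[OF c]
  note je = coproduct_joint_equivalence[OF c]
  have XY: "X c \<in> Ob (V c)" "Y c \<in> Ob (V c)" using X_in_Ob Y_in_Ob cp by auto
  note f = twist_in_Hom[OF cp(1,3,5) m] and g = twist_in_Hom[OF cp(2,4,6) n]
  interpret x: linear_category k "V x" using cp by (simp add: V_linear)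
  interpret y: linear_category k "V y" using cp by (simp add: V_linear)
  note ti = transfer_in_Hom[OF J(1) cp(5,3) XY f] and tj = transfer_in_Hom[OF J(2) cp(6,4) XY g]
  note pi = pull_transfer_coproduct[OF je J(1) cp(2,5,3,6,4) XY f]
  note pj = pull_transfer_coproduct[OF joint_equivalence_sym[OF je] J(2) cp(1,6,4,5,3) XY g]
  note s = Add_in_Hom[OF cp(9) ti tj]
  show "Res N i (Add (V c) (Ind N i m) (Ind N j n)) = m"
    unfolding Ind_eq[OF J(1) cp(3,5) m] Ind_eq[OF J(2) cp(4,6) n] Res_eq[OF cp(1,3,5) s]
      pull_Add[OF cp(1,5,3) ti tj] pi(1) pj(2) x.Add_Zero_right[OF f] by (rule untwist[OF cp(1,3,5) m])
  show "Res N j (Add (V c) (Ind N i m) (Ind N j n)) = n"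
    unfolding Ind_eq[OF J(1) cp(3,5) m] Ind_eq[OF J(2) cp(4,6) n] Res_eq[OF cp(2,4,6) s]
      pull_Add[OF cp(2,6,4) ti tj] pi(2) pj(1) y.Add_Zero_left[OF g] by (rule untwist[OF cp(2,4,6) n])
qed

lemma sum_Ind_Res:
  assumes c: "coproduct G [x, y] c [i, j]" and m: "m \<in> Hom (V c) (X c) (Y c)"
  shows "Add (V c) (Ind N i (Res N i m)) (Ind N j (Res N j m)) = m"
proof -
  note cp = coproduct_Ar[OF c] and J = coproduct_inclusions_in_J[OF c]
  have "Ind N i (Res N i m) = transfer i (X c) (Y c) (pull i m)"
    using Ind_eq[OF J(1) cp(3,5) Res_in_Hom[OF cp(1,3,5) m]] Res_eq[OF cp(1,3,5) m] m cp by (simp add: decat_simps)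
  moreover have "Ind N j (Res N j m) = transfer j (X c) (Y c) (pull j m)"
    using Ind_eq[OF J(2) cp(4,6) Res_in_Hom[OF cp(2,4,6) m]] Res_eq[OF cp(2,4,6) m] m cp by (simp add: decat_simps)
  ultimately show ?thesis using transfer_coproduct_sum[OF c m] by simp
qed

lemma sandwich_linear:
  assumes x: "x \<in> Ob G" and r: "r \<in> Hom (V x) b b'" and l: "l \<in> Hom (V x) a' a"
    and f: "f \<in> Hom (V x) a b"
  shows "g \<in> Hom (V x) a b \<Longrightarrow> r \<cdot>\<^bsub>V x\<^esub> (Add (V x) f g \<cdot>\<^bsub>V x\<^esub> l) =
      Add (V x) (r \<cdot>\<^bsub>V x\<^esub> (f \<cdot>\<^bsub>V x\<^esub> l)) (r \<cdot>\<^bsub>V x\<^esub> (g \<cdot>\<^bsub>V x\<^esub> l))"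
    and "c \<in> carrier k \<Longrightarrow> r \<cdot>\<^bsub>V x\<^esub> (Scal (V x) c f \<cdot>\<^bsub>V x\<^esub> l) = Scal (V x) c (r \<cdot>\<^bsub>V x\<^esub> (f \<cdot>\<^bsub>V x\<^esub> l))"
proof -
  interpret x: linear_category k "V x" using x by (simp add: V_linear)
  show "g \<in> Hom (V x) a b \<Longrightarrow> r \<cdot>\<^bsub>V x\<^esub> (Add (V x) f g \<cdot>\<^bsub>V x\<^esub> l) =
      Add (V x) (r \<cdot>\<^bsub>V x\<^esub> (f \<cdot>\<^bsub>V x\<^esub> l)) (r \<cdot>\<^bsub>V x\<^esub> (g \<cdot>\<^bsub>V x\<^esub> l))"
    by (simp add: x.Cmp_Add_left[OF l f] x.Cmp_Add_right[OF x.Cmp_in_Hom[OF l f] x.Cmp_in_Hom[OF l] r])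
  show "c \<in> carrier k \<Longrightarrow> r \<cdot>\<^bsub>V x\<^esub> (Scal (V x) c f \<cdot>\<^bsub>V x\<^esub> l) = Scal (V x) c (r \<cdot>\<^bsub>V x\<^esub> (f \<cdot>\<^bsub>V x\<^esub> l))"
    by (simp add: x.Cmp_Scal_left[OF _ l f] x.Cmp_Scal_right[OF _ x.Cmp_in_Hom[OF l f] r])
qed

lemma Res_linear_map:
  assumes u: "u \<in> Ar G"
  shows "linear_map k (Mod N (Tgt G u)) (Mod N (Src G u)) (Res N u)"
  unfolding linear_map_def carrier_N add_N smult_N
proof (intro conjI ballI Pi_I)
  let ?K = "Tgt G u" and ?H = "Src G u"
  have ob: "?K \<in> Ob G" "?H \<in> Ob G" using u by (auto simp: G_simps)
  fix f assume f: "f \<in> Hom (V ?K) (X ?K) (Y ?K)"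
  show "Res N u f \<in> Hom (V ?H) (X ?H) (Y ?H)" by (rule Res_in_Hom[OF u refl refl f])
  have push: "pull u f \<in> Hom (V ?H) (pull_ob u (X ?K)) (pull_ob u (Y ?K))" using f u by (simp add: mackey_simps)
  { fix g assume g: "g \<in> Hom (V ?K) (X ?K) (Y ?K)"
    have pg: "pull u g \<in> Hom (V ?H) (pull_ob u (X ?K)) (pull_ob u (Y ?K))" using g u by (simp add: mackey_simps)
    show "Res N u (Add (V ?K) f g) = Add (V ?H) (Res N u f) (Res N u g)"
      unfolding Res_eq[OF u refl refl f] Res_eq[OF u refl refl g] 
        Res_eq[OF u refl refl Add_in_Hom[OF ob(1) f g]] pull_Add[OF u refl refl f g]
      by (rule sandwich_linear(1)[OF ob(2) rho_in_Hom[OF u] lam_in_Hom[OF u] push pg]) }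
  { fix c assume c: "c \<in> carrier k"
    have "pull u (Scal (V ?K) c f) = Scal (V ?H) c (pull u f)"
      using Pull_functor[OF u] c f by (auto simp: linear_functor_def Hom_def)
    then show "Res N u (Scal (V ?K) c f) = Scal (V ?H) c (Res N u f)"
      unfolding Res_eq[OF u refl refl f] Res_eq[OF u refl refl Scal_in_Hom[OF ob(1) c f]]
      using sandwich_linear(2)[OF ob(2) rho_in_Hom[OF u] lam_in_Hom[OF u] push c] by simp }
qed

lemma Ind_linear_map:
  assumes u: "u \<in> J"
  shows "linear_map k (Mod N (Src G u)) (Mod N (Tgt G u)) (Ind N u)"
  unfolding linear_map_def carrier_N add_N smult_N
proof (intro conjI ballI Pi_I)
  let ?K = "Tgt G u" and ?H = "Src G u"
  have ob: "?K \<in> Ob G" "?H \<in> Ob G" using J_Ar[OF u] by (auto simp: G_simps)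
  have XY: "X ?K \<in> Ob (V ?K)" "Y ?K \<in> Ob (V ?K)" using X_in_Ob Y_in_Ob ob by auto
  fix f assume f: "f \<in> Hom (V ?H) (X ?H) (Y ?H)"
  show "Ind N u f \<in> Hom (V ?K) (X ?K) (Y ?K)" by (rule Ind_in_Hom[OF u refl refl f])
  note tf = twist_in_Hom[OF J_Ar[OF u] refl refl f]
  have r: "rho_inv u \<in> Hom (V ?H) (Y ?H) (pull_ob u (Y ?K))" and l: "lam_inv u \<in> Hom (V ?H) (pull_ob u (X ?K)) (X ?H)"
    using J_Ar[OF u] by (auto simp: decat_simps)
  { fix g assume g: "g \<in> Hom (V ?H) (X ?H) (Y ?H)"
    note tg = twist_in_Hom[OF J_Ar[OF u] refl refl g]
    show "Ind N u (Add (V ?H) f g) = Add (V ?K) (Ind N u f) (Ind N u g)"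
      unfolding Ind_eq[OF u refl refl f] Ind_eq[OF u refl refl g] 
        Ind_eq[OF u refl refl Add_in_Hom[OF ob(2) f g]] sandwich_linear(1)[OF ob(2) r l f g]
      by (rule transfer_Add[OF u refl refl XY tf tg]) }
  { fix c assume c: "c \<in> carrier k"
    show "Ind N u (Scal (V ?H) c f) = Scal (V ?K) c (Ind N u f)"
      unfolding Ind_eq[OF u refl refl f] Ind_eq[OF u refl refl Scal_in_Hom[OF ob(2) c f]] 
        sandwich_linear(2)[OF ob(2) r l f c]
      by (rule transfer_Scal[OF u refl refl XY tf c]) }
qed

theorem hom_decat_mackey_functor: "mackey_functor k G J N"
proof (intro mackey_functor.intro mackey_functor_axioms.intro)
  show "cring k" by unfold_locales
next
  fix x assume x: "x \<in> Ob G"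
  show "module k (Mod N x)"
    using linear_category.Hom_module[OF V_linear[OF x] X_in_Ob[OF x] Y_in_Ob[OF x]]
    by (simp add: hom_decat_def)
next
  fix x m assume x: "x \<in> Ob G" and "m \<in> carrier (Mod N x)"
  then have m: "m \<in> Hom (V x) (X x) (Y x)" by (simp add: carrier_N)
  show "Ind N (Ide G x) m = m" by (rule Ind_identity[OF x m])
  show "Res N (Ide G x) m = m"
    using Res_eq[of "Ide G x" x x m] m x lam_Ide[OF x] rho_Ide[OF x] by (simp add: mackey_simps)
next
  fix u assume "u \<in> Ar G"
  then show "linear_map k (Mod N (Tgt G u)) (Mod N (Src G u)) (Res N u)" by (rule Res_linear_map)
next
  fix u assume "u \<in> J"
  then show "linear_map k (Mod N (Src G u)) (Mod N (Tgt G u)) (Ind N u)" by (rule Ind_linear_map)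
next
  fix u v m assume "u \<in> Ar G" "v \<in> Ar G" "Src G u = Tgt G v" "m \<in> carrier (Mod N (Tgt G u))"
  then show "Res N (u \<cdot>\<^bsub>G\<^esub> v) m = Res N v (Res N u m)" unfolding carrier_N by (rule Res_comp)
next
  fix u v m assume "u \<in> J" "v \<in> J" "Src G u = Tgt G v" "m \<in> carrier (Mod N (Src G v))"
  then show "Ind N (u \<cdot>\<^bsub>G\<^esub> v) m = Ind N u (Ind N v m)" unfolding carrier_N by (rule Ind_comp)
next
  fix u v m assume "isomorphic_1cells G u v" "m \<in> carrier (Mod N (Tgt G u))"
  then show "Res N u m = Res N v m"
    unfolding carrier_N isomorphic_1cells_def using Res_Cell_eq by blast
next
  fix u v m assume "u \<in> J" "v \<in> J" "isomorphic_1cells G u v" "m \<in> carrier (Mod N (Src G u))"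
  then show "Ind N u m = Ind N v m"
    unfolding carrier_N isomorphic_1cells_def using Ind_Cell_eq by blast
next
  fix x y c i j m assume "coproduct G [x, y] c [i, j]" "m \<in> carrier (Mod N c)"
  then show "Ind N i (Res N i m) \<oplus>\<^bsub>Mod N c\<^esub> Ind N j (Res N j m) = m"
    unfolding carrier_N add_N by (rule sum_Ind_Res)
next
  fix x y c i j m n assume "coproduct G [x, y] c [i, j]" "m \<in> carrier (Mod N x)" "n \<in> carrier (Mod N y)"
  then show "Res N i (Ind N i m \<oplus>\<^bsub>Mod N c\<^esub> Ind N j n) = m \<and> Res N j (Ind N i m \<oplus>\<^bsub>Mod N c\<^esub> Ind N j n) = n"
    unfolding carrier_N add_N using Res_sum_Ind by blast
next
  fix i u p q \<gamma> m assume "mackey_square G J i u p q \<gamma>" "m \<in> carrier (Mod N (Src G i))"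
  then show "Res N u (Ind N i m) = Ind N q (Res N p m)"
    unfolding carrier_N by (rule Res_Ind_mackey_square)
qed

text \<open>Inverting \<open>\<lambda>\<close> turns its cocycle condition into the one required of \<open>\<rho>\<close>.\<close>

lemma coherent_family_source: "coherent_family G M X X lam lam_inv"
proof
  fix u v assume u: "u \<in> Ar G" and v: "v \<in> Ar G" and uv: "Src G u = Tgt G v"
  show "lam_inv (u \<cdot>\<^bsub>G\<^esub> v) = lam_inv v \<cdot>\<^bsub>V (Src G v)\<^esub> pull v (lam_inv u)" by (rule lam_inv_Cmp[OF u v uv refl refl])
next
  fix u assume u: "u \<in> Ar G"
  show "lam_inv u \<in> Hom (V (Src G u)) (pull_ob u (X (Tgt G u))) (X (Src G u))"
    using u by (auto simp: decat_simps)
  show "Defs.is_iso (V (Src G u)) (lam_inv u)"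
    using inverse_arrows_sym[OF lam_inverse[OF u refl]] by (auto simp: is_iso_def)
next
  fix x assume x: "x \<in> Ob G"
  show "lam_inv (Ide G x) = Ide (V x) (X x)" by (rule lam_inv_rho_inv_Ide(1)[OF x])
next
  fix \<alpha> u v assume "\<alpha> \<in> Hom2 G u v"
  then show "lam_inv v \<cdot>\<^bsub>V (Src G u)\<^esub> Cell M \<alpha> (X (Tgt G u)) = lam_inv u" by (rule lam_inv_Cell) auto
qed (auto intro: X_in_Ob lam_in_Hom lam_iso lam_Ide lam_Cmp lam_Cell)

lemma coherent_family_target: "coherent_family G M Y Y rho_inv rho"
proof
  fix u v assume u: "u \<in> Ar G" and v: "v \<in> Ar G" and uv: "Src G u = Tgt G v"
  show "rho_inv (u \<cdot>\<^bsub>G\<^esub> v) = pull v (rho_inv u) \<cdot>\<^bsub>V (Src G v)\<^esub> rho_inv v" by (rule rho_inv_Cmp[OF u v uv refl refl])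
next
  fix u assume u: "u \<in> Ar G"
  show "rho_inv u \<in> Hom (V (Src G u)) (Y (Src G u)) (pull_ob u (Y (Tgt G u)))"
    using u by (auto simp: decat_simps)
  show "Defs.is_iso (V (Src G u)) (rho_inv u)"
    using inverse_arrows_sym[OF rho_inverse[OF u refl]] by (auto simp: is_iso_def)
next
  fix x assume x: "x \<in> Ob G"
  show "rho_inv (Ide G x) = Ide (V x) (Y x)" by (rule lam_inv_rho_inv_Ide(2)[OF x])
next
  fix \<alpha> u v assume "\<alpha> \<in> Hom2 G u v"
  then show "Cell M \<alpha> (Y (Tgt G u)) \<cdot>\<^bsub>V (Src G u)\<^esub> rho_inv u = rho_inv v" by (rule rho_inv_Cell) auto
qed (auto intro: Y_in_Ob rho_in_Hom rho_iso rho_Ide rho_Cmp rho_Cell)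

end

section \<open>Composition pairings, Green functors and modules\<close>

text \<open>The middle family occurs twice, as target with \<open>rho\<close> and as source with \<open>mu\<close>. Both are parameters, mutually
inverse on the 1-cells of \<open>G\<close>, so that the two module structures are instances: one has \<open>mu\<close> and the other
has \<open>rho\<close> of the form \<open>inv_family\<close>. Inverting twice recovers a family only on the 1-cells of \<open>G\<close>, so fixing
either one as the inverse of the other would exclude one of the two.\<close>

locale composable_decategorifications =
  XY: hom_decategorification U G J k A M X Y lam rho +
  YZ: hom_decategorification U G J k A M Y Z mu sigma
  for U :: "'s set" and G :: "('g, 'u, 'a) twocat" and J :: "'u set"
    and k :: "'k ring" and A :: ambient and M :: "('k, 'g, 'u, 'a, 'o, 'm) mackey2"
    and X Y Z :: "'g \<Rightarrow> 'o" and lam rho mu sigma :: "'u \<Rightarrow> 'm" +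
  assumes middle_inverse: "u \<in> Ar G \<Longrightarrow> inverse_arrows (Val M (Src G u)) (mu u) (rho u)"
begin

lemma coherent_family_composite: "coherent_family G M X Z lam sigma"
  by unfold_locales (auto intro: XY.X_in_Ob XY.lam_in_Hom XY.lam_iso XY.lam_Ide XY.lam_Cmp XY.lam_Cell
      YZ.Y_in_Ob YZ.rho_in_Hom YZ.rho_iso YZ.rho_Ide YZ.rho_Cmp YZ.rho_Cell)

sublocale XZ: hom_decategorification U G J k A M X Z lam sigma
  by (intro hom_decategorification.intro coherent_family_composite XY.rectified_mackey_2_functor_axioms)

lemma middle_eq:
  assumes u: "u \<in> Ar G"
  shows "mu u = XY.rho_inv u" "YZ.lam_inv u = rho u"
  using inverse_arrows_unique[OF XY.V_category inverse_arrows_sym[OF middle_inverse[OF u]] XY.rho_inverse[OF u refl]]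
    inverse_arrows_unique[OF XY.V_category YZ.lam_inverse[OF u refl] middle_inverse[OF u]]
    u XY.Src_in_Ob by auto

lemma composition_bilinear:
  assumes "x \<in> Ob G" "a \<in> Hom (Val M x) (Y x) (Z x)" "b \<in> Hom (Val M x) (X x) (Y x)"
  shows "a \<cdot>\<^bsub>Val M x\<^esub> b \<in> Hom (Val M x) (X x) (Z x)"
    and "a' \<in> Hom (Val M x) (Y x) (Z x) \<Longrightarrow>
      Add (Val M x) a a' \<cdot>\<^bsub>Val M x\<^esub> b = Add (Val M x) (a \<cdot>\<^bsub>Val M x\<^esub> b) (a' \<cdot>\<^bsub>Val M x\<^esub> b)"
    and "b' \<in> Hom (Val M x) (X x) (Y x) \<Longrightarrow>
      a \<cdot>\<^bsub>Val M x\<^esub> Add (Val M x) b b' = Add (Val M x) (a \<cdot>\<^bsub>Val M x\<^esub> b) (a \<cdot>\<^bsub>Val M x\<^esub> b')"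
    and "c \<in> carrier k \<Longrightarrow> Scal (Val M x) c a \<cdot>\<^bsub>Val M x\<^esub> b = Scal (Val M x) c (a \<cdot>\<^bsub>Val M x\<^esub> b)"
    and "c \<in> carrier k \<Longrightarrow> a \<cdot>\<^bsub>Val M x\<^esub> Scal (Val M x) c b = Scal (Val M x) c (a \<cdot>\<^bsub>Val M x\<^esub> b)"
proof -
  interpret x: linear_category k "Val M x" using assms(1) by (rule XY.V_linear)
  show "a \<cdot>\<^bsub>Val M x\<^esub> b \<in> Hom (Val M x) (X x) (Z x)" using x.Cmp_in_Hom assms by blast
  show "a' \<in> Hom (Val M x) (Y x) (Z x) \<Longrightarrow>
      Add (Val M x) a a' \<cdot>\<^bsub>Val M x\<^esub> b = Add (Val M x) (a \<cdot>\<^bsub>Val M x\<^esub> b) (a' \<cdot>\<^bsub>Val M x\<^esub> b)"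
    using x.Cmp_Add_left assms by blast
  show "b' \<in> Hom (Val M x) (X x) (Y x) \<Longrightarrow>
      a \<cdot>\<^bsub>Val M x\<^esub> Add (Val M x) b b' = Add (Val M x) (a \<cdot>\<^bsub>Val M x\<^esub> b) (a \<cdot>\<^bsub>Val M x\<^esub> b')"
    using x.Cmp_Add_right assms by blast
  show "c \<in> carrier k \<Longrightarrow> Scal (Val M x) c a \<cdot>\<^bsub>Val M x\<^esub> b = Scal (Val M x) c (a \<cdot>\<^bsub>Val M x\<^esub> b)"
    using x.Cmp_Scal_left assms by blast
  show "c \<in> carrier k \<Longrightarrow> a \<cdot>\<^bsub>Val M x\<^esub> Scal (Val M x) c b = Scal (Val M x) c (a \<cdot>\<^bsub>Val M x\<^esub> b)"
    using x.Cmp_Scal_right assms by blast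
qed

text \<open>The middle isomorphisms \<open>\<mu>\<^sub>u\<close> and \<open>\<rho>\<^sub>u\<close> meet and cancel.\<close>

lemma Res_composite:
  assumes u: "u \<in> Ar G" and a: "a \<in> Hom (Val M (Tgt G u)) (Y (Tgt G u)) (Z (Tgt G u))"
    and b: "b \<in> Hom (Val M (Tgt G u)) (X (Tgt G u)) (Y (Tgt G u))"
  shows "Res XZ.N u (a \<cdot>\<^bsub>Val M (Tgt G u)\<^esub> b) = Res YZ.N u a \<cdot>\<^bsub>Val M (Src G u)\<^esub> Res XY.N u b"
proof -
  have ob: "Tgt G u \<in> Ob G" "Src G u \<in> Ob G" using XY.ends_in_Ob[OF u refl refl] by auto
  have ab: "a \<cdot>\<^bsub>Val M (Tgt G u)\<^esub> b \<in> Hom (Val M (Tgt G u)) (X (Tgt G u)) (Z (Tgt G u))"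
    using a b ob by (simp add: XY.mackey_simps)
  show ?thesis
    unfolding XZ.Res_eq[OF u refl refl ab] YZ.Res_eq[OF u refl refl a] XY.Res_eq[OF u refl refl b]
    using a b u ob by (simp add: middle_eq(1) XY.decat_simps YZ.structure_simps(7-9))
qed

text \<open>By naturality of transfer, \<open>a\<close> enters as \<open>u\<^sup>*a\<close>, and \<open>u\<^sup>*a \<rho>\<^sub>u\<^sup>-\<^sup>1 = \<sigma>\<^sub>u\<^sup>-\<^sup>1 Res\<^sub>u(a)\<close> by definition of restriction.
\<open>Ind_Cmp\<close> is the mirror image.\<close>

lemma Cmp_Ind:
  assumes u: "u \<in> J" and a: "a \<in> Hom (Val M (Tgt G u)) (Y (Tgt G u)) (Z (Tgt G u))"
    and b: "b \<in> Hom (Val M (Src G u)) (X (Src G u)) (Y (Src G u))"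
  shows "a \<cdot>\<^bsub>Val M (Tgt G u)\<^esub> Ind XY.N u b = Ind XZ.N u (Res YZ.N u a \<cdot>\<^bsub>Val M (Src G u)\<^esub> b)"
proof -
  note uA = XY.J_Ar[OF u]
  have ob: "Tgt G u \<in> Ob G" "Src G u \<in> Ob G" using XY.ends_in_Ob[OF uA refl refl] by auto
  have r: "Res YZ.N u a \<cdot>\<^bsub>Val M (Src G u)\<^esub> b \<in> Hom (Val M (Src G u)) (X (Src G u)) (Z (Src G u))"
    using YZ.Res_in_Hom[OF uA refl refl a] b ob by (simp add: XY.mackey_simps)
  have "a \<cdot>\<^bsub>Val M (Tgt G u)\<^esub> Ind XY.N u b =
     XY.transfer u (X (Tgt G u)) (Z (Tgt G u))
       (FA (Pull M u) a \<cdot>\<^bsub>Val M (Src G u)\<^esub> (XY.rho_inv u \<cdot>\<^bsub>Val M (Src G u)\<^esub> (b \<cdot>\<^bsub>Val M (Src G u)\<^esub> XY.lam_inv u)))"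
    unfolding XY.Ind_eq[OF u refl refl b]
    by (rule XY.Cmp_transfer[OF u refl refl XY.X_in_Ob[OF ob(1)] a XY.twist_in_Hom[OF uA refl refl b]])
  also have "FA (Pull M u) a \<cdot>\<^bsub>Val M (Src G u)\<^esub> (XY.rho_inv u \<cdot>\<^bsub>Val M (Src G u)\<^esub> (b \<cdot>\<^bsub>Val M (Src G u)\<^esub> XY.lam_inv u)) =
      XZ.rho_inv u \<cdot>\<^bsub>Val M (Src G u)\<^esub> ((Res YZ.N u a \<cdot>\<^bsub>Val M (Src G u)\<^esub> b) \<cdot>\<^bsub>Val M (Src G u)\<^esub> XZ.lam_inv u)"
    unfolding YZ.Res_eq[OF uA refl refl a]
    using a b uA ob by (simp add: middle_eq(1) XY.decat_simps XZ.structure_simps XZ.inverse_cancel)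
  also have "XY.transfer u (X (Tgt G u)) (Z (Tgt G u)) \<dots> = Ind XZ.N u (Res YZ.N u a \<cdot>\<^bsub>Val M (Src G u)\<^esub> b)"
    by (rule XZ.Ind_eq[OF u refl refl r, symmetric])
  finally show ?thesis .
qed

lemma Ind_Cmp:
  assumes u: "u \<in> J" and a: "a \<in> Hom (Val M (Src G u)) (Y (Src G u)) (Z (Src G u))"
    and b: "b \<in> Hom (Val M (Tgt G u)) (X (Tgt G u)) (Y (Tgt G u))"
  shows "Ind YZ.N u a \<cdot>\<^bsub>Val M (Tgt G u)\<^esub> b = Ind XZ.N u (a \<cdot>\<^bsub>Val M (Src G u)\<^esub> Res XY.N u b)"
proof -
  note uA = XY.J_Ar[OF u]
  have ob: "Tgt G u \<in> Ob G" "Src G u \<in> Ob G" using XY.ends_in_Ob[OF uA refl refl] by auto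
  have r: "a \<cdot>\<^bsub>Val M (Src G u)\<^esub> Res XY.N u b \<in> Hom (Val M (Src G u)) (X (Src G u)) (Z (Src G u))"
    using XY.Res_in_Hom[OF uA refl refl b] a ob by (simp add: XY.mackey_simps)
  have "Ind YZ.N u a \<cdot>\<^bsub>Val M (Tgt G u)\<^esub> b =
     XY.transfer u (X (Tgt G u)) (Z (Tgt G u))
       ((YZ.rho_inv u \<cdot>\<^bsub>Val M (Src G u)\<^esub> (a \<cdot>\<^bsub>Val M (Src G u)\<^esub> YZ.lam_inv u)) \<cdot>\<^bsub>Val M (Src G u)\<^esub> FA (Pull M u) b)"
    unfolding YZ.Ind_eq[OF u refl refl a]
    by (rule XY.transfer_Cmp[OF u refl refl YZ.Y_in_Ob[OF ob(1)] b YZ.twist_in_Hom[OF uA refl refl a]])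
  also have "(YZ.rho_inv u \<cdot>\<^bsub>Val M (Src G u)\<^esub> (a \<cdot>\<^bsub>Val M (Src G u)\<^esub> YZ.lam_inv u)) \<cdot>\<^bsub>Val M (Src G u)\<^esub> FA (Pull M u) b =
      XZ.rho_inv u \<cdot>\<^bsub>Val M (Src G u)\<^esub> ((a \<cdot>\<^bsub>Val M (Src G u)\<^esub> Res XY.N u b) \<cdot>\<^bsub>Val M (Src G u)\<^esub> XZ.lam_inv u)"
    unfolding XY.Res_eq[OF uA refl refl b]
    using a b uA ob by (simp add: middle_eq(2) XY.decat_simps XZ.structure_simps)
  also have "XY.transfer u (X (Tgt G u)) (Z (Tgt G u)) \<dots> = Ind XZ.N u (a \<cdot>\<^bsub>Val M (Src G u)\<^esub> Res XY.N u b)"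
    by (rule XZ.Ind_eq[OF u refl refl r, symmetric])
  finally show ?thesis .
qed

end

text \<open>The condition on \<open>rho\<close> covers the families \<open>(\<lambda>, \<lambda>\<^sup>-\<^sup>1)\<close> and \<open>(\<rho>\<^sup>-\<^sup>1, \<rho>)\<close> at the same time.\<close>

locale endomorphism_decategorification = hom_decategorification U G J k A M X X lam rho
  for U :: "'s set" and G :: "('g, 'u, 'a) twocat" and J :: "'u set"
    and k :: "'k ring" and A :: ambient and M :: "('k, 'g, 'u, 'a, 'o, 'm) mackey2"
    and X :: "'g \<Rightarrow> 'o" and lam rho :: "'u \<Rightarrow> 'm" +
  assumes lam_rho_inverse: "u \<in> Ar G \<Longrightarrow> inverse_arrows (Val M (Src G u)) (lam u) (rho u)"
begin

sublocale composable_decategorifications U G J k A M X X X lam rho lam rho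
  by unfold_locales (rule lam_rho_inverse)

lemma ring_at_N: "ring_at N (comp_mul M) (id_unit M X) x = End_ring (V x) (X x)"
  by (simp add: ring_at_def End_ring_def hom_decat_def hom_module_def comp_mul_def id_unit_def fun_eq_iff)

theorem hom_decat_green_functor: "green_functor k G J N (comp_mul M) (id_unit M X)"
proof (intro green_functor.intro green_functor_axioms.intro hom_decat_mackey_functor)
  fix x assume x: "x \<in> Ob G"
  interpret x: linear_category k "V x" using x by (rule V_linear)
  show "ring (ring_at N (comp_mul M) (id_unit M X) x)"
    unfolding ring_at_N using x X_in_Ob by (intro x.ring_End_ring)
next
  fix x c a b assume "x \<in> Ob G" and *: "c \<in> carrier k" "a \<in> carrier (Mod N x)" "b \<in> carrier (Mod N x)"
  then interpret x: linear_category k "V x" by (intro V_linear)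
  show "comp_mul M x (c \<odot>\<^bsub>Mod N x\<^esub> a) b = c \<odot>\<^bsub>Mod N x\<^esub> comp_mul M x a b"
    "comp_mul M x a (c \<odot>\<^bsub>Mod N x\<^esub> b) = c \<odot>\<^bsub>Mod N x\<^esub> comp_mul M x a b"
    using * x.Cmp_Scal_left x.Cmp_Scal_right unfolding carrier_N smult_N comp_mul_def by blast+
qed (auto simp: carrier_N comp_mul_def intro: Res_composite Cmp_Ind Ind_Cmp)

end

context hom_decategorification
begin

text \<open>The pairing of the families \<open>X\<close>, \<open>Y\<close>, \<open>Y\<close>; for the right module below, of \<open>X\<close>, \<open>X\<close>, \<open>Y\<close>.\<close>

theorem hom_decat_left_module:
  "green_left_module k G J (hom_decat G M Y Y rho_inv rho) (comp_mul M) (id_unit M Y) N (comp_mul M)"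
proof -
  interpret R: hom_decategorification U G J k A M Y Y rho_inv rho
    by (intro hom_decategorification.intro coherent_family_target rectified_mackey_2_functor_axioms)
  interpret R: endomorphism_decategorification U G J k A M Y rho_inv rho
    by unfold_locales (rule inverse_arrows_sym[OF rho_inverse[OF _ refl]])
  interpret P: composable_decategorifications U G J k A M X Y Y lam rho rho_inv rho
    by unfold_locales (rule inverse_arrows_sym[OF rho_inverse[OF _ refl]])
  show ?thesis
  proof (intro green_left_module.intro green_left_module_axioms.intro R.hom_decat_green_functor hom_decat_mackey_functor;
      unfold carrier_N R.carrier_N add_N R.add_N smult_N R.smult_N comp_mul_def id_unit_def)
    fix x a b n assume "x \<in> Ob G" "a \<in> Hom (V x) (Y x) (Y x)" "b \<in> Hom (V x) (Y x) (Y x)" "n \<in> Hom (V x) (X x) (Y x)"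
    then show "a \<cdot>\<^bsub>V x\<^esub> b \<cdot>\<^bsub>V x\<^esub> n = a \<cdot>\<^bsub>V x\<^esub> (b \<cdot>\<^bsub>V x\<^esub> n)" by (simp add: mackey_simps)
  next
    fix x n assume "x \<in> Ob G" "n \<in> Hom (V x) (X x) (Y x)"
    then show "Ide (V x) (Y x) \<cdot>\<^bsub>V x\<^esub> n = n" by (simp add: mackey_simps)
  qed (rule P.composition_bilinear P.Res_composite P.Cmp_Ind P.Ind_Cmp; assumption)+
qed

theorem hom_decat_right_module:
  "green_right_module k G J (hom_decat G M X X lam lam_inv) (comp_mul M) (id_unit M X) N (comp_mul M)"
proof -
  interpret R: hom_decategorification U G J k A M X X lam lam_inv
    by (intro hom_decategorification.intro coherent_family_source rectified_mackey_2_functor_axioms)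
  interpret R: endomorphism_decategorification U G J k A M X lam lam_inv
    by unfold_locales (rule lam_inverse[OF _ refl])
  interpret P: composable_decategorifications U G J k A M X X Y lam lam_inv lam rho
    by unfold_locales (rule lam_inverse[OF _ refl])
  show ?thesis
  proof (intro green_right_module.intro green_right_module_axioms.intro R.hom_decat_green_functor hom_decat_mackey_functor;
      unfold carrier_N R.carrier_N add_N R.add_N smult_N R.smult_N comp_mul_def id_unit_def)
    fix x a b n assume "x \<in> Ob G" "n \<in> Hom (V x) (X x) (Y x)" "a \<in> Hom (V x) (X x) (X x)" "b \<in> Hom (V x) (X x) (X x)"
    then show "n \<cdot>\<^bsub>V x\<^esub> (a \<cdot>\<^bsub>V x\<^esub> b) = n \<cdot>\<^bsub>V x\<^esub> a \<cdot>\<^bsub>V x\<^esub> b" by (simp add: mackey_simps)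
  next
    fix x n assume "x \<in> Ob G" "n \<in> Hom (V x) (X x) (Y x)"
    then show "n \<cdot>\<^bsub>V x\<^esub> Ide (V x) (X x) = n" by (simp add: mackey_simps)
  qed (rule P.composition_bilinear P.Res_composite P.Cmp_Ind P.Ind_Cmp; assumption)+
qed

end

theorem theorem12p6:
  fixes U :: "'s set" and G :: "('g, 'u, 'a) twocat" and J :: "'u set"
    and k :: "'k ring" and A :: ambient and M :: "('k, 'g, 'u, 'a, 'o, 'm) mackey2"
  assumes "rectified_mackey_2_functor U G J k A M"
  shows
    "(\<forall>X lam. coherent_family G M X X lam (inv_family G M lam) \<longrightarrow>
        (let N = hom_decat G M X X lam (inv_family G M lam) in
         green_functor k G J N (comp_mul M) (id_unit M X) \<and>
         (\<forall>x \<in> Ob G. ring_at N (comp_mul M) (id_unit M X) x = End_ring (Val M x) (X x)) \<and>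
         ((\<forall>x \<in> Ob G. cring (End_ring (Val M x) (X x))) \<longrightarrow>
            commutative_green_functor k G J N (comp_mul M) (id_unit M X))))
     \<and>
     (\<forall>X Y lam rho. coherent_family G M X Y lam rho \<longrightarrow>
        coherent_family G M Y Y (inv_family G M rho) rho \<and>
        coherent_family G M X X lam (inv_family G M lam) \<and>
        green_left_module k G J
          (hom_decat G M Y Y (inv_family G M rho) rho) (comp_mul M) (id_unit M Y)
          (hom_decat G M X Y lam rho) (comp_mul M) \<and>
        green_right_module k G J
          (hom_decat G M X X lam (inv_family G M lam)) (comp_mul M) (id_unit M X)
          (hom_decat G M X Y lam rho) (comp_mul M))"
proof (intro conjI allI impI)
  fix X lam assume "coherent_family G M X X lam (inv_family G M lam)"
  then interpret hom_decategorification U G J k A M X X lam "inv_family G M lam"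
    using assms by (intro hom_decategorification.intro)
  interpret endomorphism_decategorification U G J k A M X lam "inv_family G M lam"
    by unfold_locales (rule lam_inverse[OF _ refl])
  show "let N = hom_decat G M X X lam (inv_family G M lam) in
         green_functor k G J N (comp_mul M) (id_unit M X) \<and>
         (\<forall>x \<in> Ob G. ring_at N (comp_mul M) (id_unit M X) x = End_ring (Val M x) (X x)) \<and>
         ((\<forall>x \<in> Ob G. cring (End_ring (Val M x) (X x))) \<longrightarrow>
            commutative_green_functor k G J N (comp_mul M) (id_unit M X))"
    unfolding Let_def
    by (auto simp: ring_at_N hom_decat_green_functor
        intro!: commutative_green_functor.intro commutative_green_functor_axioms.intro)
next
  fix X Y lam rho assume "coherent_family G M X Y lam rho"
  then interpret hom_decategorification U G J k A M X Y lam rho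
    using assms by (intro hom_decategorification.intro)
  show "coherent_family G M Y Y (inv_family G M rho) rho"
    "coherent_family G M X X lam (inv_family G M lam)"
    "green_left_module k G J
          (hom_decat G M Y Y (inv_family G M rho) rho) (comp_mul M) (id_unit M Y)
          (hom_decat G M X Y lam rho) (comp_mul M)"
    "green_right_module k G J
          (hom_decat G M X X lam (inv_family G M lam)) (comp_mul M) (id_unit M X)
          (hom_decat G M X Y lam rho) (comp_mul M)"
    by (rule coherent_family_target coherent_family_source hom_decat_left_module hom_decat_right_module)+
qed

end
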